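(* Suppose that $\rho_1+\rho_2\neq1$. There exist $U_0<\infty$ and $t_0>0$ (that depend on $\rho_1$ and $\rho_2$ only) such that for $U>U_0$ and $t<t_0$ we have $$ \bigl(\Upsilon_\Lambda,\sigma_\Lambda(x)\Upsilon_\Lambda\bigr)=O\bigl(|\Lambda|^{-\frac1d}\bigr). $$ Here $\Upsilon_\Lambda$ is any ground state of $H_\Lambda$ in the subspace where light and heavy particles have densities $\rho_1$ and $\rho_2$, respectively.
   Context: The asymmetric Hubbard model on $\mathbb{Z}^d$: $\Lambda$ is a finite cube in $\mathbb{Z}^d$, with $|\Lambda|$ sites. $\mathcal{F}(\Lambda)$ is the Fock space for spinless fermions in $\Lambda$, and $\mathcal{F}(\Lambda;N)$ is its subspace corresponding to $N$ particles. The state space is $\mathcal{F}(\Lambda)\otimes\mathcal{F}(\Lambda)$; the first factor describes light particles (species 1) and the second heavy particles (species 2). For $j=1,2$ and $x\in\Lambda$, $c_{xj}^\dagger$ and $c_{xj}$ are the creation and annihilation operators of a fermion of species $j$ at site $x$, and $n_{xj}=c_{xj}^\dagger c_{xj}$ is the particle number operator. With $|\cdot|$ the $\ell_1$ norm on $\mathbb{Z}^d$, the Hamiltonian is $$ H_\Lambda=-\sum_{x,y\in\Lambda,\ |x-y|=1}c_{x1}^\dagger c_{y1}-t\sum_{x,y\in\Lambda,\ |x-y|=1}c_{x2}^\dagger c_{y2}+U\sum_{x\in\Lambda}n_{x1}n_{x2}, $$ where $0\le t\le1$ and $U>0$. $H_\Lambda$ conserves both particle numbers. The densities of light and heavy particles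 are fixed to $\rho_1=N_1/|\Lambda|$ and $\rho_2=N_2/|\Lambda|$, where $N_1$ and $N_2$ are the numbers of light and heavy particles; the subspace with these densities is $\mathcal{F}(\Lambda;N_1)\otimes\mathcal{F}(\Lambda;N_2)$, and a ground state in it is a normalized vector of this subspace minimizing the energy $(\Upsilon,H_\Lambda\Upsilon)$. For $x\in\mathbb{Z}^d$ the correlation operator is $$ \sigma_\Lambda(x)=\frac1{|\Lambda|}\sum_{y\in\Lambda}\bigl[n_{y2}-n_{y+x,2}\bigr]^2 $$ (no separate convention is specified for sites $y+x$ outside $\Lambda$).
   Formalization: The cases ρ1=0 or ρ1=1 with 0<ρ2<1 are excluded: there, at t=0, the Hamiltonian is constant on the subspace, so every normalized state (e.g. a checkerboard of heavy particles) is a ground state and the claimed decay fails. *)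

theory Defs
  imports "HOL-Analysis.Analysis"
begin

type_synonym 'd site = "(int, 'd) vec"

definition l1_norm :: "('d::finite) site \<Rightarrow> int" where
  "l1_norm x = (\<Sum>i\<in>UNIV. \<bar>x $ i\<bar>)"

definition is_cube :: "('d::finite) site set \<Rightarrow> bool" where
  "is_cube \<Lambda> \<longleftrightarrow> (\<exists>a L. L > 0 \<and> \<Lambda> = {x. \<forall>i. a $ i \<le> x $ i \<and> x $ i < a $ i + L})"

definition bonds :: "('d::finite) site set \<Rightarrow> ('d site \<times> 'd site) set" where
  "bonds \<Lambda> = {(x, y) \<in> \<Lambda> \<times> \<Lambda>. l1_norm (x - y) = 1}"

text \<open>
  Fermionic Fock space is realised as the space of antisymmetric wave functions: the value of
  \<open>\<psi>\<close> at a list of length \<open>n\<close> is its \<open>n\<close>-particle component at that tuple of positions.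
  Antisymmetry makes \<open>\<psi>\<close> vanish on lists with repetitions.
\<close>

definition fock :: "'s set \<Rightarrow> ('s list \<Rightarrow> complex) set" where
  "fock \<Lambda> = {\<psi>. (\<forall>xs. \<psi> xs \<noteq> 0 \<longrightarrow> set xs \<subseteq> \<Lambda>) \<and>
     (\<forall>xs \<pi>. \<pi> permutes {..<length xs} \<longrightarrow>
        \<psi> (permute_list \<pi> xs) = of_int (sign \<pi>) * \<psi> xs)}"

definition fock_n :: "'s set \<Rightarrow> nat \<Rightarrow> ('s list \<Rightarrow> complex) set" where
  "fock_n \<Lambda> N = {\<psi> \<in> fock \<Lambda>. \<forall>xs. \<psi> xs \<noteq> 0 \<longrightarrow> length xs = N}"

text \<open>
  The factors \<open>sqrt (n + 1)\<close> and \<open>1 / sqrt n\<close> are the usual ones making the two operators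
  mutually adjoint and satisfying the canonical anticommutation relations on Fock space, for the
  inner product that sums over all ordered tuples of positions.
\<close>

definition annihilate :: "'s \<Rightarrow> ('s list \<Rightarrow> complex) \<Rightarrow> 's list \<Rightarrow> complex" where
  "annihilate x \<psi> xs = of_real (sqrt (real (length xs + 1))) * \<psi> (x # xs)"

definition create :: "'s \<Rightarrow> ('s list \<Rightarrow> complex) \<Rightarrow> 's list \<Rightarrow> complex" where
  "create x \<psi> xs = of_real (1 / sqrt (real (length xs))) *
     (\<Sum>i | i < length xs \<and> xs ! i = x. (-1) ^ i * \<psi> (take i xs @ drop (Suc i) xs))"

text \<open>
  Vectors of the tensor product of two Fock spaces are functions on pairs of lists. For
  finite-dimensional spaces \<open>V\<close> and \<open>W\<close> of functions, their tensor product consists of the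
  functions of two arguments all of whose slices lie in \<open>V\<close> and \<open>W\<close>, respectively.
\<close>

type_synonym 's state = "'s list \<times> 's list \<Rightarrow> complex"

definition tensor :: "('s list \<Rightarrow> complex) set \<Rightarrow> ('s list \<Rightarrow> complex) set \<Rightarrow> 's state set" where
  "tensor V W = {\<Psi>. (\<forall>ys. (\<lambda>xs. \<Psi> (xs, ys)) \<in> V) \<and> (\<forall>xs. (\<lambda>ys. \<Psi> (xs, ys)) \<in> W)}"

text \<open>The operators \<open>A \<otimes> 1\<close> and \<open>1 \<otimes> A\<close>.\<close>

definition on_first :: "(('s list \<Rightarrow> complex) \<Rightarrow> 's list \<Rightarrow> complex) \<Rightarrow> 's state \<Rightarrow> 's state" where
  "on_first A \<Psi> = (\<lambda>(xs, ys). A (\<lambda>xs'. \<Psi> (xs', ys)) xs)"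

definition on_second :: "(('s list \<Rightarrow> complex) \<Rightarrow> 's list \<Rightarrow> complex) \<Rightarrow> 's state \<Rightarrow> 's state" where
  "on_second A \<Psi> = (\<lambda>(xs, ys). A (\<lambda>ys'. \<Psi> (xs, ys')) ys)"

definition inner_state :: "'s set \<Rightarrow> 's state \<Rightarrow> 's state \<Rightarrow> complex" where
  "inner_state \<Lambda> \<Phi> \<Psi> =
     (let P = {xs. set xs \<subseteq> \<Lambda> \<and> distinct xs} in \<Sum>p\<in>P \<times> P. cnj (\<Phi> p) * \<Psi> p)"

definition c1 :: "'s \<Rightarrow> 's state \<Rightarrow> 's state" where
  "c1 x = on_first (annihilate x)"

definition c1_dag :: "'s \<Rightarrow> 's state \<Rightarrow> 's state" where
  "c1_dag x = on_first (create x)"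

definition c2 :: "'s \<Rightarrow> 's state \<Rightarrow> 's state" where
  "c2 x = on_second (annihilate x)"

definition c2_dag :: "'s \<Rightarrow> 's state \<Rightarrow> 's state" where
  "c2_dag x = on_second (create x)"

definition n1 :: "'s \<Rightarrow> 's state \<Rightarrow> 's state" where
  "n1 x = c1_dag x \<circ> c1 x"

definition n2 :: "'s \<Rightarrow> 's state \<Rightarrow> 's state" where
  "n2 x = c2_dag x \<circ> c2 x"

definition hamiltonian ::
  "('d::finite) site set \<Rightarrow> real \<Rightarrow> real \<Rightarrow> 'd site state \<Rightarrow> 'd site state" where
  "hamiltonian \<Lambda> t U \<Psi> = (\<lambda>p.
     - (\<Sum>(x, y)\<in>bonds \<Lambda>. c1_dag x (c1 y \<Psi>) p)
     - of_real t * (\<Sum>(x, y)\<in>bonds \<Lambda>. c2_dag x (c2 y \<Psi>) p)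
     + of_real U * (\<Sum>x\<in>\<Lambda>. n1 x (n2 x \<Psi>) p))"

definition ground_state ::
  "('d::finite) site set \<Rightarrow> real \<Rightarrow> real \<Rightarrow> nat \<Rightarrow> nat \<Rightarrow> 'd site state \<Rightarrow> bool" where
  "ground_state \<Lambda> t U N1 N2 \<Upsilon> \<longleftrightarrow>
     (let V = {\<Psi> \<in> tensor (fock_n \<Lambda> N1) (fock_n \<Lambda> N2). inner_state \<Lambda> \<Psi> \<Psi> = 1};
          E = (\<lambda>\<Psi>. Re (inner_state \<Lambda> \<Psi> (hamiltonian \<Lambda> t U \<Psi>)))
      in \<Upsilon> \<in> V \<and> (\<forall>\<Psi>\<in>V. E \<Upsilon> \<le> E \<Psi>))"

text \<open>
  For \<open>y + x\<close> outside \<open>\<Lambda>\<close>, the operator \<open>n2 (y + x)\<close> annihilates every state supported in \<open>\<Lambda>\<close>,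
  that is, sites outside \<open>\<Lambda>\<close> count as empty.
\<close>

definition correlation ::
  "('d::finite) site set \<Rightarrow> 'd site \<Rightarrow> 'd site state \<Rightarrow> 'd site state" where
  "correlation \<Lambda> x \<Psi> = (\<lambda>p. of_real (1 / real (card \<Lambda>)) *
     (\<Sum>y\<in>\<Lambda>. ((\<lambda>\<Phi> q. n2 y \<Phi> q - n2 (y + x) \<Phi> q) ^^ 2) \<Psi> p))"

end

theory Submission
  imports Defs
begin

text \<open>
  Fix the configuration \<open>W\<close> of the heavy particles in a cube of side \<open>L\<close>. By the Pauli principle the
  light particles have a one-particle density matrix \<open>0 \<le> \<gamma> \<le> 1\<close>. If \<open>\<rho>1 + \<rho>2 < 1\<close>, essentially all of
  them live in the complement \<open>D\<close> of \<open>W\<close>; if \<open>\<rho>1 + \<rho>2 > 1\<close>, they fill that complement and the remaining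
  ones form a partially filled band in \<open>D = W\<close>. In both cases the filling \<open>n\<close> of \<open>D\<close> is a fixed number
  strictly between \<open>0\<close> and \<open>1\<close>. Expanding in plane waves on a discrete torus of side \<open>M > L\<close>, whose Fermi
  level at filling \<open>n\<close> is \<open>\<mu>\<close>, the energy of \<open>\<gamma>\<close> in \<open>D\<close> exceeds its bulk value by a sum over momenta of
  \<open>|\<epsilon> k - \<mu>|\<close> times the squared distance of \<open>\<gamma>\<close> from the Fermi projection. Nearest-neighbour entries
  of the Fermi projection do not vanish, whereas those of \<open>\<gamma>\<close> across the boundary of \<open>D\<close> do. Since few
  momenta lie close to the Fermi surface, uniformly in \<open>M\<close>, the excess is at least a constant \<open>a > 0\<close>
  times the size of the boundary. A large finite \<open>U\<close> costs at most half of this, and hopping of the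
  heavy particles at most \<open>t\<close> times the size of the boundary. A trial state in which \<open>D\<close> is
  essentially a slab has the same bulk energy up to \<open>O(L\<^sup>d\<^sup>-\<^sup>1)\<close>. Hence the expected boundary of \<open>W\<close> in a
  ground state is \<open>O(L\<^sup>d\<^sup>-\<^sup>1)\<close>, and it controls the correlation operator.
\<close>

section \<open>One-body operators on antisymmetric functions\<close>

text \<open>The bulk energy is never computed and no limit of large tori is taken. Given \<rho>1 and
  \<rho>2, the size of D and the filling n are the same for all heavy configurations with N2
  particles. So the lower bound for an arbitrary W and the upper bound from the trial state contain
  the same multiple of the band energy of one and the same finite torus, and it cancels exactly. For
  this the occupation at the Fermi level may be fractional, so that the filling equals n on every
  torus. Tori are used because plane waves diagonalize their hopping; as M > L, the cube does not
  notice the periodicity. What must be uniform is the constant a, which may depend on n and the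
  dimension only. It degenerates at n = 0 and n = 1, where the Fermi projection has no
  nearest-neighbour entries. These fillings belong to \<rho>1 = 0 and \<rho>1 = 1: then the light
  energy is the same for all W, and the heavy particles are free and need not segregate.\<close>

definition words :: "'s set \<Rightarrow> nat \<Rightarrow> 's list set" where
  "words S N = {xs. set xs \<subseteq> S \<and> length xs = N}"

text \<open>Second quantization of the matrix \<open>a\<close>: it acts on each particle in turn.
  Hopping, and the potential that fixed heavy particles exert on the light ones, are both of this
  form.\<close>

definition onebody ::
  "'s set \<Rightarrow> ('s \<Rightarrow> 's \<Rightarrow> complex) \<Rightarrow> ('s list \<Rightarrow> complex) \<Rightarrow> 's list \<Rightarrow> complex" where
  "onebody S a \<psi> xs = (\<Sum>i<length xs. \<Sum>y\<in>S. a (xs ! i) y * \<psi> (xs[i := y]))"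

text \<open>The sum runs over all tuples, including those with repetitions, where antisymmetric
  functions vanish. Over all tuples, sums of products factorize position by position.\<close>

definition mbinner :: "'s set \<Rightarrow> nat \<Rightarrow> ('s list \<Rightarrow> complex) \<Rightarrow> ('s list \<Rightarrow> complex) \<Rightarrow> complex" where
  "mbinner S N \<phi> \<psi> = (\<Sum>xs\<in>words S N. cnj (\<phi> xs) * \<psi> xs)"

definition mbnorm2 :: "'s set \<Rightarrow> nat \<Rightarrow> ('s list \<Rightarrow> complex) \<Rightarrow> real" where
  "mbnorm2 S N \<psi> = (\<Sum>xs\<in>words S N. (cmod (\<psi> xs))\<^sup>2)"

lemma finite_words: "finite S \<Longrightarrow> finite (words S N)"
  unfolding words_def by (rule finite_lists_length_eq)

lemma words_update: "xs \<in> words S N \<Longrightarrow> y \<in> S \<Longrightarrow> xs[i := y] \<in> words S N"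
  by (auto simp: words_def dest: set_update_subset_insert[THEN subsetD])

lemma words_nth: "xs \<in> words S N \<Longrightarrow> i < N \<Longrightarrow> xs ! i \<in> S"
  by (auto simp: words_def)

lemma cnj_mult_self: "cnj z * z = complex_of_real ((cmod z)\<^sup>2)"
  by (metis complex_norm_square mult.commute of_real_power)

lemma mbinner_self: "mbinner S N \<psi> \<psi> = complex_of_real (mbnorm2 S N \<psi>)"
  unfolding mbinner_def mbnorm2_def of_real_sum by (intro sum.cong refl cnj_mult_self)

lemma mbinner_commute: "mbinner S N \<phi> \<psi> = cnj (mbinner S N \<psi> \<phi>)"
  by (simp add: mbinner_def mult.commute)

lemma mbinner_diff_left: "mbinner S N (\<lambda>xs. \<phi> xs - \<phi>' xs) \<psi> = mbinner S N \<phi> \<psi> - mbinner S N \<phi>' \<psi>"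
  by (simp add: mbinner_def algebra_simps sum_subtractf)

lemma mbinner_diff_right: "mbinner S N \<phi> (\<lambda>xs. \<psi> xs - \<psi>' xs) = mbinner S N \<phi> \<psi> - mbinner S N \<phi> \<psi>'"
  by (simp add: mbinner_def algebra_simps sum_subtractf)

lemma mbnorm2_nonneg: "0 \<le> mbnorm2 S N \<psi>"
  by (simp add: mbnorm2_def sum_nonneg)

lemma permute_list_transpose:
  assumes "i < length xs" "j < length xs"
  shows "permute_list (Transposition.transpose i j) xs = xs[i := xs ! j, j := xs ! i]"
proof (rule nth_equalityI)
  fix k assume "k < length (permute_list (Transposition.transpose i j) xs)"
  then have k: "k < length xs" by simp
  have p: "Transposition.transpose i j permutes {..<length xs}"
    using assms by (intro permutes_swap_id) auto
  show "permute_list (Transposition.transpose i j) xs ! k = xs[i := xs ! j, j := xs ! i] ! k"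
    using k assms by (auto simp: permute_list_nth[OF p k] nth_list_update Transposition.transpose_def)
qed simp

lemma fock_swap:
  assumes "\<psi> \<in> fock \<Lambda>" "i < length xs" "j < length xs" "i \<noteq> j"
  shows "\<psi> (xs[i := xs ! j, j := xs ! i]) = - \<psi> xs"
proof -
  have p: "Transposition.transpose i j permutes {..<length xs}"
    using assms by (intro permutes_swap_id) auto
  have "\<psi> (permute_list (Transposition.transpose i j) xs) = of_int (sign (Transposition.transpose i j)) * \<psi> xs"
    using assms(1) p by (simp add: fock_def)
  then show ?thesis using assms by (simp add: permute_list_transpose sign_swap_id)
qed

lemma fock_not_distinct:
  assumes "\<psi> \<in> fock \<Lambda>" "\<not> distinct xs"
  shows "\<psi> xs = 0"
proof -
  obtain i j where ij: "i < length xs" "j < length xs" "i \<noteq> j" "xs ! i = xs ! j"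
    using assms(2) by (auto simp: distinct_conv_nth)
  have "xs[i := xs ! j, j := xs ! i] = xs"
    using ij by (metis list_update_id)
  then have "\<psi> xs = - \<psi> xs" using fock_swap[OF assms(1) ij(1-3)] by simp
  then show ?thesis by simp
qed

lemma fock_n_fock: "\<psi> \<in> fock_n \<Lambda> N \<Longrightarrow> \<psi> \<in> fock \<Lambda>"
  by (simp add: fock_n_def)

lemma fock_n_nonzero:
  "\<psi> \<in> fock_n \<Lambda> N \<Longrightarrow> \<psi> xs \<noteq> 0 \<Longrightarrow> set xs \<subseteq> \<Lambda> \<and> length xs = N \<and> distinct xs"
  using fock_not_distinct[OF fock_n_fock] by (auto simp: fock_n_def fock_def)

text \<open>Moving the entry at position \<open>i\<close> to the front is a product of \<open>i\<close> adjacent swaps.\<close>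

lemma fock_move_front:
  assumes "\<psi> \<in> fock \<Lambda>" "i < length xs"
  shows "\<psi> (xs ! i # take i xs @ drop (Suc i) xs) = (-1) ^ i * \<psi> xs"
  using assms(2)
proof (induction i arbitrary: xs)
  case 0
  then show ?case by (cases xs) auto
next
  case (Suc i)
  define ys where "ys = xs[i := xs ! Suc i, Suc i := xs ! i]"
  have l: "i < length ys" using Suc.prems by (simp add: ys_def)
  have "ys ! i # take i ys @ drop (Suc i) ys = xs ! Suc i # take (Suc i) xs @ drop (Suc (Suc i)) xs"
    using Suc.prems
    by (auto simp: ys_def take_Suc_conv_app_nth Cons_nth_drop_Suc[symmetric] drop_update_cancel
        simp flip: Cons_nth_drop_Suc)
  then have "\<psi> (xs ! Suc i # take (Suc i) xs @ drop (Suc (Suc i)) xs) = (-1) ^ i * \<psi> ys"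
    using Suc.IH[OF l] by simp
  also have "\<psi> ys = - \<psi> xs"
    unfolding ys_def using Suc.prems by (intro fock_swap[OF assms(1)]) auto
  finally show ?case by simp
qed

text \<open>The operator treats all positions alike, so it commutes with permutations of the tuple.
  The hypothesis on \<open>a\<close> keeps the result supported in \<Lambda>.\<close>

lemma onebody_fock_n:
  assumes "\<psi> \<in> fock_n \<Lambda> N" and a: "\<And>x y. x \<notin> \<Lambda> \<Longrightarrow> a x y = 0"
  shows "onebody \<Lambda> a \<psi> \<in> fock_n \<Lambda> N"
proof -
  have f: "\<psi> \<in> fock \<Lambda>" using assms(1) by (rule fock_n_fock)
  have supp: "set xs \<subseteq> \<Lambda> \<and> length xs = N" if nz: "onebody \<Lambda> a \<psi> xs \<noteq> 0" for xs
  proof -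
    obtain i where i: "i < length xs" "(\<Sum>y\<in>\<Lambda>. a (xs ! i) y * \<psi> (xs[i := y])) \<noteq> 0"
      using nz unfolding onebody_def by (metis (no_types, lifting) lessThan_iff sum.neutral)
    obtain y where y: "y \<in> \<Lambda>" "a (xs ! i) y * \<psi> (xs[i := y]) \<noteq> 0"
      using i(2) by (metis (no_types, lifting) sum.neutral)
    have x: "xs ! i \<in> \<Lambda>" using a y(2) by auto
    have s: "set (xs[i := y]) \<subseteq> \<Lambda>" "length xs = N"
      using y(2) fock_n_nonzero[OF assms(1), of "xs[i := y]"] by auto
    have "set xs = set ((xs[i := y])[i := xs ! i])" by simp
    also have "\<dots> \<subseteq> insert (xs ! i) (set (xs[i := y]))" by (rule set_update_subset_insert)
    finally show ?thesis using s x by auto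
  qed
  have anti: "onebody \<Lambda> a \<psi> (permute_list \<pi> xs) = of_int (sign \<pi>) * onebody \<Lambda> a \<psi> xs"
    if p: "\<pi> permutes {..<length xs}" for xs \<pi>
  proof -
    have upd: "(permute_list \<pi> xs)[i := y] = permute_list \<pi> (xs[\<pi> i := y])" if i: "i < length xs" for i y
    proof (rule nth_equalityI)
      fix k assume "k < length ((permute_list \<pi> xs)[i := y])"
      then have k: "k < length xs" by simp
      have "\<pi> i = \<pi> k \<longleftrightarrow> i = k" using permutes_inj[OF p] by (auto dest: injD)
      moreover have "\<pi> k < length xs" using permutes_in_image[OF p, of k] k by auto
      ultimately show "(permute_list \<pi> xs)[i := y] ! k = permute_list \<pi> (xs[\<pi> i := y]) ! k"
        using i k p by (auto simp: nth_list_update permute_list_nth)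
    qed simp
    have "onebody \<Lambda> a \<psi> (permute_list \<pi> xs) =
        (\<Sum>i<length xs. \<Sum>y\<in>\<Lambda>. a (xs ! \<pi> i) y * (of_int (sign \<pi>) * \<psi> (xs[\<pi> i := y])))"
      unfolding onebody_def using f p
      by (auto simp: upd permute_list_nth fock_def intro!: sum.cong)
    also have "\<dots> = (\<Sum>i<length xs. \<Sum>y\<in>\<Lambda>. a (xs ! i) y * (of_int (sign \<pi>) * \<psi> (xs[i := y])))"
      by (rule sum.permute[OF p, unfolded o_def, symmetric])
    also have "\<dots> = of_int (sign \<pi>) * onebody \<Lambda> a \<psi> xs"
      by (simp add: onebody_def sum_distrib_left algebra_simps)
    finally show ?thesis .
  qed
  show ?thesis unfolding fock_n_def fock_def using supp anti by auto
qed

section \<open>One-particle density matrices of antisymmetric functions\<close>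

definition qform :: "'s set \<Rightarrow> ('s \<Rightarrow> 's \<Rightarrow> complex) \<Rightarrow> ('s \<Rightarrow> complex) \<Rightarrow> complex" where
  "qform S \<gamma> f = (\<Sum>x\<in>S. \<Sum>y\<in>S. cnj (f x) * \<gamma> x y * f y)"

definition density_matrix :: "'s set \<Rightarrow> ('s \<Rightarrow> 's \<Rightarrow> complex) \<Rightarrow> bool" where
  "density_matrix S \<gamma> \<longleftrightarrow> (\<forall>x y. \<gamma> y x = cnj (\<gamma> x y)) \<and>
     (\<forall>f. 0 \<le> Re (qform S \<gamma> f) \<and> Re (qform S \<gamma> f) \<le> (\<Sum>x\<in>S. (cmod (f x))\<^sup>2))"

text \<open>The expectation of the creation operator at \<open>y\<close> times the annihilation
  operator at \<open>x\<close>. All positions contribute equally, hence the factor \<open>N\<close>;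
  at \<open>N = 0\<close> this factor makes the truncated \<open>N - 1\<close> harmless.\<close>

definition reduced :: "'s set \<Rightarrow> nat \<Rightarrow> ('s list \<Rightarrow> complex) \<Rightarrow> 's \<Rightarrow> 's \<Rightarrow> complex" where
  "reduced S N \<psi> x y = of_nat N * (\<Sum>r\<in>words S (N - 1). \<psi> (x # r) * cnj (\<psi> (y # r)))"

lemma sum_words_Suc: "(\<Sum>xs\<in>words S (Suc n). F xs) = (\<Sum>x\<in>S. \<Sum>r\<in>words S n. F (x # r))"
proof -
  have "words S (Suc n) = (\<lambda>(x, r). x # r) ` (S \<times> words S n)"
    by (auto simp: words_def image_iff length_Suc_conv)
  moreover have "inj_on (\<lambda>(x, r). x # r) (S \<times> words S n)"
    by (auto simp: inj_on_def)
  ultimately show ?thesis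
    by (simp add: sum.reindex sum.cartesian_product case_prod_unfold)
qed

text \<open>The particle at position i can be exchanged with the one at position 0: the signs from
  the two factors \<psi> cancel, so each of the \<open>N\<close> positions contributes the same
  amount.\<close>

lemma mbinner_onebody:
  assumes \<psi>: "\<psi> \<in> fock_n S N"
  shows "mbinner S N \<psi> (onebody S a \<psi>) = (\<Sum>x\<in>S. \<Sum>y\<in>S. a x y * reduced S N \<psi> y x)"
proof (cases N)
  case 0
  then show ?thesis by (simp add: mbinner_def onebody_def reduced_def words_def)
next
  case (Suc n)
  define A where "A i xs = cnj (\<psi> xs) * (\<Sum>y\<in>S. a (xs ! i) y * \<psi> (xs[i := y]))" for i xs
  have f: "\<psi> \<in> fock S" using \<psi> by (rule fock_n_fock)
  have shift: "(\<Sum>xs\<in>words S N. A i xs) = (\<Sum>xs\<in>words S N. A 0 xs)" if i: "i < N" for i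
  proof (cases "i = 0")
    case False
    define \<sigma> where "\<sigma> xs = xs[0 := xs ! i, i := xs ! 0]" for xs :: "'a list"
    show ?thesis
    proof (rule sum.reindex_bij_witness[of _ \<sigma> \<sigma>])
      fix xs assume xs: "xs \<in> words S N"
      then have l: "length xs = N" by (simp add: words_def)
      have N0: "0 < N" using i by simp
      show \<sigma>\<sigma>: "\<sigma> (\<sigma> xs) = xs" using l i False
        by (auto simp: \<sigma>_def list_eq_iff_nth_eq nth_list_update)
      then show "\<sigma> (\<sigma> xs) = xs" .
      show "\<sigma> xs \<in> words S N" using xs i N0 by (auto simp: \<sigma>_def intro!: words_update words_nth)
      then show "\<sigma> xs \<in> words S N" .
      have anti: "\<psi> (\<sigma> zs) = - \<psi> zs" if "length zs = N" for zs
        unfolding \<sigma>_def using that i False by (intro fock_swap[OF f]) auto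
      have "\<psi> ((\<sigma> xs)[0 := y]) = - \<psi> (xs[i := y])" for y
      proof -
        have "(\<sigma> xs)[0 := y] = \<sigma> (xs[i := y])" using l i False
          by (auto simp: \<sigma>_def list_eq_iff_nth_eq nth_list_update)
        then show ?thesis using anti[of "xs[i := y]"] l by simp
      qed
      moreover have "\<sigma> xs ! 0 = xs ! i" using l i False by (auto simp: \<sigma>_def nth_list_update)
      ultimately show "A 0 (\<sigma> xs) = A i xs"
        by (simp add: A_def anti[OF l] sum_negf)
    qed
  qed simp
  have "mbinner S N \<psi> (onebody S a \<psi>) = (\<Sum>xs\<in>words S N. \<Sum>i<N. A i xs)"
    unfolding mbinner_def onebody_def A_def
    by (intro sum.cong refl) (auto simp: words_def sum_distrib_left)
  also have "\<dots> = (\<Sum>i<N. \<Sum>xs\<in>words S N. A i xs)" by (rule sum.swap)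
  also have "\<dots> = (\<Sum>i<N. \<Sum>xs\<in>words S N. A 0 xs)" by (intro sum.cong refl shift) simp
  also have "\<dots> = of_nat N * (\<Sum>xs\<in>words S N. A 0 xs)" by simp
  also have "(\<Sum>xs\<in>words S N. A 0 xs) =
      (\<Sum>x\<in>S. \<Sum>r\<in>words S n. \<Sum>y\<in>S. a x y * (\<psi> (y # r) * cnj (\<psi> (x # r))))"
    by (simp add: Suc sum_words_Suc A_def sum_distrib_left algebra_simps)
  also have "\<dots> = (\<Sum>x\<in>S. \<Sum>y\<in>S. \<Sum>r\<in>words S n. a x y * (\<psi> (y # r) * cnj (\<psi> (x # r))))"
    by (intro sum.cong refl sum.swap)
  also have "of_nat N * \<dots> = (\<Sum>x\<in>S. \<Sum>y\<in>S. a x y * reduced S N \<psi> y x)"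
    by (simp add: reduced_def Suc sum_distrib_left algebra_simps)
  finally show ?thesis .
qed

text \<open>On triples (tuple, position, new entry), performing the update and remembering the old
  entry is an involution; it moves the update from \<psi> to \<phi>.\<close>

lemma mbinner_onebody_adjoint:
  "mbinner S N \<phi> (onebody S a \<psi>) = mbinner S N (onebody S (\<lambda>x y. cnj (a y x)) \<phi>) \<psi>"
proof -
  have "mbinner S N \<phi> (onebody S a \<psi>) =
      (\<Sum>(xs, i, y)\<in>words S N \<times> {..<N} \<times> S. cnj (\<phi> xs) * (a (xs ! i) y * \<psi> (xs[i := y])))"
    unfolding mbinner_def onebody_def sum.cartesian_product[symmetric]
    by (intro sum.cong refl) (auto simp: words_def sum_distrib_left)
  also have "\<dots> = (\<Sum>(xs, i, y)\<in>words S N \<times> {..<N} \<times> S. a y (xs ! i) * cnj (\<phi> (xs[i := y])) * \<psi> xs)"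
    by (rule sum.reindex_bij_witness[of _ "\<lambda>(xs, i, y). (xs[i := y], i, xs ! i)"
          "\<lambda>(xs, i, y). (xs[i := y], i, xs ! i)"])
      (auto simp: words_update words_nth, auto simp: words_def)
  also have "\<dots> = mbinner S N (onebody S (\<lambda>x y. cnj (a y x)) \<phi>) \<psi>"
    unfolding mbinner_def onebody_def sum.cartesian_product[symmetric]
    by (intro sum.cong refl) (auto simp: words_def sum_distrib_right)
  finally show ?thesis .
qed

text \<open>The projection \<open>f \<otimes> f\<^sup>*\<close> acts on antisymmetric functions as a projection as well: a second
  application at a different position vanishes. This is the Pauli principle.\<close>

lemma onebody_rank_one_idem:
  assumes fin: "finite S" and \<psi>: "\<psi> \<in> fock_n S N" and f1: "(\<Sum>x\<in>S. (cmod (f x))\<^sup>2) = 1"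
    and xs: "xs \<in> words S N"
  defines "T \<equiv> onebody S (\<lambda>x y. if x \<in> S then f x * cnj (f y) else 0)"
  shows "T (T \<psi>) xs = T \<psi> xs"
proof -
  have fk: "\<psi> \<in> fock S" using \<psi> by (rule fock_n_fock)
  have l: "length xs = N" using xs by (simp add: words_def)
  have T: "T \<phi> zs = (\<Sum>i<N. \<Sum>y\<in>S. f (zs ! i) * cnj (f y) * \<phi> (zs[i := y]))"
    if "zs \<in> words S N" for \<phi> zs
    using that unfolding T_def onebody_def by (intro sum.cong) (auto simp: words_def dest: nth_mem)
  have cross: "(\<Sum>y\<in>S. \<Sum>z\<in>S. cnj (f y) * cnj (f z) * \<psi> (xs[i := y, j := z])) = 0"
    if ij: "i < N" "j < N" "i \<noteq> j" for i j
  proof -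
    let ?B = "\<Sum>y\<in>S. \<Sum>z\<in>S. cnj (f y) * cnj (f z) * \<psi> (xs[i := y, j := z])"
    have sw: "\<psi> (xs[i := y, j := z]) = - \<psi> (xs[i := z, j := y])" for z y
    proof -
      have "(xs[i := z, j := y])[i := xs[i := z, j := y] ! j, j := xs[i := z, j := y] ! i]
          = xs[i := y, j := z]"
        using ij l by (auto simp: list_eq_iff_nth_eq nth_list_update)
      then show ?thesis using fock_swap[OF fk, of i "xs[i := z, j := y]" j] ij l by simp
    qed
    have "?B = (\<Sum>y\<in>S. \<Sum>z\<in>S. - (cnj (f z) * cnj (f y) * \<psi> (xs[i := z, j := y])))"
      by (intro sum.cong refl) (subst sw, simp)
    also have "\<dots> = (\<Sum>z\<in>S. \<Sum>y\<in>S. - (cnj (f z) * cnj (f y) * \<psi> (xs[i := z, j := y])))"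
      by (rule sum.swap)
    also have "\<dots> = - ?B" by (simp add: sum_negf)
    finally show ?thesis by simp
  qed
  have inner: "(\<Sum>y\<in>S. f (xs ! i) * cnj (f y) * (\<Sum>z\<in>S. f (xs[i := y] ! j) * cnj (f z) * \<psi> (xs[i := y, j := z])))
      = (if i = j then \<Sum>z\<in>S. f (xs ! i) * cnj (f z) * \<psi> (xs[i := z]) else 0)"
    if ij: "i < N" "j < N" for i j
  proof (cases "i = j")
    case True
    have "(\<Sum>y\<in>S. f (xs ! i) * cnj (f y) * (\<Sum>z\<in>S. f (xs[i := y] ! j) * cnj (f z) * \<psi> (xs[i := y, j := z])))
        = (\<Sum>y\<in>S. cnj (f y) * f y) * (\<Sum>z\<in>S. f (xs ! i) * cnj (f z) * \<psi> (xs[i := z]))"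
      using True ij l by (simp only: sum_distrib_right) (simp add: sum_distrib_left mult.assoc mult.left_commute)
    also have "(\<Sum>y\<in>S. cnj (f y) * f y) = 1"
      by (simp only: cnj_mult_self f1 flip: of_real_sum) simp
    finally show ?thesis using True by simp
  next
    case False
    have "(\<Sum>y\<in>S. f (xs ! i) * cnj (f y) * (\<Sum>z\<in>S. f (xs[i := y] ! j) * cnj (f z) * \<psi> (xs[i := y, j := z])))
        = f (xs ! i) * f (xs ! j) * (\<Sum>y\<in>S. \<Sum>z\<in>S. cnj (f y) * cnj (f z) * \<psi> (xs[i := y, j := z]))"
      using False ij l by (simp add: sum_distrib_left mult_ac)
    then show ?thesis using False cross[OF ij] by simp
  qed
  have "T (T \<psi>) xs = (\<Sum>i<N. \<Sum>y\<in>S. f (xs ! i) * cnj (f y) *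
      (\<Sum>j<N. \<Sum>z\<in>S. f (xs[i := y] ! j) * cnj (f z) * \<psi> (xs[i := y, j := z])))"
    unfolding T[OF xs] by (intro sum.cong refl) (simp add: T words_update[OF xs])
  also have "\<dots> = (\<Sum>i<N. \<Sum>y\<in>S. \<Sum>j<N. f (xs ! i) * cnj (f y) *
      (\<Sum>z\<in>S. f (xs[i := y] ! j) * cnj (f z) * \<psi> (xs[i := y, j := z])))"
    by (simp add: sum_distrib_left)
  also have "\<dots> = (\<Sum>i<N. \<Sum>j<N. \<Sum>y\<in>S. f (xs ! i) * cnj (f y) *
      (\<Sum>z\<in>S. f (xs[i := y] ! j) * cnj (f z) * \<psi> (xs[i := y, j := z])))"
    by (intro sum.cong refl sum.swap)
  also have "\<dots> = (\<Sum>i<N. \<Sum>j<N. if i = j then \<Sum>z\<in>S. f (xs ! i) * cnj (f z) * \<psi> (xs[i := z]) else 0)"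
    by (intro sum.cong refl) (simp add: inner)
  also have "\<dots> = (\<Sum>i<N. \<Sum>z\<in>S. f (xs ! i) * cnj (f z) * \<psi> (xs[i := z]))"
    by (intro sum.cong refl) (simp add: sum.delta')
  also have "\<dots> = T \<psi> xs" unfolding T[OF xs] ..
  finally show ?thesis .
qed

lemma reduced_hermitian: "reduced S N \<psi> y x = cnj (reduced S N \<psi> x y)"
  by (simp add: reduced_def mult.commute)

lemma qform_reduced_nonneg: "0 \<le> Re (qform S (reduced S N \<psi>) f)"
proof -
  have abs2: "Re (of_nat N * (z * cnj z)) = real N * (cmod z)\<^sup>2" for z
    using cmod_power2[of z] by (simp add: power2_eq_square)
  have "qform S (reduced S N \<psi>) f =
      (\<Sum>x\<in>S. \<Sum>y\<in>S. \<Sum>r\<in>words S (N - 1). of_nat N * ((cnj (f x) * \<psi> (x # r)) * cnj (cnj (f y) * \<psi> (y # r))))"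
    by (simp add: qform_def reduced_def sum_distrib_left sum_distrib_right algebra_simps)
  also have "\<dots> = (\<Sum>x\<in>S. \<Sum>r\<in>words S (N - 1). \<Sum>y\<in>S. of_nat N * ((cnj (f x) * \<psi> (x # r)) * cnj (cnj (f y) * \<psi> (y # r))))"
    by (intro sum.cong refl sum.swap)
  also have "\<dots> = (\<Sum>r\<in>words S (N - 1). \<Sum>x\<in>S. \<Sum>y\<in>S. of_nat N * ((cnj (f x) * \<psi> (x # r)) * cnj (cnj (f y) * \<psi> (y # r))))"
    by (rule sum.swap)
  also have "\<dots> = (\<Sum>r\<in>words S (N - 1). of_nat N * ((\<Sum>x\<in>S. cnj (f x) * \<psi> (x # r)) * cnj (\<Sum>x\<in>S. cnj (f x) * \<psi> (x # r))))"
    unfolding cnj_sum sum_product unfolding sum_distrib_left ..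
  also have "Re \<dots> = (\<Sum>r\<in>words S (N - 1). of_nat N * (cmod (\<Sum>x\<in>S. cnj (f x) * \<psi> (x # r)))\<^sup>2)"
    unfolding Re_sum by (intro sum.cong refl abs2)
  finally show ?thesis by (simp add: sum_nonneg)
qed

lemma qform_scale: "qform S \<gamma> (\<lambda>x. c * f x) = complex_of_real ((cmod c)\<^sup>2) * qform S \<gamma> f"
  unfolding cnj_mult_self[symmetric] by (simp add: qform_def sum_distrib_left algebra_simps)

text \<open>For normalized \<open>f\<close> the operator \<open>?T\<close> of the projection onto
  \<open>f\<close> is self-adjoint and idempotent on \<psi>. Its expectation is therefore the
  squared norm of \<open>?T \<psi>\<close>, and subtracting it from the squared norm of \<psi>
  leaves the squared norm of the difference. General \<open>f\<close> follow by scaling.\<close>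

lemma qform_reduced_le:
  assumes fin: "finite S" and \<psi>: "\<psi> \<in> fock_n S N"
  shows "Re (qform S (reduced S N \<psi>) f) \<le> mbnorm2 S N \<psi> * (\<Sum>x\<in>S. (cmod (f x))\<^sup>2)"
proof -
  have unit: "Re (qform S (reduced S N \<psi>) f) \<le> mbnorm2 S N \<psi>" if f1: "(\<Sum>x\<in>S. (cmod (f x))\<^sup>2) = 1" for f
  proof -
    \<comment> \<open>The cut-off keeps \<open>?T \<psi>\<close> supported in \<open>S\<close>,
      although \<open>f\<close> is arbitrary outside \<open>S\<close>.\<close>
    define a where "a x y = (if x \<in> S then f x * cnj (f y) else 0)" for x y
    let ?T = "onebody S a"
    have T\<psi>: "?T \<psi> \<in> fock_n S N" by (rule onebody_fock_n[OF \<psi>]) (simp add: a_def)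
    have q: "mbinner S N \<psi> (?T \<psi>) = qform S (reduced S N \<psi>) f"
      unfolding mbinner_onebody[OF \<psi>] qform_def
      by (subst sum.swap) (intro sum.cong refl, simp add: a_def)
    have "mbinner S N (?T \<psi>) (?T \<psi>) = mbinner S N \<psi> (onebody S (\<lambda>x y. cnj (a y x)) (?T \<psi>))"
      unfolding mbinner_onebody_adjoint[of S N \<psi>] by simp
    also have "\<dots> = mbinner S N \<psi> (?T (?T \<psi>))"
      unfolding mbinner_def onebody_def
      by (intro sum.cong refl arg_cong2[where f = "(*)"]) (auto simp: a_def words_def dest: nth_mem)
    also have "\<dots> = mbinner S N \<psi> (?T \<psi>)"
      unfolding mbinner_def a_def
      by (intro sum.cong refl arg_cong2[where f = "(*)"] onebody_rank_one_idem[OF fin \<psi> f1])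
    finally have TT: "mbinner S N (?T \<psi>) (?T \<psi>) = qform S (reduced S N \<psi>) f" using q by simp
    have qr: "mbinner S N (?T \<psi>) \<psi> = cnj (qform S (reduced S N \<psi>) f)"
      using mbinner_commute q by metis
    have "complex_of_real (mbnorm2 S N (\<lambda>xs. \<psi> xs - ?T \<psi> xs)) =
        mbnorm2 S N \<psi> - cnj (qform S (reduced S N \<psi>) f)"
      unfolding mbinner_self[symmetric] mbinner_diff_left mbinner_diff_right q TT qr by simp
    then have "mbnorm2 S N (\<lambda>xs. \<psi> xs - ?T \<psi> xs) = mbnorm2 S N \<psi> - Re (qform S (reduced S N \<psi>) f)"
      by (metis Re_complex_of_real cnj.sel(1) minus_complex.sel(1))
    then show ?thesis using mbnorm2_nonneg[of S N "\<lambda>xs. \<psi> xs - ?T \<psi> xs"] by simp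
  qed
  define n where "n = (\<Sum>x\<in>S. (cmod (f x))\<^sup>2)"
  show ?thesis
  proof (cases "n = 0")
    case True
    then have "\<forall>x\<in>S. f x = 0" unfolding n_def using fin by (simp add: sum_nonneg_eq_0_iff)
    then have "qform S (reduced S N \<psi>) f = 0" by (simp add: qform_def)
    then show ?thesis using True n_def by simp
  next
    case False
    then have n: "n > 0" unfolding n_def by (simp add: sum_nonneg order_less_le)
    define g where "g x = complex_of_real (1 / sqrt n) * f x" for x
    have "(cmod (complex_of_real (1 / sqrt n)))\<^sup>2 = 1 / n"
      using n by (simp add: norm_divide power_divide)
    moreover have "(\<Sum>x\<in>S. (cmod (g x))\<^sup>2) = (cmod (complex_of_real (1 / sqrt n)))\<^sup>2 * n"
      by (simp only: g_def norm_mult power_mult_distrib n_def sum_distrib_left)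
    ultimately have "(\<Sum>x\<in>S. (cmod (g x))\<^sup>2) = 1" using n by simp
    then have "Re (qform S (reduced S N \<psi>) g) \<le> mbnorm2 S N \<psi>" by (rule unit)
    moreover have "qform S (reduced S N \<psi>) g = complex_of_real (1 / n) * qform S (reduced S N \<psi>) f"
      unfolding g_def qform_scale using \<open>(cmod (complex_of_real (1 / sqrt n)))\<^sup>2 = 1 / n\<close> by simp
    then have "Re (qform S (reduced S N \<psi>) g) = Re (qform S (reduced S N \<psi>) f) / n" by simp
    ultimately show ?thesis using n by (simp add: n_def[symmetric] field_simps)
  qed
qed

lemma reduced_trace:
  assumes "\<psi> \<in> fock_n S N"
  shows "(\<Sum>x\<in>S. reduced S N \<psi> x x) = of_nat N * complex_of_real (mbnorm2 S N \<psi>)"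
proof (cases N)
  case 0
  then show ?thesis by (simp add: reduced_def)
next
  case (Suc n)
  then show ?thesis
    by (simp add: reduced_def mbinner_self[symmetric] mbinner_def sum_words_Suc sum_distrib_left mult.commute)
qed

lemma density_matrix_reduced:
  assumes "finite S" "\<psi> \<in> fock_n S N" "mbnorm2 S N \<psi> = 1"
  shows "density_matrix S (reduced S N \<psi>)"
  unfolding density_matrix_def
proof (intro conjI allI)
  show "reduced S N \<psi> y x = cnj (reduced S N \<psi> x y)" for x y by (rule reduced_hermitian)
  show "0 \<le> Re (qform S (reduced S N \<psi>) f)" for f by (rule qform_reduced_nonneg)
  show "Re (qform S (reduced S N \<psi>) f) \<le> (\<Sum>x\<in>S. (cmod (f x))\<^sup>2)" for f
    using qform_reduced_le[OF assms(1,2), of f] assms(3) by simp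
qed

section \<open>Slater determinants\<close>

definition slater :: "'s set \<Rightarrow> nat \<Rightarrow> (nat \<Rightarrow> 's \<Rightarrow> complex) \<Rightarrow> 's list \<Rightarrow> complex" where
  "slater S N f xs = (if xs \<in> words S N then complex_of_real (1 / sqrt (fact N)) *
     (\<Sum>\<pi> | \<pi> permutes {..<N}. of_int (sign \<pi>) * (\<Prod>i<N. f (\<pi> i) (xs ! i))) else 0)"

lemma slater_fock_n: "slater S N f \<in> fock_n S N"
proof -
  have anti: "slater S N f (permute_list \<tau> xs) = of_int (sign \<tau>) * slater S N f xs"
    if \<tau>: "\<tau> permutes {..<length xs}" for xs \<tau>
  proof (cases "xs \<in> words S N")
    case True
    then have l: "length xs = N" by (simp add: words_def)
    have \<tau>N: "\<tau> permutes {..<N}" using \<tau> l by simp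
    have perm: "permutation \<pi>" if "\<pi> permutes {..<N}" for \<pi>
      using that permutation_permutes by blast
    have "(\<Sum>\<pi> | \<pi> permutes {..<N}. of_int (sign \<pi>) * (\<Prod>i<N. f (\<pi> i) (permute_list \<tau> xs ! i)))
        = (\<Sum>\<pi> | \<pi> permutes {..<N}. of_int (sign (\<pi> \<circ> \<tau>)) * (\<Prod>i<N. f ((\<pi> \<circ> \<tau>) i) (permute_list \<tau> xs ! i)))"
      by (rule sum_permutations_compose_right[OF \<tau>N])
    also have "\<dots> = (\<Sum>\<pi> | \<pi> permutes {..<N}. (of_int (sign \<tau>) :: complex) * (of_int (sign \<pi>) * (\<Prod>i<N. f (\<pi> i) (xs ! i))))"
    proof (intro sum.cong refl)
      fix \<pi> assume "\<pi> \<in> {\<pi>. \<pi> permutes {..<N}}"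
      then have \<pi>: "\<pi> permutes {..<N}" by simp
      have "(\<Prod>i<N. f ((\<pi> \<circ> \<tau>) i) (permute_list \<tau> xs ! i)) = (\<Prod>i<N. f (\<pi> (\<tau> i)) (xs ! \<tau> i))"
        using \<tau> l by (intro prod.cong refl) (simp add: permute_list_nth)
      also have "\<dots> = (\<Prod>i<N. f (\<pi> i) (xs ! i))"
        by (rule prod.permute[OF \<tau>N, unfolded o_def, symmetric])
      finally show "of_int (sign (\<pi> \<circ> \<tau>)) * (\<Prod>i<N. f ((\<pi> \<circ> \<tau>) i) (permute_list \<tau> xs ! i))
          = (of_int (sign \<tau>) :: complex) * (of_int (sign \<pi>) * (\<Prod>i<N. f (\<pi> i) (xs ! i)))"
        using perm[OF \<pi>] perm[OF \<tau>N] by (simp add: sign_compose)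
    qed
    also have "\<dots> = of_int (sign \<tau>) * (\<Sum>\<pi> | \<pi> permutes {..<N}. of_int (sign \<pi>) * (\<Prod>i<N. f (\<pi> i) (xs ! i)))"
      by (rule sum_distrib_left[symmetric])
    finally show ?thesis using True \<tau> by (simp add: slater_def words_def)
  next
    case False
    then have "permute_list \<tau> xs \<notin> words S N" using \<tau> by (auto simp: words_def)
    then show ?thesis using False by (simp add: slater_def)
  qed
  show ?thesis unfolding fock_n_def fock_def using anti
    by (auto simp: slater_def words_def split: if_splits)
qed

lemma slater_nonzero:
  assumes "slater S N f xs \<noteq> 0"
  obtains \<pi> where "\<pi> permutes {..<N}" "\<And>i. i < N \<Longrightarrow> f (\<pi> i) (xs ! i) \<noteq> 0"
proof -
  have "(\<Sum>\<pi> | \<pi> permutes {..<N}. of_int (sign \<pi>) * (\<Prod>i<N. f (\<pi> i) (xs ! i))) \<noteq> 0"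
    using assms by (auto simp: slater_def split: if_splits)
  then obtain \<pi> where "\<pi> permutes {..<N}" "(\<Prod>i<N. f (\<pi> i) (xs ! i)) \<noteq> 0"
    by (metis (mono_tags, lifting) mem_Collect_eq mult_zero_right sum.neutral)
  then show ?thesis using that by auto
qed

lemma sum_words_prod:
  fixes g :: "nat \<Rightarrow> 's \<Rightarrow> complex"
  shows "(\<Sum>xs\<in>words S N. \<Prod>i<N. g i (xs ! i)) = (\<Prod>i<N. \<Sum>x\<in>S. g i x)"
proof (induction N arbitrary: g)
  case 0
  have "words S 0 = {[]}" by (auto simp: words_def)
  then show ?case by simp
next
  case (Suc n)
  have im: "words S (Suc n) = (\<lambda>(x, r). x # r) ` (S \<times> words S n)"
    by (auto simp: words_def image_iff length_Suc_conv)
  have "(\<Sum>xs\<in>words S (Suc n). \<Prod>i<Suc n. g i (xs ! i)) =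
      (\<Sum>x\<in>S. \<Sum>r\<in>words S n. \<Prod>i<Suc n. g i ((x # r) ! i))"
    unfolding im by (subst sum.reindex) (auto simp: inj_on_def sum.cartesian_product case_prod_unfold)
  also have "\<dots> = (\<Sum>x\<in>S. \<Sum>r\<in>words S n. g 0 x * (\<Prod>i<n. g (Suc i) (r ! i)))"
    by (simp add: prod.lessThan_Suc_shift del: prod.lessThan_Suc)
  also have "\<dots> = (\<Sum>x\<in>S. g 0 x) * (\<Sum>r\<in>words S n. \<Prod>i<n. g (Suc i) (r ! i))"
    by (simp add: sum_product)
  also have "(\<Sum>r\<in>words S n. \<Prod>i<n. g (Suc i) (r ! i)) = (\<Prod>i<n. \<Sum>x\<in>S. g (Suc i) x)"
    by (rule Suc.IH)
  finally show ?case by (simp add: prod.lessThan_Suc_shift del: prod.lessThan_Suc)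
qed

text \<open>After expanding the determinants, the sum over tuples factorizes into one-particle
  overlaps. As \<open>g\<close> depends on permutation and position separately, the same formula
  serves for the norm and for a product in which one orbital has been acted on by a matrix.\<close>

lemma slater_overlap:
  "(\<Sum>xs\<in>words S N. cnj (slater S N f xs) *
      (\<Sum>\<pi>' | \<pi>' permutes {..<N}. of_int (sign \<pi>') * (\<Prod>i<N. g \<pi>' i (xs ! i)))) =
   complex_of_real (1 / sqrt (fact N)) * (\<Sum>\<pi> | \<pi> permutes {..<N}. \<Sum>\<pi>' | \<pi>' permutes {..<N}.
      of_int (sign \<pi>) * of_int (sign \<pi>') * (\<Prod>i<N. \<Sum>x\<in>S. cnj (f (\<pi> i) x) * g \<pi>' i x))"
  (is "?L = ?c * _")
proof -
  let ?P = "{\<pi>. \<pi> permutes {..<N}}"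
  have "?L = (\<Sum>xs\<in>words S N. \<Sum>\<pi>\<in>?P. \<Sum>\<pi>'\<in>?P. ?c * (of_int (sign \<pi>) * of_int (sign \<pi>') *
      (\<Prod>i<N. cnj (f (\<pi> i) (xs ! i)) * g \<pi>' i (xs ! i))))"
    by (intro sum.cong refl)
      (simp add: slater_def sum_distrib_left sum_distrib_right prod.distrib mult_ac)
  also have "\<dots> = (\<Sum>\<pi>\<in>?P. \<Sum>xs\<in>words S N. \<Sum>\<pi>'\<in>?P. ?c * (of_int (sign \<pi>) * of_int (sign \<pi>') *
      (\<Prod>i<N. cnj (f (\<pi> i) (xs ! i)) * g \<pi>' i (xs ! i))))"
    by (rule sum.swap)
  also have "\<dots> = (\<Sum>\<pi>\<in>?P. \<Sum>\<pi>'\<in>?P. \<Sum>xs\<in>words S N. ?c * (of_int (sign \<pi>) * of_int (sign \<pi>') *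
      (\<Prod>i<N. cnj (f (\<pi> i) (xs ! i)) * g \<pi>' i (xs ! i))))"
    by (intro sum.cong refl sum.swap)
  also have "\<dots> = (\<Sum>\<pi>\<in>?P. \<Sum>\<pi>'\<in>?P. ?c * (of_int (sign \<pi>) * of_int (sign \<pi>') *
      (\<Prod>i<N. \<Sum>x\<in>S. cnj (f (\<pi> i) x) * g \<pi>' i x)))"
    unfolding sum_distrib_left[symmetric]
      sum_words_prod[where g = "\<lambda>i x. cnj (f (\<pi> i) x) * g \<pi>' i x" for \<pi> \<pi>'] ..
  finally show ?thesis by (simp only: sum_distrib_left)
qed

context
  fixes S :: "'s set" and N :: nat and f :: "nat \<Rightarrow> 's \<Rightarrow> complex"
  assumes fin: "finite S"
    and ortho: "\<And>i j. i < N \<Longrightarrow> j < N \<Longrightarrow> (\<Sum>x\<in>S. cnj (f i x) * f j x) = (if i = j then 1 else 0)"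
begin

lemma inv_sqrt_fact:
  "complex_of_real (1 / sqrt (fact N)) * (complex_of_real (1 / sqrt (fact N)) * of_nat (fact N)) = 1"
proof -
  have "(1 / sqrt (fact N)) * ((1 / sqrt (fact N)) * real (fact N)) = 1"
    by (simp add: field_simps)
  then have "complex_of_real ((1 / sqrt (fact N)) * ((1 / sqrt (fact N)) * real (fact N))) = complex_of_real 1"
    by (simp only:)
  then show ?thesis by (simp only: of_real_mult of_real_of_nat_eq of_real_1)
qed

lemma sign_sq: "of_int (sign p) * of_int (sign p) = (1 :: complex)"
  by (simp flip: of_int_mult)

lemma slater_norm: "mbnorm2 S N (slater S N f) = 1"
proof -
  let ?c = "complex_of_real (1 / sqrt (fact N))"
  let ?P = "{\<pi>. \<pi> permutes {..<N}}"
  have fP: "finite ?P" by (simp add: finite_permutations)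
  have prod: "(\<Prod>i<N. \<Sum>x\<in>S. cnj (f (\<pi> i) x) * f (\<pi>' i) x) = (if \<pi> = \<pi>' then 1 else 0)"
    if \<pi>: "\<pi> \<in> ?P" "\<pi>' \<in> ?P" for \<pi> \<pi>'
  proof -
    have eq: "(\<Sum>x\<in>S. cnj (f (\<pi> i) x) * f (\<pi>' i) x) = (if \<pi> i = \<pi>' i then 1 else 0)" if "i < N" for i
      using that \<pi> permutes_in_image[of _ "{..<N}" i] by (intro ortho) auto
    show ?thesis
    proof (cases "\<pi> = \<pi>'")
      case False
      then obtain i where "\<pi> i \<noteq> \<pi>' i" by auto
      moreover from this have "i < N" using \<pi> by (metis lessThan_iff mem_Collect_eq permutes_not_in)
      ultimately show ?thesis using False eq by auto
    qed (use eq in \<open>auto intro!: prod.neutral\<close>)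
  qed
  have "mbinner S N (slater S N f) (slater S N f) = ?c * (\<Sum>xs\<in>words S N. cnj (slater S N f xs) *
      (\<Sum>\<pi>' | \<pi>' permutes {..<N}. of_int (sign \<pi>') * (\<Prod>i<N. f (\<pi>' i) (xs ! i))))"
    unfolding mbinner_def sum_distrib_left[where r = ?c]
    by (intro sum.cong refl) (simp add: slater_def[of S N f])
  also have "\<dots> = ?c * (?c * (\<Sum>\<pi>\<in>?P. \<Sum>\<pi>'\<in>?P. of_int (sign \<pi>) * of_int (sign \<pi>') *
      (if \<pi> = \<pi>' then 1 else 0)))"
    unfolding slater_overlap[where g = "\<lambda>\<pi> i. f (\<pi> i)"] by (intro arg_cong2[where f = "(*)"] refl sum.cong) (use prod in auto)
  also have "(\<Sum>\<pi>\<in>?P. \<Sum>\<pi>'\<in>?P. of_int (sign \<pi>) * of_int (sign \<pi>') * (if \<pi> = \<pi>' then 1 else (0::complex)))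
      = (\<Sum>\<pi>\<in>?P. of_int (sign \<pi> * sign \<pi>))"
    using fP by (intro sum.cong refl) (simp add: if_distrib[where f = "(*) _"] sum.delta sign_sq cong: if_cong)
  also have "\<dots> = of_nat (fact N)"
    by (simp add: card_permutations[of "{..<N}"])
  also have "?c * (?c * of_nat (fact N)) = 1" by (rule inv_sqrt_fact)
  finally show ?thesis by (metis mbinner_self of_real_eq_1_iff)
qed

text \<open>In \<open>g k\<close> the orbital at position \<open>k\<close> is replaced by its image
  under the matrix, the others are left alone. By orthogonality only equal permutations contribute,
  and averaging over them visits each orbital equally often.\<close>

lemma slater_onebody:
  "mbinner S N (slater S N f) (onebody S a (slater S N f)) =
   (\<Sum>i<N. \<Sum>x\<in>S. \<Sum>y\<in>S. cnj (f i x) * a x y * f i y)"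
proof -
  let ?c = "complex_of_real (1 / sqrt (fact N))"
  let ?P = "{\<pi>. \<pi> permutes {..<N}}"
  have fP: "finite ?P" by (simp add: finite_permutations)
  define af where "af j x = (\<Sum>y\<in>S. a x y * f j y)" for j x
  define g where "g k \<pi> i = (if i = k then af (\<pi> i) else f (\<pi> i))" for k and \<pi> :: "nat \<Rightarrow> nat" and i
  define e where "e j = (\<Sum>x\<in>S. cnj (f j x) * af j x)" for j
  have one: "onebody S a (slater S N f) xs = ?c * (\<Sum>k<N. \<Sum>\<pi>\<in>?P. of_int (sign \<pi>) * (\<Prod>i<N. g k \<pi> i (xs ! i)))"
    if xs: "xs \<in> words S N" for xs
  proof -
    have l: "length xs = N" using xs by (simp add: words_def)
    have "(\<Sum>y\<in>S. a (xs ! k) y * (\<Prod>i<N. f (\<pi> i) (xs[k := y] ! i))) = (\<Prod>i<N. g k \<pi> i (xs ! i))"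
      if k: "k < N" for k and \<pi> :: "nat \<Rightarrow> nat"
    proof -
      have "(\<Prod>i<N. f (\<pi> i) (xs[k := y] ! i)) = f (\<pi> k) y * (\<Prod>i\<in>{..<N} - {k}. f (\<pi> i) (xs ! i))" for y
        using k l by (subst prod.remove[of _ k]) auto
      moreover have "(\<Prod>i<N. g k \<pi> i (xs ! i)) = af (\<pi> k) (xs ! k) * (\<Prod>i\<in>{..<N} - {k}. f (\<pi> i) (xs ! i))"
        using k by (subst prod.remove[of _ k]) (auto simp: g_def)
      ultimately show ?thesis by (simp add: af_def sum_distrib_right mult_ac)
    qed
    then have inner: "(\<Sum>y\<in>S. a (xs ! k) y * (of_int (sign \<pi>) * (\<Prod>i<N. f (\<pi> i) (xs[k := y] ! i))))
        = of_int (sign \<pi>) * (\<Prod>i<N. g k \<pi> i (xs ! i))"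
      if k: "k < N" for k and \<pi> :: "nat \<Rightarrow> nat"
      using k by (simp add: sum_distrib_left[symmetric] mult.left_commute[of "a _ _"])
    have "onebody S a (slater S N f) xs = (\<Sum>k<N. \<Sum>y\<in>S. \<Sum>\<pi>\<in>?P.
        ?c * (a (xs ! k) y * (of_int (sign \<pi>) * (\<Prod>i<N. f (\<pi> i) (xs[k := y] ! i)))))"
      unfolding onebody_def l
      by (intro sum.cong refl)
        (simp add: slater_def words_update[OF xs] sum_distrib_left mult.left_commute[of "a _ _"])
    also have "\<dots> = (\<Sum>k<N. \<Sum>\<pi>\<in>?P. \<Sum>y\<in>S.
        ?c * (a (xs ! k) y * (of_int (sign \<pi>) * (\<Prod>i<N. f (\<pi> i) (xs[k := y] ! i)))))"
      by (intro sum.cong refl sum.swap)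
    also have "\<dots> = (\<Sum>k<N. \<Sum>\<pi>\<in>?P. ?c * (of_int (sign \<pi>) * (\<Prod>i<N. g k \<pi> i (xs ! i))))"
      by (intro sum.cong refl) (simp only: sum_distrib_left[symmetric] inner lessThan_iff)
    finally show ?thesis by (simp only: sum_distrib_left)
  qed
  have prod: "(\<Prod>i<N. \<Sum>x\<in>S. cnj (f (\<pi> i) x) * g k \<pi>' i x) = (if \<pi> = \<pi>' then e (\<pi> k) else 0)"
    if \<pi>: "\<pi> \<in> ?P" "\<pi>' \<in> ?P" and k: "k < N" for \<pi> \<pi>' k
  proof -
    have in_N: "\<pi> i < N" "\<pi>' i < N" if "i < N" for i
      using that \<pi> permutes_in_image[of _ "{..<N}" i] by auto
    have eq: "(\<Sum>x\<in>S. cnj (f (\<pi> i) x) * g k \<pi>' i x) = (if \<pi> i = \<pi>' i then 1 else 0)"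
      if "i < N" "i \<noteq> k" for i
      using that ortho[OF in_N(1) in_N(2)] by (simp add: g_def)
    show ?thesis
    proof (cases "\<pi> = \<pi>'")
      case True
      have "(\<Prod>i<N. \<Sum>x\<in>S. cnj (f (\<pi> i) x) * g k \<pi>' i x) = e (\<pi> k)"
        using k eq True by (subst prod.remove[of _ k]) (auto simp: g_def e_def)
      then show ?thesis using True by simp
    next
      case False
      \<comment> \<open>Permutations that agree away from \<open>k\<close> also agree at
        \<open>k\<close>. Different ones thus differ at a position that still carries plain
        orbitals, and orthogonality makes the product vanish.\<close>
      have "\<exists>i<N. i \<noteq> k \<and> \<pi> i \<noteq> \<pi>' i"
      proof (rule ccontr)
        assume "\<not> ?thesis"
        then have same: "\<pi> i = \<pi>' i" if "i \<noteq> k" for i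
          using that \<pi> by (metis lessThan_iff mem_Collect_eq permutes_not_in)
        have "\<pi> k = \<pi>' k"
        proof (rule ccontr)
          assume ne: "\<pi> k \<noteq> \<pi>' k"
          obtain m where m: "\<pi>' m = \<pi> k" using \<pi>(2) by (metis mem_Collect_eq permutes_surj surjD)
          have "m \<noteq> k" using m ne by auto
          then have "\<pi> m = \<pi> k" using same m by simp
          then show False using \<pi>(1) \<open>m \<noteq> k\<close> by (metis injD mem_Collect_eq permutes_inj)
        qed
        then have "\<pi> = \<pi>'" using same by (intro ext) metis
        then show False using False by simp
      qed
      then obtain i where "i < N" "i \<noteq> k" "\<pi> i \<noteq> \<pi>' i" by auto
      then have "\<exists>i\<in>{..<N}. (\<Sum>x\<in>S. cnj (f (\<pi> i) x) * g k \<pi>' i x) = 0"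
        using eq by (intro bexI[of _ i]) auto
      then show ?thesis using False by simp
    qed
  qed
  have "mbinner S N (slater S N f) (onebody S a (slater S N f)) =
      (\<Sum>xs\<in>words S N. \<Sum>k<N. ?c * (cnj (slater S N f xs) * (\<Sum>\<pi>\<in>?P. of_int (sign \<pi>) * (\<Prod>i<N. g k \<pi> i (xs ! i)))))"
    unfolding mbinner_def by (intro sum.cong refl) (simp add: one sum_distrib_left mult_ac)
  also have "\<dots> = (\<Sum>k<N. ?c * (\<Sum>xs\<in>words S N. cnj (slater S N f xs) * (\<Sum>\<pi>\<in>?P. of_int (sign \<pi>) * (\<Prod>i<N. g k \<pi> i (xs ! i)))))"
    unfolding sum_distrib_left[where r = ?c] by (rule sum.swap)
  also have "\<dots> = (\<Sum>k<N. ?c * (?c * (\<Sum>\<pi>\<in>?P. \<Sum>\<pi>'\<in>?P. of_int (sign \<pi>) * of_int (sign \<pi>') *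
      (if \<pi> = \<pi>' then e (\<pi> k) else 0))))"
    unfolding slater_overlap by (intro arg_cong2[where f = "(*)"] refl sum.cong) (use prod in auto)
  also have "\<dots> = (\<Sum>k<N. ?c * (?c * (\<Sum>\<pi>\<in>?P. e (\<pi> k))))"
  proof (intro sum.cong refl arg_cong2[where f = "(*)"])
    fix k and \<pi> :: "nat \<Rightarrow> nat" assume "\<pi> \<in> ?P"
    then have "(\<Sum>\<pi>'\<in>?P. of_int (sign \<pi>) * of_int (sign \<pi>') * (if \<pi> = \<pi>' then e (\<pi> k) else 0))
        = of_int (sign \<pi> * sign \<pi>) * e (\<pi> k)"
      using fP by (simp add: if_distrib[where f = "(*) _"] sum.delta sign_sq cong: if_cong)
    then show "(\<Sum>\<pi>'\<in>?P. of_int (sign \<pi>) * of_int (sign \<pi>') * (if \<pi> = \<pi>' then e (\<pi> k) else 0)) = e (\<pi> k)"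
      by simp
  qed
  also have "\<dots> = ?c * ?c * (\<Sum>\<pi>\<in>?P. \<Sum>k<N. e (\<pi> k))"
    by (subst sum.swap) (simp add: sum_distrib_left mult.assoc)
  also have "(\<Sum>\<pi>\<in>?P. \<Sum>k<N. e (\<pi> k)) = (\<Sum>\<pi>\<in>?P. \<Sum>k<N. e k)"
  proof (rule sum.cong[OF refl])
    fix \<pi> assume "\<pi> \<in> ?P"
    then have "\<pi> permutes {..<N}" by simp
    from sum.permute[OF this, of e] show "(\<Sum>k<N. e (\<pi> k)) = (\<Sum>k<N. e k)" by (simp add: o_def)
  qed
  also have "\<dots> = of_nat (fact N) * (\<Sum>k<N. e k)"
    by (simp add: card_permutations[of "{..<N}"])
  also have "?c * ?c * (of_nat (fact N) * (\<Sum>k<N. e k)) = (\<Sum>k<N. e k)"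
    using inv_sqrt_fact by (simp only: mult.assoc[symmetric]) simp
  finally show ?thesis by (simp add: e_def af_def sum_distrib_left mult.assoc)
qed

end

section \<open>Plane waves on boxes\<close>

text \<open>Momenta of the discrete torus with side \<open>l i\<close> in direction
  \<open>i\<close>. Unequal sides are allowed because the trial orbitals live in slabs.\<close>

definition modes :: "('d::finite \<Rightarrow> nat) \<Rightarrow> ('d \<Rightarrow> nat) set" where
  "modes l = (\<Pi>\<^sub>E i\<in>UNIV. {..<l i})"

definition wave :: "('d::finite \<Rightarrow> nat) \<Rightarrow> ('d \<Rightarrow> nat) \<Rightarrow> 'd site \<Rightarrow> complex" where
  "wave l k z = (\<Prod>i\<in>UNIV. cis (2 * pi * real (k i) * of_int (z $ i) / real (l i)))"

text \<open>The eigenvalue, on the plane wave \<open>k\<close>, of minus the sum of the shifts by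
  all signed unit vectors.\<close>

definition dispersion :: "('d::finite \<Rightarrow> nat) \<Rightarrow> ('d \<Rightarrow> nat) \<Rightarrow> real" where
  "dispersion l k = - (\<Sum>i\<in>UNIV. 2 * cos (2 * pi * real (k i) / real (l i)))"

definition cuboid :: "'d::finite site \<Rightarrow> ('d \<Rightarrow> nat) \<Rightarrow> 'd site set" where
  "cuboid r l = {x. \<forall>i. r $ i \<le> x $ i \<and> x $ i < r $ i + int (l i)}"

lemma finite_modes [simp]: "finite (modes l)"
  by (auto simp: modes_def intro!: finite_PiE)

lemma card_modes: "card (modes l) = (\<Prod>i\<in>UNIV. l i)"
  by (simp add: modes_def card_PiE)

lemma wave_zero [simp]: "wave l k 0 = 1"
  by (simp add: wave_def)

lemma wave_add: "wave l k (x + y) = wave l k x * wave l k y"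
  by (simp add: wave_def prod.distrib[symmetric] cis_mult distrib_left add_divide_distrib)

lemma wave_minus: "wave l k (- x) = cnj (wave l k x)"
  by (simp add: wave_def cis_cnj)

lemma wave_diff: "wave l k (x - y) = wave l k x * cnj (wave l k y)"
  using wave_add[of l k x "- y"] by (simp add: wave_minus)

lemma norm_wave [simp]: "cmod (wave l k x) = 1"
  by (simp add: wave_def prod_norm[symmetric])

lemma wave_axis: "wave l k (axis i 1) = cis (2 * pi * real (k i) / real (l i))"
proof -
  have "wave l k (axis i 1) = (\<Prod>j\<in>UNIV. if j = i then cis (2 * pi * real (k i) / real (l i)) else 1)"
    unfolding wave_def by (intro prod.cong refl) (simp add: axis_def)
  then show ?thesis by simp
qed

lemma dispersion_wave:
  "complex_of_real (dispersion l k) = - (\<Sum>i\<in>UNIV. wave l k (axis i 1) + wave l k (- axis i 1))"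
  by (simp add: dispersion_def wave_minus wave_axis complex_eq_iff)

lemma dispersion_bound: "\<bar>dispersion l (k :: 'd::finite \<Rightarrow> nat)\<bar> \<le> 2 * real CARD('d)"
proof -
  have "\<bar>dispersion l k\<bar> \<le> (\<Sum>i\<in>(UNIV::'d set). \<bar>2 * cos (2 * pi * real (k i) / real (l i))\<bar>)"
    unfolding dispersion_def abs_minus_cancel by (rule sum_abs)
  also have "\<dots> \<le> (\<Sum>i\<in>(UNIV::'d set). 2)"
    by (intro sum_mono) (simp add: abs_mult)
  finally show ?thesis by simp
qed

lemma sum_cis:
  assumes n: "n > 0"
  shows "(\<Sum>j<n. cis (2 * pi * real j * of_int m / real n)) = (if int n dvd m then of_nat n else 0)"
proof -
  define w where "w = cis (2 * pi * of_int m / real n)"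
  have pw: "cis (2 * pi * real j * of_int m / real n) = w ^ j" for j
    unfolding w_def Complex.DeMoivre by (simp add: field_simps)
  have w1: "w = 1 \<longleftrightarrow> int n dvd m"
  proof
    assume "int n dvd m"
    then obtain q where "m = int n * q" by (auto elim: dvdE)
    then have "w = cis (2 * pi * of_int q)" using n unfolding w_def
      by (intro arg_cong[where f = cis]) (simp add: field_simps)
    moreover have "cis (2 * pi * of_int q) = 1" by (rule cis_multiple_2pi) simp
    ultimately show "w = 1" by (simp only:)
  next
    assume "w = 1"
    then have "cos (2 * pi * of_int m / real n) = 1" by (simp add: w_def complex_eq_iff)
    then obtain q :: int where "2 * pi * of_int m / real n = of_int q * 2 * pi"
      by (auto simp: cos_one_2pi_int)
    then have "real_of_int m = of_int q * real n" using n by (simp add: field_simps)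
    then have "m = q * int n" by (metis of_int_eq_iff of_int_mult of_int_of_nat_eq)
    then show "int n dvd m" by simp
  qed
  have wn: "w ^ n = 1"
  proof -
    have "w ^ n = cis (2 * pi * of_int m)" using n unfolding w_def Complex.DeMoivre by simp
    then show ?thesis by simp
  qed
  show ?thesis unfolding pw
    using w1 wn geometric_sum[of w n] by (cases "w = 1") auto
qed

lemma sum_wave:
  assumes l: "\<And>i. l i > 0"
  shows "(\<Sum>k\<in>modes l. wave l k z) = (if \<forall>i. int (l i) dvd z $ i then of_nat (\<Prod>i\<in>UNIV. l i) else 0)"
proof -
  have "(\<Sum>k\<in>modes l. wave l k z) =
      (\<Prod>i\<in>UNIV. \<Sum>j<l i. cis (2 * pi * real j * of_int (z $ i) / real (l i)))"
    unfolding modes_def wave_def by (subst prod_sum_PiE) auto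
  also have "\<dots> = (\<Prod>i\<in>UNIV. if int (l i) dvd z $ i then of_nat (l i) else 0)"
    by (intro prod.cong refl sum_cis l)
  finally show ?thesis by auto
qed

lemma sum_cuboid:
  fixes g :: "'d::finite \<Rightarrow> int \<Rightarrow> complex"
  shows "(\<Sum>x\<in>cuboid r l. \<Prod>i\<in>UNIV. g i (x $ i)) = (\<Prod>i\<in>UNIV. \<Sum>j<l i. g i (r $ i + int j))"
proof -
  have bound: "nat (x $ i - r $ i) < l i" "r $ i \<le> x $ i" if "x \<in> cuboid r l" for x i
    using that by (auto simp: cuboid_def nat_less_iff diff_less_eq add.commute)
  have "(\<Prod>i\<in>UNIV. \<Sum>j<l i. g i (r $ i + int j)) = (\<Sum>k\<in>modes l. \<Prod>i\<in>UNIV. g i (r $ i + int (k i)))"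
    unfolding modes_def by (subst prod_sum_PiE) auto
  also have "\<dots> = (\<Sum>x\<in>cuboid r l. \<Prod>i\<in>UNIV. g i (x $ i))"
  proof (rule sum.reindex_bij_witness[of _ "\<lambda>x i. nat (x $ i - r $ i)" "\<lambda>k. \<chi> i. r $ i + int (k i)"])
    show "(\<chi> i. r $ i + int (k i)) \<in> cuboid r l" if "k \<in> modes l" for k
      using that by (simp add: cuboid_def modes_def PiE_iff)
    show "(\<lambda>i. nat (x $ i - r $ i)) \<in> modes l" if "x \<in> cuboid r l" for x
      using bound(1)[OF that] by (simp add: modes_def PiE_iff)
    show "(\<chi> i. r $ i + int (nat (x $ i - r $ i))) = x" if "x \<in> cuboid r l" for x
      using bound(2)[OF that] by (simp add: vec_eq_iff)
  qed simp_all
  finally show ?thesis by simp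
qed

lemma card_cuboid: "card (cuboid r l) = (\<Prod>i\<in>UNIV. l i)"
proof -
  have "complex_of_nat (card (cuboid r l)) = of_nat (\<Prod>i\<in>UNIV. l i)"
    using sum_cuboid[of "\<lambda>_ _. 1" r l] by simp
  then show ?thesis by (simp only: of_nat_eq_iff)
qed

lemma finite_cuboid [simp]: "finite (cuboid r l)"
proof (cases "\<forall>i. l i > 0")
  case True
  then have "(\<Prod>i\<in>UNIV. l i) > 0" by (intro prod_pos) auto
  then show ?thesis using card_cuboid[of r l] card_gt_0_iff by metis
next
  case False
  then obtain i where "l i = 0" by auto
  then have "cuboid r l = {}" by (auto simp: cuboid_def) (metis add.right_neutral not_le of_nat_0)
  then show ?thesis by simp
qed

lemma wave_orthogonal:
  assumes l: "\<And>i. l i > 0" and k: "k \<in> modes l" "k' \<in> modes l"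
  shows "(\<Sum>x\<in>cuboid r l. cnj (wave l k x) * wave l k' x) = (if k = k' then of_nat (\<Prod>i\<in>UNIV. l i) else 0)"
proof -
  define G where "G i n = cis (2 * pi * real_of_int ((int (k' i) - int (k i)) * n) / real (l i))" for i n
  have "(\<Sum>x\<in>cuboid r l. cnj (wave l k x) * wave l k' x) = (\<Sum>x\<in>cuboid r l. \<Prod>i\<in>UNIV. G i (x $ i))"
    unfolding wave_def cnj_prod G_def
    by (intro sum.cong refl)
      (simp add: prod.distrib[symmetric] cis_cnj cis_mult algebra_simps diff_divide_distrib)
  also have "\<dots> = (\<Prod>i\<in>UNIV. \<Sum>j<l i. G i (r $ i + int j))"
    by (rule sum_cuboid)
  also have "\<dots> = (\<Prod>i\<in>UNIV. if k i = k' i then of_nat (l i) else 0)"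
  proof (intro prod.cong refl)
    fix i
    define m where "m = int (k' i) - int (k i)"
    have "(\<Sum>j<l i. cis (2 * pi * real_of_int (m * (r $ i + int j)) / real (l i)))
        = cis (2 * pi * real_of_int (m * r $ i) / real (l i)) * (\<Sum>j<l i. cis (2 * pi * real j * of_int m / real (l i)))"
      by (simp add: sum_distrib_left cis_mult algebra_simps add_divide_distrib)
    also have "\<dots> = (if k i = k' i then of_nat (l i) else 0)"
    proof (cases "k i = k' i")
      case False
      have kl: "k i < l i" "k' i < l i" using k by (auto simp: modes_def)
      have "\<not> int (l i) dvd m"
      proof
        assume "int (l i) dvd m"
        moreover have "m \<noteq> 0" using False by (simp add: m_def)
        ultimately have "int (l i) \<le> \<bar>m\<bar>" by (metis abs_of_nat dvd_imp_le_int)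
        then show False using kl by (simp add: m_def)
      qed
      then show ?thesis using False by (simp add: sum_cis[OF l])
    qed (use sum_cis[OF l[of i], of m] in \<open>simp add: m_def\<close>)
    finally show "(\<Sum>j<l i. G i (r $ i + int j)) = (if k i = k' i then of_nat (l i) else 0)"
      by (simp add: m_def G_def)
  qed
  also have "\<dots> = (if k = k' then of_nat (\<Prod>i\<in>UNIV. l i) else 0)"
    by (auto simp: fun_eq_iff)
  finally show ?thesis .
qed

section \<open>Level sets of the dispersion relation\<close>

lemma l1_norm_eq_1_iff: "l1_norm (z :: 'd::finite site) = 1 \<longleftrightarrow> (\<exists>i. z = axis i 1 \<or> z = - axis i 1)"
proof
  assume z: "l1_norm z = 1"
  have "\<exists>i. z $ i \<noteq> 0"
  proof (rule ccontr)
    assume "\<not> ?thesis"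
    then show False using z by (simp add: l1_norm_def)
  qed
  then obtain i where i: "z $ i \<noteq> 0" by auto
  have split: "l1_norm z = \<bar>z $ i\<bar> + (\<Sum>j\<in>UNIV - {i}. \<bar>z $ j\<bar>)"
    unfolding l1_norm_def by (subst sum.remove[of _ i]) auto
  have nn: "0 \<le> (\<Sum>j\<in>UNIV - {i}. \<bar>z $ j\<bar>)" by (intro sum_nonneg) auto
  have i1: "\<bar>z $ i\<bar> = 1" using split z nn i by linarith
  then have "(\<Sum>j\<in>UNIV - {i}. \<bar>z $ j\<bar>) = 0" using split z by linarith
  then have "\<forall>j\<in>UNIV - {i}. \<bar>z $ j\<bar> = 0" by (subst (asm) sum_nonneg_eq_0_iff) auto
  then have "z = axis i (z $ i)" by (auto simp: vec_eq_iff axis_def)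
  moreover have "z $ i = 1 \<or> z $ i = -1" using i1 by linarith
  moreover have "axis i (-1) = - axis i (1::int)" by (simp add: vec_eq_iff axis_def)
  ultimately show "\<exists>i. z = axis i 1 \<or> z = - axis i 1" by metis
next
  have "(\<Sum>j\<in>UNIV. \<bar>axis i (1::int) $ j\<bar>) = 1" for i :: 'd
  proof -
    have "(\<Sum>j\<in>UNIV. \<bar>axis i (1::int) $ j\<bar>) = (\<Sum>j\<in>UNIV. if j = i then 1 else 0)"
      by (intro sum.cong refl) (simp add: axis_def)
    then show ?thesis by simp
  qed
  then show "\<exists>i. z = axis i 1 \<or> z = - axis i 1 \<Longrightarrow> l1_norm z = 1"
    by (auto simp: l1_norm_def)
qed

lemma axis_one_eq_iff: "axis i (1::int) = axis j 1 \<longleftrightarrow> i = j"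
  by (simp add: axis_eq_axis)

lemma axis_ne_minus: "axis i (1::int) \<noteq> - axis j 1"
proof
  assume "axis i (1::int) = - axis j 1"
  then have "axis i (1::int) $ i = (- axis j 1) $ i" by simp
  then show False by (auto simp: axis_def split: if_splits)
qed

text \<open>At most one of the signed unit vectors can equal \<open>z\<close>. This turns adjacency
  into a sum over directions, which the dispersion relation is as well.\<close>

lemma sum_axis_eq:
  "(\<Sum>i\<in>UNIV. of_bool (z = axis i 1) + of_bool (z = - axis i (1::int))) = (of_bool (l1_norm z = 1) :: 'a::semiring_1)"
proof (cases "l1_norm z = 1")
  case True
  then obtain i where i: "z = axis i 1 \<or> z = - axis i 1" by (auto simp: l1_norm_eq_1_iff)
  have "of_bool (z = axis j 1) + of_bool (z = - axis j (1::int)) = (if j = i then (1::'a) else 0)" for j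
  proof (cases "z = axis i 1")
    case True
    then have "z \<noteq> - axis j 1" "z = axis j 1 \<longleftrightarrow> j = i" using axis_ne_minus axis_one_eq_iff by metis+
    then show ?thesis by simp
  next
    case False
    then have "z = - axis i 1" using i by simp
    then have "z \<noteq> axis j 1" "z = - axis j 1 \<longleftrightarrow> j = i"
      using axis_ne_minus axis_one_eq_iff neg_equal_iff_equal by metis+
    then show ?thesis by simp
  qed
  then have "(\<Sum>j\<in>UNIV. of_bool (z = axis j 1) + of_bool (z = - axis j (1::int))) = (\<Sum>j\<in>UNIV. if j = i then (1::'a) else 0)"
    by (intro sum.cong refl)
  then show ?thesis using True by simp
next
  case False
  then show ?thesis unfolding l1_norm_eq_1_iff by simp
qed

text \<open>Points whose coordinates differ by less than \<open>M\<close> are not identified on the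
  torus, so its periodic delta function is the ordinary one.\<close>

lemma sum_wave_small:
  assumes M: "M > 0" and z: "\<And>i. \<bar>z $ i\<bar> < int M"
  shows "(\<Sum>k\<in>modes (\<lambda>_::'d::finite. M). wave (\<lambda>_. M) k z) = of_nat M ^ CARD('d) * of_bool (z = 0)"
proof -
  have "(\<forall>i. int M dvd z $ i) \<longleftrightarrow> z = 0"
  proof
    assume d: "\<forall>i. int M dvd z $ i"
    have "z $ i = 0" for i
    proof (rule ccontr)
      assume "z $ i \<noteq> 0"
      then have "int M \<le> \<bar>z $ i\<bar>" using d by (metis abs_of_nat dvd_imp_le_int)
      then show False using z[of i] by simp
    qed
    then show "z = 0" by (simp add: vec_eq_iff)
  qed simp
  then show ?thesis using sum_wave[of "\<lambda>_. M" z] M by simp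
qed

text \<open>The dispersion relation is the Fourier transform of nearest-neighbour hopping. One unit
  more room than for the delta function is assumed since \<open>z\<close> gets shifted by a unit
  vector.\<close>

lemma sum_dispersion_wave:
  fixes z :: "'d::finite site"
  assumes z: "\<And>i. \<bar>z $ i\<bar> + 1 < int M"
  shows "(\<Sum>k\<in>modes (\<lambda>_::'d. M). complex_of_real (dispersion (\<lambda>_. M) k) * wave (\<lambda>_. M) k z) =
    - (of_nat M ^ CARD('d) * of_bool (l1_norm z = 1))"
proof -
  let ?W = "wave (\<lambda>_::'d. M)" and ?K = "modes (\<lambda>_::'d. M)"
  have M: "M > 0" using z[of undefined] by linarith
  have s: "\<bar>(axis i 1 + z) $ j\<bar> < int M" "\<bar>(- axis i 1 + z) $ j\<bar> < int M" for i j
    using z[of j] by (auto simp: axis_def)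
  have e: "axis i 1 + z = 0 \<longleftrightarrow> z = - axis i 1" "- axis i 1 + z = 0 \<longleftrightarrow> z = axis i 1" for i
    by (simp_all only: add_eq_0_iff minus_minus)
  have "(\<Sum>k\<in>?K. complex_of_real (dispersion (\<lambda>_. M) k) * ?W k z) =
      (\<Sum>k\<in>?K. \<Sum>i\<in>UNIV. - (?W k (axis i 1 + z) + ?W k (- axis i 1 + z)))"
  proof (rule sum.cong[OF refl])
    fix k
    show "complex_of_real (dispersion (\<lambda>_. M) k) * ?W k z = (\<Sum>i\<in>UNIV. - (?W k (axis i 1 + z) + ?W k (- axis i 1 + z)))"
      unfolding dispersion_wave wave_add distrib_right[symmetric] sum_negf sum_distrib_right[symmetric]
      by simp
  qed
  also have "\<dots> = (\<Sum>i\<in>UNIV. \<Sum>k\<in>?K. - (?W k (axis i 1 + z) + ?W k (- axis i 1 + z)))"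
    by (rule sum.swap)
  also have "\<dots> = (\<Sum>i\<in>UNIV. - (of_nat M ^ CARD('d) * (of_bool (z = axis i 1) + of_bool (z = - axis i 1))))"
    unfolding sum_negf sum.distrib sum_wave_small[OF M s(1)] sum_wave_small[OF M s(2)] e
    by (simp only: distrib_left sum.distrib sum_negf add.commute)
  also have "\<dots> = - (of_nat M ^ CARD('d) * of_bool (l1_norm z = 1))"
    by (simp only: sum_negf sum_distrib_left[symmetric] sum_axis_eq)
  finally show ?thesis .
qed

section \<open>Counting momenta close to a given energy\<close>

lemma sin_ge_third:
  fixes x :: real
  assumes "0 \<le> x" "x \<le> pi / 2"
  shows "x / 3 \<le> sin x"
proof -
  have "\<bar>sin x - (\<Sum>m<3. sin_coeff m * x ^ m)\<bar> \<le> inverse (fact 3) * \<bar>x\<bar> ^ 3"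
    by (rule Maclaurin_sin_bound)
  moreover have "(\<Sum>m<3. sin_coeff m * x ^ m) = x"
    by (simp add: numeral_3_eq_3 sin_coeff_def)
  ultimately have "\<bar>sin x - x\<bar> \<le> x ^ 3 / 6"
    using assms by (simp add: fact_numeral)
  then have 1: "x - x ^ 3 / 6 \<le> sin x" by linarith
  have "x < 2" using assms pi_half_less_two by linarith
  then have "x ^ 2 \<le> 2 ^ 2" using assms by (intro power_mono) auto
  then have "x * x ^ 2 \<le> x * 4" using assms by (intro mult_left_mono) auto
  then have "x ^ 3 \<le> 4 * x" by (simp add: power3_eq_cube power2_eq_square)
  then show ?thesis using 1 by linarith
qed

text \<open>Only the residue of \<open>j + m\<close> modulo \<open>M\<close> matters. Because the
  sine is at least a third of its argument on the first quarter period and pi exceeds 3, a small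
  sine forces this residue to lie within \<open>\<tau> * M\<close> of 0 or of
  \<open>M\<close>.\<close>

lemma card_sin_small:
  fixes m :: int
  assumes M: "M > 0" and \<tau>: "\<tau> \<ge> 0"
  shows "real (card {j\<in>{..<M}. \<bar>sin (pi * real_of_int (int j + m) / real M)\<bar> < \<tau>}) \<le> 2 * \<tau> * real M + 2"
proof -
  define q where "q = nat \<lceil>\<tau> * real M\<rceil>"
  have q: "real q < \<tau> * real M + 1" unfolding q_def using \<tau> by (simp add: of_nat_nat ceiling_correct) linarith
  define J where "J = {j\<in>{..<M}. \<bar>sin (pi * real_of_int (int j + m) / real M)\<bar> < \<tau>}"
  define h where "h j = nat ((int j + m) mod int M)" for j
  have inj: "inj_on h J"
  proof (rule inj_onI)
    fix i j assume ij: "i \<in> J" "j \<in> J" "h i = h j"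
    then have "(int i + m) mod int M = (int j + m) mod int M"
      using M by (simp add: h_def nat_eq_iff)
    then have "int M dvd (int i + m) - (int j + m)" by (rule mod_eq_dvd_iff[THEN iffD1])
    then have d: "int M dvd int i - int j" by simp
    have "\<bar>int i - int j\<bar> < int M" using ij by (auto simp: J_def)
    then have "int i - int j = 0" using d by (metis abs_of_nat dvd_imp_le_int not_le)
    then show "i = j" by simp
  qed
  have "h ` J \<subseteq> {..<q} \<union> {j\<in>{..<M}. real (M - j) < \<tau> * real M}"
    (is "_ \<subseteq> _ \<union> ?B")
  proof
    fix r assume "r \<in> h ` J"
    then obtain j where j: "j \<in> J" "r = h j" by auto
    have rM: "r < M" using M by (simp add: j h_def nat_less_iff)
    have r: "int r = (int j + m) mod int M" using M by (simp add: j h_def)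
    define c where "c = (int j + m) div int M"
    have "int j + m = int r + int M * c" unfolding r c_def by simp
    then have "pi * real_of_int (int j + m) / real M = pi * real r / real M + pi * of_int c"
      using M by (simp add: field_simps)
    moreover have "\<bar>sin (x + pi * of_int c)\<bar> = \<bar>sin x\<bar>" for x
      unfolding sin_add sin_npi_int cos_npi_int by simp
    ultimately have s: "\<bar>sin (pi * real r / real M)\<bar> < \<tau>" using j by (simp add: J_def)
    show "r \<in> {..<q} \<union> ?B"
    proof (cases "2 * r \<le> M")
      case True
      have "real (2 * r) \<le> real M" using True by (simp only: of_nat_le_iff)
      then have "pi * real r / real M \<le> pi / 2" using M by (simp add: field_simps)
      then have "(pi * real r / real M) / 3 \<le> sin (pi * real r / real M)" by (intro sin_ge_third) auto
      then have "(pi * real r / real M) / 3 < \<tau>" using s by linarith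
      then have "(pi / 3) * (real r / real M) < \<tau>" by (simp add: field_simps)
      moreover have "1 * (real r / real M) \<le> (pi / 3) * (real r / real M)"
        using pi_gt3 by (intro mult_right_mono) auto
      ultimately have "real r < \<tau> * real M" using M by (simp add: field_simps)
      then have "r < q" unfolding q_def by linarith
      then show ?thesis by simp
    next
      case False
      define r' where "r' = M - r"
      have r': "real r' = real M - real r" using rM by (simp add: r'_def)
      have "real M < real (2 * r)" using False by (simp only: of_nat_less_iff not_le)
      then have "pi * real r' / real M \<le> pi / 2" using M by (simp add: field_simps r')
      then have "(pi * real r' / real M) / 3 \<le> sin (pi * real r' / real M)" by (intro sin_ge_third) auto
      also have "pi * real r' / real M = pi - pi * real r / real M" using M by (simp add: r' field_simps)
      then have "sin (pi * real r' / real M) = sin (pi * real r / real M)" by (simp only: sin_pi_minus)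
      finally have "(pi * real r' / real M) / 3 \<le> sin (pi * real r / real M)" .
      then have "(pi * real r' / real M) / 3 < \<tau>" using s by linarith
      then have "(pi / 3) * (real r' / real M) < \<tau>" by (simp add: field_simps)
      moreover have "1 * (real r' / real M) \<le> (pi / 3) * (real r' / real M)"
        using pi_gt3 by (intro mult_right_mono) auto
      ultimately have *: "real r' < \<tau> * real M" using M by (simp add: field_simps)
      then show ?thesis using rM * by (simp add: r'_def)
    qed
  qed
  also have "{..<q} \<union> ?B \<subseteq> {..<q} \<union> (\<lambda>i. M - Suc i) ` {..<q}"
  proof (intro Un_mono subset_refl subsetI)
    fix j assume j: "j \<in> ?B"
    then have "real (M - j) < \<tau> * real M" by blast
    then have "M - j < q" unfolding q_def by linarith
    moreover have "j < M" using j by blast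
    ultimately have "j = M - Suc (M - j - 1) \<and> M - j - 1 < q" by auto
    then show "j \<in> (\<lambda>i. M - Suc i) ` {..<q}" by blast
  qed
  finally have "card (h ` J) \<le> card ({..<q} \<union> (\<lambda>i. M - Suc i) ` {..<q})"
    by (intro card_mono) auto
  also have "\<dots> \<le> card {..<q} + card ((\<lambda>i. M - Suc i) ` {..<q})" by (rule card_Un_le)
  also have "\<dots> \<le> q + q" using card_image_le[of "{..<q}" "\<lambda>i. M - Suc i"] by simp
  finally have "card J \<le> 2 * q" using card_image[OF inj] by simp
  then have "real (card J) \<le> 2 * real q" by (metis of_nat_le_iff of_nat_mult of_nat_numeral)
  then show ?thesis using q unfolding J_def by linarith
qed

text \<open>Two points of the same level set have a small \<open>cos a - cos b\<close>, which factors into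
  two sines.\<close>

lemma card_cos_level:
  assumes M: "M > 0" and \<tau>: "\<tau> > 0"
  shows "real (card {j\<in>{..<M}. \<bar>2 * cos (2 * pi * real j / real M) - c\<bar> < 2 * \<tau>\<^sup>2}) \<le> 4 * \<tau> * real M + 4"
    (is "real (card ?A) \<le> _")
proof (cases "?A = {}")
  case False
  then obtain i where i: "i \<in> ?A" by blast
  let ?S = "\<lambda>m. {j\<in>{..<M}. \<bar>sin (pi * real_of_int (int j + m) / real M)\<bar> < \<tau>}"
  have "?A \<subseteq> ?S (int i) \<union> ?S (- int i)"
  proof
    fix j assume j: "j \<in> ?A"
    define a b where "a = 2 * pi * real i / real M" and "b = 2 * pi * real j / real M"
    have "\<bar>2 * cos a - c\<bar> < 2 * \<tau>\<^sup>2" "\<bar>2 * cos b - c\<bar> < 2 * \<tau>\<^sup>2"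
      using i j by (auto simp: a_def b_def)
    then have "\<bar>cos b - cos a\<bar> < 2 * \<tau>\<^sup>2" by linarith
    also have "cos b - cos a = 2 * sin ((b + a) / 2) * sin ((a - b) / 2)" by (rule cos_diff_cos)
    also have "\<dots> = - (2 * (sin ((b + a) / 2) * sin ((b - a) / 2)))"
      using sin_minus[of "(b - a) / 2"] by (simp add: minus_divide_left del: sin_minus)
    finally have p: "\<bar>sin ((b + a) / 2)\<bar> * \<bar>sin ((b - a) / 2)\<bar> < \<tau> * \<tau>"
      by (simp add: abs_mult power2_eq_square)
    have "\<bar>sin ((b + a) / 2)\<bar> < \<tau> \<or> \<bar>sin ((b - a) / 2)\<bar> < \<tau>"
    proof (rule ccontr)
      assume "\<not> ?thesis"
      then have "\<tau> * \<tau> \<le> \<bar>sin ((b + a) / 2)\<bar> * \<bar>sin ((b - a) / 2)\<bar>" using \<tau> by (intro mult_mono) auto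
      then show False using p by simp
    qed
    moreover have "(b + a) / 2 = pi * real_of_int (int j + int i) / real M"
      "(b - a) / 2 = pi * real_of_int (int j + - int i) / real M"
      by (simp_all add: a_def b_def add_divide_distrib diff_divide_distrib algebra_simps)
    ultimately show "j \<in> ?S (int i) \<union> ?S (- int i)" using j by auto
  qed
  then have "card ?A \<le> card (?S (int i) \<union> ?S (- int i))" by (intro card_mono) auto
  also have "\<dots> \<le> card (?S (int i)) + card (?S (- int i))" by (rule card_Un_le)
  finally have "real (card ?A) \<le> real (card (?S (int i))) + real (card (?S (- int i)))" by linarith
  also have "\<dots> \<le> (2 * \<tau> * real M + 2) + (2 * \<tau> * real M + 2)"
    using \<tau> by (intro add_mono card_sin_small[OF M]) auto
  finally show ?thesis by simp
next
  case True
  then show ?thesis using \<tau> M by (simp only: True card.empty) simp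
qed

text \<open>The dispersion relation is a sum over coordinates. With all coordinates but
  \<open>i0\<close> fixed, the last one obeys a one-dimensional level condition, whose bound does
  not depend on the level; the square on \<tau> accounts for the critical points of the
  cosine.\<close>

lemma card_level_set:
  fixes \<mu> :: real
  assumes M: "M > 0" and \<tau>: "\<tau> > 0"
  shows "real (card {k\<in>modes (\<lambda>_::'d::finite. M). \<bar>dispersion (\<lambda>_. M) k - \<mu>\<bar> < 2 * \<tau>\<^sup>2})
    \<le> (4 * \<tau> + 4 / real M) * real M ^ CARD('d)"
proof -
  define i0 :: 'd where "i0 = undefined"
  define R where "R = (\<Pi>\<^sub>E i\<in>UNIV - {i0}. {..<M})"
  define c where "c g = - \<mu> - (\<Sum>i\<in>UNIV - {i0}. 2 * cos (2 * pi * real (g i) / real M))" for g :: "'d \<Rightarrow> nat"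
  define A where "A g = {j\<in>{..<M}. \<bar>2 * cos (2 * pi * real j / real M) - c g\<bar> < 2 * \<tau>\<^sup>2}" for g
  have fR: "finite R" unfolding R_def by (intro finite_PiE) auto
  have "{k\<in>modes (\<lambda>_::'d. M). \<bar>dispersion (\<lambda>_. M) k - \<mu>\<bar> < 2 * \<tau>\<^sup>2} \<subseteq> (\<Union>g\<in>R. (\<lambda>j. g(i0 := j)) ` A g)"
  proof
    fix k assume k: "k \<in> {k\<in>modes (\<lambda>_::'d. M). \<bar>dispersion (\<lambda>_. M) k - \<mu>\<bar> < 2 * \<tau>\<^sup>2}"
    define g where "g = k(i0 := undefined)"
    have g: "g \<in> R" using k by (auto simp: g_def R_def modes_def PiE_iff extensional_def)
    have "dispersion (\<lambda>_. M) k = - (2 * cos (2 * pi * real (k i0) / real M)) - (\<Sum>i\<in>UNIV - {i0}. 2 * cos (2 * pi * real (k i) / real M))"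
      unfolding dispersion_def by (subst sum.remove[of _ i0]) auto
    also have "(\<Sum>i\<in>UNIV - {i0}. 2 * cos (2 * pi * real (k i) / real M)) = (\<Sum>i\<in>UNIV - {i0}. 2 * cos (2 * pi * real (g i) / real M))"
      by (intro sum.cong refl) (simp add: g_def)
    finally have "k i0 \<in> A g" using k by (auto simp: A_def c_def modes_def abs_minus_commute)
    moreover have "k = g(i0 := k i0)" by (simp add: g_def)
    ultimately show "k \<in> (\<Union>g\<in>R. (\<lambda>j. g(i0 := j)) ` A g)" using g by blast
  qed
  then have "card {k\<in>modes (\<lambda>_::'d. M). \<bar>dispersion (\<lambda>_. M) k - \<mu>\<bar> < 2 * \<tau>\<^sup>2} \<le> card (\<Union>g\<in>R. (\<lambda>j. g(i0 := j)) ` A g)"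
    using fR by (intro card_mono) (auto simp: A_def)
  also have "\<dots> \<le> (\<Sum>g\<in>R. card ((\<lambda>j. g(i0 := j)) ` A g))" by (rule card_UN_le[OF fR])
  also have "\<dots> \<le> (\<Sum>g\<in>R. card (A g))" by (intro sum_mono card_image_le) (simp add: A_def)
  finally have "real (card {k\<in>modes (\<lambda>_::'d. M). \<bar>dispersion (\<lambda>_. M) k - \<mu>\<bar> < 2 * \<tau>\<^sup>2}) \<le> (\<Sum>g\<in>R. real (card (A g)))"
    by (simp only: of_nat_le_iff flip: of_nat_sum)
  also have "\<dots> \<le> (\<Sum>g\<in>R. 4 * \<tau> * real M + 4)"
    unfolding A_def by (intro sum_mono card_cos_level M \<tau>)
  also have "\<dots> = real M ^ (CARD('d) - 1) * (4 * \<tau> * real M + 4)"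
    by (simp add: R_def card_PiE card_Diff_singleton)
  also have "4 * \<tau> * real M + 4 = real M * (4 * \<tau> + 4 / real M)" using M by (simp add: field_simps)
  also have "real M ^ (CARD('d) - 1) * (real M * (4 * \<tau> + 4 / real M)) = real M ^ CARD('d) * (4 * \<tau> + 4 / real M)"
    by (simp only: mult.assoc[symmetric] power_minus_mult[OF zero_less_card_finite])
  finally show ?thesis by (simp add: mult.commute)
qed

lemma level_set_small:
  assumes "\<kappa> > 0"
  obtains \<eta> M0 where "\<eta> > 0"
    "\<And>M \<mu>. M \<ge> M0 \<Longrightarrow> real (card {k\<in>modes (\<lambda>_::'d::finite. M). \<bar>dispersion (\<lambda>_. M) k - \<mu>\<bar> < \<eta>}) \<le> \<kappa> * real M ^ CARD('d)"
proof -
  \<comment> \<open>Each of \<open>4 * \<tau>\<close> and \<open>4 / M\<close> is granted half of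
    \<kappa>.\<close>
  define \<tau> where "\<tau> = \<kappa> / 8"
  have \<tau>: "\<tau> > 0" using assms by (simp add: \<tau>_def)
  define M0 where "M0 = nat \<lceil>8 / \<kappa>\<rceil> + 1"
  have "real (card {k\<in>modes (\<lambda>_::'d. M). \<bar>dispersion (\<lambda>_. M) k - \<mu>\<bar> < 2 * \<tau>\<^sup>2}) \<le> \<kappa> * real M ^ CARD('d)"
    if M: "M \<ge> M0" for M \<mu>
  proof -
    have M0: "M > 0" using M by (simp add: M0_def)
    have "8 / \<kappa> \<le> real M" using M unfolding M0_def by linarith
    then have "4 / real M \<le> \<kappa> / 2" using M0 assms by (simp add: field_simps)
    then have "4 * \<tau> + 4 / real M \<le> \<kappa>" by (simp add: \<tau>_def)
    then have "(4 * \<tau> + 4 / real M) * real M ^ CARD('d) \<le> \<kappa> * real M ^ CARD('d)"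
      by (intro mult_right_mono) auto
    then show ?thesis using card_level_set[OF M0 \<tau>, of \<mu>, where 'd = 'd] by linarith
  qed
  then show ?thesis using that[of "2 * \<tau>\<^sup>2" M0] \<tau> by simp
qed

section \<open>One-particle density matrices\<close>

lemma Re_qform_diff:
  assumes herm: "\<And>x y. \<gamma> y x = cnj (\<gamma> x y)"
  shows "Re (qform S \<gamma> (\<lambda>x. f x - g x)) =
    Re (qform S \<gamma> f) + Re (qform S \<gamma> g) - 2 * Re (\<Sum>x\<in>S. cnj (g x) * (\<Sum>y\<in>S. \<gamma> x y * f y))"
proof -
  define X where "X = (\<Sum>x\<in>S. \<Sum>y\<in>S. cnj (g x) * \<gamma> x y * f y)"
  have "cnj X = (\<Sum>x\<in>S. \<Sum>y\<in>S. cnj (f y) * \<gamma> y x * g x)"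
    unfolding X_def cnj_sum complex_cnj_mult complex_cnj_cnj herm[symmetric]
    by (intro sum.cong refl) (simp only: mult_ac)
  also have "\<dots> = (\<Sum>x\<in>S. \<Sum>y\<in>S. cnj (f x) * \<gamma> x y * g y)" by (rule sum.swap)
  finally have X': "cnj X = (\<Sum>x\<in>S. \<Sum>y\<in>S. cnj (f x) * \<gamma> x y * g y)" .
  have "qform S \<gamma> (\<lambda>x. f x - g x) = qform S \<gamma> f + qform S \<gamma> g - X - cnj X"
    unfolding X' unfolding X_def by (simp add: qform_def algebra_simps sum.distrib sum_subtractf)
  moreover have "X = (\<Sum>x\<in>S. cnj (g x) * (\<Sum>y\<in>S. \<gamma> x y * f y))"
    by (simp add: X_def sum_distrib_left mult.assoc)
  ultimately show ?thesis by (simp only: minus_complex.sel plus_complex.sel cnj.sel)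
qed

lemma density_matrix_hermitian: "density_matrix S \<gamma> \<Longrightarrow> \<gamma> y x = cnj (\<gamma> x y)"
  unfolding density_matrix_def by blast

lemma density_matrix_nonneg: "density_matrix S \<gamma> \<Longrightarrow> 0 \<le> Re (qform S \<gamma> f)"
  unfolding density_matrix_def by blast

lemma density_matrix_le: "density_matrix S \<gamma> \<Longrightarrow> Re (qform S \<gamma> f) \<le> (\<Sum>x\<in>S. (cmod (f x))\<^sup>2)"
  unfolding density_matrix_def by blast

text \<open>This is \<gamma>^2 \<le> \<gamma>: the form is nonnegative at f - \<gamma> f, and at
  \<gamma> f it is at most the squared norm.\<close>

lemma density_matrix_apply_le:
  assumes "density_matrix S \<gamma>"
  shows "(\<Sum>x\<in>S. (cmod (\<Sum>y\<in>S. \<gamma> x y * f y))\<^sup>2) \<le> Re (qform S \<gamma> f)"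
proof -
  define g where "g x = (\<Sum>y\<in>S. \<gamma> x y * f y)" for x
  have "0 \<le> Re (qform S \<gamma> (\<lambda>x. f x - g x))" by (rule density_matrix_nonneg[OF assms])
  also have "\<dots> = Re (qform S \<gamma> f) + Re (qform S \<gamma> g) - 2 * Re (\<Sum>x\<in>S. cnj (g x) * g x)"
    unfolding Re_qform_diff[OF density_matrix_hermitian[OF assms]] by (simp only: g_def[abs_def])
  also have "Re (\<Sum>x\<in>S. cnj (g x) * g x) = (\<Sum>x\<in>S. (cmod (g x))\<^sup>2)"
    by (simp only: cnj_mult_self Re_sum Re_complex_of_real)
  finally show ?thesis using density_matrix_le[OF assms, of g] unfolding g_def[symmetric] by linarith
qed

text \<open>Expanding the square and inserting \<gamma>^2 \<le> \<gamma> gives its counterpart (1 -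
  \<gamma>)^2 \<le> 1 - \<gamma> for holes.\<close>

lemma density_matrix_apply_compl_le:
  assumes "density_matrix S \<gamma>"
  shows "(\<Sum>x\<in>S. (cmod (f x - (\<Sum>y\<in>S. \<gamma> x y * f y)))\<^sup>2) \<le> (\<Sum>x\<in>S. (cmod (f x))\<^sup>2) - Re (qform S \<gamma> f)"
proof -
  define g where "g x = (\<Sum>y\<in>S. \<gamma> x y * f y)" for x
  have "(cmod (f x - g x))\<^sup>2 = (cmod (f x))\<^sup>2 - 2 * Re (cnj (f x) * g x) + (cmod (g x))\<^sup>2" for x
    unfolding cmod_power2 by (simp add: power2_eq_square algebra_simps)
  then have "(\<Sum>x\<in>S. (cmod (f x - g x))\<^sup>2) =
      (\<Sum>x\<in>S. (cmod (f x))\<^sup>2) - 2 * (\<Sum>x\<in>S. Re (cnj (f x) * g x)) + (\<Sum>x\<in>S. (cmod (g x))\<^sup>2)"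
    by (simp only: sum.distrib sum_subtractf sum_distrib_left[symmetric])
  also have "(\<Sum>x\<in>S. Re (cnj (f x) * g x)) = Re (qform S \<gamma> f)"
    unfolding Re_sum[symmetric] by (simp only: g_def qform_def sum_distrib_left mult.assoc)
  finally show ?thesis using density_matrix_apply_le[OF assms, of f] unfolding g_def[symmetric] by linarith
qed

lemma density_matrix_subset:
  assumes "density_matrix S \<gamma>" "finite S" "T \<subseteq> S"
  shows "density_matrix T \<gamma>"
  unfolding density_matrix_def
proof (intro conjI allI)
  show "\<gamma> y x = cnj (\<gamma> x y)" for x y using assms(1) by (rule density_matrix_hermitian)
  fix f :: "'a \<Rightarrow> complex"
  define g where "g x = (if x \<in> T then f x else 0)" for x
  have "qform S \<gamma> g = (\<Sum>x\<in>T. \<Sum>y\<in>S. cnj (g x) * \<gamma> x y * g y)"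
    unfolding qform_def using assms by (intro sum.mono_neutral_right) (auto simp: g_def)
  also have "\<dots> = (\<Sum>x\<in>T. \<Sum>y\<in>T. cnj (g x) * \<gamma> x y * g y)"
    using assms by (intro sum.cong refl sum.mono_neutral_right) (auto simp: g_def)
  also have "\<dots> = qform T \<gamma> f" by (simp add: qform_def g_def)
  finally have q: "qform S \<gamma> g = qform T \<gamma> f" .
  have "(\<Sum>x\<in>S. (cmod (g x))\<^sup>2) = (\<Sum>x\<in>T. (cmod (g x))\<^sup>2)"
    using assms by (intro sum.mono_neutral_right) (auto simp: g_def)
  also have "\<dots> = (\<Sum>x\<in>T. (cmod (f x))\<^sup>2)" by (simp add: g_def)
  finally have "(\<Sum>x\<in>S. (cmod (g x))\<^sup>2) = (\<Sum>x\<in>T. (cmod (f x))\<^sup>2)" .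
  then show "0 \<le> Re (qform T \<gamma> f)" "Re (qform T \<gamma> f) \<le> (\<Sum>x\<in>T. (cmod (f x))\<^sup>2)"
    using density_matrix_nonneg[OF assms(1), of g] density_matrix_le[OF assms(1), of g] q by simp_all
qed

text \<open>Particle-hole duality: 1 - \<gamma> describes the holes. At high filling it takes the
  place of \<gamma>.\<close>

lemma density_matrix_compl:
  assumes "density_matrix S \<gamma>" "finite S"
  shows "density_matrix S (\<lambda>x y. of_bool (x = y) - \<gamma> x y)"
  unfolding density_matrix_def
proof (intro conjI allI)
  show "of_bool (y = x) - \<gamma> y x = cnj (of_bool (x = y) - \<gamma> x y)" for x y
    using density_matrix_hermitian[OF assms(1), of y x] by auto
  fix f
  have "qform S (\<lambda>x y. of_bool (x = y) - \<gamma> x y) f = (\<Sum>x\<in>S. \<Sum>y\<in>S. of_bool (x = y) * (cnj (f x) * f y)) - qform S \<gamma> f"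
    by (simp add: qform_def algebra_simps sum_subtractf)
  also have "(\<Sum>x\<in>S. \<Sum>y\<in>S. of_bool (x = y) * (cnj (f x) * f y)) = (\<Sum>x\<in>S. complex_of_real ((cmod (f x))\<^sup>2))"
    using assms(2) by (intro sum.cong refl) (simp add: of_bool_def if_distrib[where f = "\<lambda>c. c * _"] cnj_mult_self cong: if_cong)
  finally have "Re (qform S (\<lambda>x y. of_bool (x = y) - \<gamma> x y) f) = (\<Sum>x\<in>S. (cmod (f x))\<^sup>2) - Re (qform S \<gamma> f)"
    by simp
  then show "0 \<le> Re (qform S (\<lambda>x y. of_bool (x = y) - \<gamma> x y) f)"
    "Re (qform S (\<lambda>x y. of_bool (x = y) - \<gamma> x y) f) \<le> (\<Sum>x\<in>S. (cmod (f x))\<^sup>2)"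
    using density_matrix_nonneg[OF assms(1), of f] density_matrix_le[OF assms(1), of f] by linarith+
qed

lemma qform_delta:
  assumes "finite S" "z \<in> S"
  shows "qform S \<gamma> (\<lambda>x. of_bool (x = z)) = \<gamma> z z"
  using assms by (simp add: qform_def of_bool_def if_distrib[where f = "\<lambda>c. c * _"]
      if_distrib[where f = "\<lambda>c. _ * c"] if_distrib[where f = cnj] sum.delta cong: if_cong)

lemma density_matrix_diag:
  assumes "density_matrix S \<gamma>" "finite S" "z \<in> S"
  shows "0 \<le> Re (\<gamma> z z)" "Re (\<gamma> z z) \<le> 1" "\<gamma> z z = complex_of_real (Re (\<gamma> z z))"
proof -
  have "(\<Sum>x\<in>S. (cmod (of_bool (x = z)))\<^sup>2) = (\<Sum>x\<in>S. of_bool (x = z) :: real)"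
    by (intro sum.cong refl) simp
  also have "\<dots> = 1" using assms(2,3) by (simp add: of_bool_def)
  finally have 1: "(\<Sum>x\<in>S. (cmod (of_bool (x = z)))\<^sup>2) = 1" .
  from density_matrix_nonneg[OF assms(1), of "\<lambda>x. of_bool (x = z)"]
    density_matrix_le[OF assms(1), of "\<lambda>x. of_bool (x = z)"] show "0 \<le> Re (\<gamma> z z)" "Re (\<gamma> z z) \<le> 1"
    unfolding qform_delta[OF assms(2,3)] 1 .
  have "\<gamma> z z = cnj (\<gamma> z z)" by (rule density_matrix_hermitian[OF assms(1)])
  then show "\<gamma> z z = complex_of_real (Re (\<gamma> z z))" by (simp add: complex_eq_iff)
qed

text \<open>\<gamma>^2 \<le> \<gamma>, tested on the delta function at \<open>z\<close>.\<close>

lemma density_matrix_column_le: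
  assumes "density_matrix S \<gamma>" "finite S" "z \<in> S"
  shows "(\<Sum>x\<in>S. (cmod (\<gamma> x z))\<^sup>2) \<le> Re (\<gamma> z z)"
proof -
  have "(\<Sum>y\<in>S. \<gamma> x y * of_bool (y = z)) = \<gamma> x z" for x
    using assms(2,3) by (simp add: of_bool_def if_distrib[where f = "\<lambda>c. _ * c"] cong: if_cong)
  then show ?thesis
    using density_matrix_apply_le[OF assms(1), of "\<lambda>x. of_bool (x = z)"] qform_delta[OF assms(2,3)] by simp
qed

lemma density_matrix_entry_sqrt:
  assumes "density_matrix S \<gamma>" "finite S" "x \<in> S" "z \<in> S"
  shows "(cmod (\<gamma> x z))\<^sup>2 \<le> Re (\<gamma> z z)"
proof -
  have "(cmod (\<gamma> x z))\<^sup>2 \<le> (\<Sum>x\<in>S. (cmod (\<gamma> x z))\<^sup>2)"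
    using assms by (intro member_le_sum) auto
  then show ?thesis using density_matrix_column_le[OF assms(1,2,4)] by linarith
qed

text \<open>Positivity is tested on a vector supported on the two sites, with a relative phase that
  turns the cross term into minus twice the modulus of the entry.\<close>

lemma density_matrix_entry_mean:
  assumes dm: "density_matrix S \<gamma>" and fin: "finite S" and xz: "x \<in> S" "z \<in> S" "x \<noteq> z"
  shows "2 * cmod (\<gamma> x z) \<le> Re (\<gamma> x x) + Re (\<gamma> z z)"
proof -
  \<comment> \<open>If the entry vanishes then so does \<open>u\<close>; hence \<open>u\<close> has
    modulus at most 1, not always equal to 1.\<close>
  define u where "u = - sgn (cnj (\<gamma> x z))"
  have u: "\<gamma> x z * u = - complex_of_real (cmod (\<gamma> x z))" "cmod u \<le> 1"
  proof -
    have "\<gamma> x z * cnj (\<gamma> x z) = complex_of_real (cmod (\<gamma> x z)) * complex_of_real (cmod (\<gamma> x z))"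
      using complex_norm_square[of "\<gamma> x z"] by (simp add: power2_eq_square)
    then show "\<gamma> x z * u = - complex_of_real (cmod (\<gamma> x z))"
      by (cases "\<gamma> x z = 0") (simp_all add: u_def sgn_eq)
    show "cmod u \<le> 1" by (simp add: u_def norm_sgn)
  qed
  have herm: "\<gamma> z x = cnj (\<gamma> x z)" using dm by (rule density_matrix_hermitian)
  define f where "f y = (if y = x then 1 else if y = z then u else 0)" for y
  have inner: "(\<Sum>y\<in>S. \<gamma> w y * f y) = \<gamma> w x + \<gamma> w z * u" for w
  proof -
    have "(\<Sum>y\<in>S. \<gamma> w y * f y) = (\<Sum>y\<in>{x, z}. \<gamma> w y * f y)"
      using fin xz by (intro sum.mono_neutral_right) (auto simp: f_def)
    then show ?thesis using xz by (simp add: f_def)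
  qed
  have "qform S \<gamma> f = (\<Sum>w\<in>S. cnj (f w) * (\<gamma> w x + \<gamma> w z * u))"
    by (simp add: qform_def inner[symmetric] sum_distrib_left mult.assoc)
  also have "\<dots> = (\<Sum>w\<in>{x, z}. cnj (f w) * (\<gamma> w x + \<gamma> w z * u))"
    using fin xz by (intro sum.mono_neutral_right) (auto simp: f_def)
  also have "\<dots> = \<gamma> x x + \<gamma> x z * u + (cnj (\<gamma> x z * u) + cnj u * u * \<gamma> z z)"
    using xz by (simp add: f_def herm algebra_simps)
  also have "\<dots> = \<gamma> x x - 2 * complex_of_real (cmod (\<gamma> x z)) + complex_of_real ((cmod u)\<^sup>2) * \<gamma> z z"
    unfolding u(1) cnj_mult_self by simp
  finally have "Re (qform S \<gamma> f) = Re (\<gamma> x x) - 2 * cmod (\<gamma> x z) + (cmod u)\<^sup>2 * Re (\<gamma> z z)"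
    by simp
  moreover have "0 \<le> Re (qform S \<gamma> f)" using dm by (rule density_matrix_nonneg)
  moreover have "(cmod u)\<^sup>2 * Re (\<gamma> z z) \<le> 1 * Re (\<gamma> z z)"
    using u(2) density_matrix_diag(1)[OF dm fin xz(2)]
    by (intro mult_right_mono) (auto simp: power_le_one)
  ultimately show ?thesis by linarith
qed

section \<open>The boundary contribution to the energy\<close>

abbreviation kinetic :: "'d::finite site set \<Rightarrow> ('d site \<Rightarrow> 'd site \<Rightarrow> complex) \<Rightarrow> complex" where
  "kinetic D \<gamma> \<equiv> \<Sum>x\<in>D. \<Sum>y\<in>D. - of_bool (l1_norm (x - y) = 1) * \<gamma> x y"

abbreviation band_energy :: "nat \<Rightarrow> (('d::finite \<Rightarrow> nat) \<Rightarrow> real) \<Rightarrow> real" where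
  "band_energy M f \<equiv> (\<Sum>k\<in>modes (\<lambda>_. M). f k * dispersion (\<lambda>_. M) k) / real M ^ CARD('d)"

text \<open>A Fermi sea with level \<mu>. Fractional occupation exactly at the level makes every
  real filling attainable. As \<mu> is itself an energy of the band, it inherits the bound on the
  dispersion relation.\<close>

definition filling :: "'k set \<Rightarrow> ('k \<Rightarrow> real) \<Rightarrow> real \<Rightarrow> real \<Rightarrow> ('k \<Rightarrow> real) \<Rightarrow> bool" where
  "filling K E n \<mu> f \<longleftrightarrow> (\<forall>k\<in>K. 0 \<le> f k \<and> f k \<le> 1) \<and> (\<forall>k\<in>K. E k < \<mu> \<longrightarrow> f k = 1) \<and>
     (\<forall>k\<in>K. \<mu> < E k \<longrightarrow> f k = 0) \<and> sum f K = n * real (card K) \<and> \<mu> \<in> E ` K"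

text \<open>\<mu> is the lowest level up to which there are at least n times \<open>card K\<close>
  states. The states strictly below are full, and what remains is spread evenly over the states at
  \<mu>.\<close>

lemma ex_filling:
  assumes fin: "finite K" "K \<noteq> {}" and n: "0 \<le> n" "n \<le> 1"
  shows "\<exists>\<mu> f. filling K E n \<mu> f"
proof -
  define good where "good = {v\<in>E ` K. n * real (card K) \<le> real (card {k\<in>K. E k \<le> v})}"
  have mx: "Max (E ` K) \<in> good"
  proof -
    have "{k\<in>K. E k \<le> Max (E ` K)} = K" using fin by auto
    then show ?thesis using fin n by (auto simp: good_def mult_left_le_one_le)
  qed
  have g: "good \<noteq> {}" "finite good" using mx fin by (blast, simp add: good_def)
  define \<mu> where "\<mu> = Min good"
  have \<mu>: "\<mu> \<in> good" unfolding \<mu>_def using g by (intro Min_in)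
  define A B where "A = {k\<in>K. E k < \<mu>}" and "B = {k\<in>K. E k = \<mu>}"
  have fAB: "finite A" "finite B" using fin by (auto simp: A_def B_def)
  have "{k\<in>K. E k \<le> \<mu>} = A \<union> B" "A \<inter> B = {}" by (auto simp: A_def B_def)
  then have up: "n * real (card K) \<le> real (card A) + real (card B)"
    using \<mu> fAB card_Un_disjoint[of A B] by (simp add: good_def)
  have lo: "real (card A) \<le> n * real (card K)"
  proof (cases "A = {}")
    case False
    define v where "v = Max (E ` A)"
    have v: "v \<in> E ` A" unfolding v_def using False fAB by (intro Max_in) auto
    have "{k\<in>K. E k \<le> v} = A"
    proof (rule set_eqI, rule iffI)
      fix k assume "k \<in> {k\<in>K. E k \<le> v}"
      then show "k \<in> A" using v by (auto simp: A_def)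
    next
      fix k assume "k \<in> A"
      then show "k \<in> {k\<in>K. E k \<le> v}" using fAB by (auto simp: A_def v_def)
    qed
    moreover have "v < \<mu>" using v by (auto simp: A_def)
    then have "v \<notin> good" using g unfolding \<mu>_def by (auto simp: Min_gr_iff)
    moreover have "v \<in> E ` K" using v by (auto simp: A_def)
    ultimately show ?thesis by (auto simp: good_def)
  qed (use n in simp)
  have "B \<noteq> {}" using \<mu> by (auto simp: good_def B_def)
  then have B0: "real (card B) > 0" using fAB by (simp add: card_gt_0_iff)
  define s where "s = (n * real (card K) - real (card A)) / real (card B)"
  have s: "0 \<le> s" "s \<le> 1" using lo up B0 by (simp_all add: s_def field_simps)
  define f where "f k = (if E k < \<mu> then 1 else if E k = \<mu> then s else 0)" for k
  have "sum f K = (\<Sum>k\<in>K. (if k \<in> A then 1 else 0) + (if k \<in> B then s else 0))"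
    by (intro sum.cong refl) (auto simp: f_def A_def B_def)
  also have "\<dots> = real (card A) + real (card B) * s"
  proof -
    have "K \<inter> A = A" "K \<inter> B = B" by (auto simp: A_def B_def)
    then show ?thesis using fin by (simp add: sum.distrib sum.If_cases Int_def[symmetric] flip: sum.inter_restrict)
  qed
  also have "\<dots> = n * real (card K)" using B0 by (simp add: s_def)
  finally have "sum f K = n * real (card K)" .
  then have "filling K E n \<mu> f" using s \<mu> by (auto simp: filling_def f_def good_def)
  then show ?thesis by blast
qed

lemma l1_norm_minus: "l1_norm (- z) = l1_norm z"
  by (simp add: l1_norm_def)

lemma l1_norm_commute: "l1_norm (x - y) = l1_norm (y - x)"
  using l1_norm_minus[of "x - y"] by simp

lemma neighbours_eq: "{x. l1_norm (x - y) = 1} = (\<lambda>i. y + axis i 1) ` UNIV \<union> (\<lambda>i. y - axis i 1) ` UNIV"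
  by (auto simp: l1_norm_eq_1_iff image_iff algebra_simps)

lemma card_neighbours: "card {x :: 'd::finite site. l1_norm (x - y) = 1} \<le> 2 * CARD('d)"
  and finite_neighbours: "finite {x :: 'd::finite site. l1_norm (x - y) = 1}"
proof -
  have "card {x :: 'd site. l1_norm (x - y) = 1} \<le> card ((\<lambda>i::'d. y + axis i 1) ` UNIV) + card ((\<lambda>i::'d. y - axis i 1) ` UNIV)"
    unfolding neighbours_eq by (rule card_Un_le)
  also have "\<dots> \<le> CARD('d) + CARD('d)" by (intro add_mono card_image_le) auto
  finally show "card {x :: 'd site. l1_norm (x - y) = 1} \<le> 2 * CARD('d)" by simp
  show "finite {x :: 'd::finite site. l1_norm (x - y) = 1}" unfolding neighbours_eq by simp
qed

text \<open>Edge boundary relative to \<Lambda>: bonds that leave \<Lambda> are not counted, so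
  contact with the faces of the cube is free of charge.\<close>

definition boundary :: "'d::finite site set \<Rightarrow> 'd site set \<Rightarrow> nat" where
  "boundary \<Lambda> W = card {(x, y). x \<in> \<Lambda> - W \<and> y \<in> W \<and> l1_norm (x - y) = 1}"

lemma boundary_le:
  fixes W :: "'d::finite site set"
  assumes "finite W"
  shows "boundary \<Lambda> W \<le> 2 * CARD('d) * card {y\<in>W. \<exists>x\<in>\<Lambda> - W. l1_norm (x - y) = 1}"
proof -
  let ?D = "{y\<in>W. \<exists>x\<in>\<Lambda> - W. l1_norm (x - y) = 1}"
  have fD: "finite ?D" using assms by simp
  have "{(x, y). x \<in> \<Lambda> - W \<and> y \<in> W \<and> l1_norm (x - y) = 1} \<subseteq> (\<Union>y\<in>?D. (\<lambda>x. (x, y)) ` {x. l1_norm (x - y) = 1})"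
    by auto
  then have "boundary \<Lambda> W \<le> card (\<Union>y\<in>?D. (\<lambda>x. (x, y)) ` {x. l1_norm (x - y) = 1})"
    unfolding boundary_def using fD finite_neighbours by (intro card_mono) auto
  also have "\<dots> \<le> (\<Sum>y\<in>?D. card ((\<lambda>x. (x, y)) ` {x. l1_norm (x - y) = 1}))"
    by (rule card_UN_le[OF fD])
  also have "\<dots> \<le> (\<Sum>y\<in>?D. 2 * CARD('d))"
    by (intro sum_mono order_trans[OF card_image_le card_neighbours] finite_neighbours)
  also have "\<dots> = 2 * CARD('d) * card ?D" by (simp only: sum_constant of_nat_id mult.commute)
  finally show ?thesis .
qed

lemma cuboid_diff_less:
  assumes "x \<in> cuboid r (\<lambda>_. L)" "y \<in> cuboid r (\<lambda>_. L)" "L < M"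
  shows "\<bar>(x - y) $ i\<bar> + 1 < int M"
proof -
  have "r $ i \<le> x $ i" "x $ i < r $ i + int L" "r $ i \<le> y $ i" "y $ i < r $ i + int L"
    using assms by (auto simp: cuboid_def)
  then show ?thesis using assms(3) by simp
qed

section \<open>Plane waves of a larger torus restricted to a subset of the cube\<close>

context
  fixes M L :: nat and r :: "'d::finite site" and D :: "'d site set"
  assumes LM: "L < M" and D: "D \<subseteq> cuboid r (\<lambda>_. L)"
begin

private abbreviation "K \<equiv> modes (\<lambda>_::'d. M)"
private abbreviation "w \<equiv> wave (\<lambda>_::'d. M)"
private abbreviation "E \<equiv> dispersion (\<lambda>_::'d. M)"

private lemma M_pos: "M > 0" using LM by simp

private lemma finite_D: "finite D" using D finite_subset finite_cuboid by blast

private lemma card_K: "card K = M ^ CARD('d)" by (simp add: card_modes)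

private lemma sum_wave_pair:
  assumes "x \<in> cuboid r (\<lambda>_. L)" "y \<in> cuboid r (\<lambda>_. L)"
  shows "(\<Sum>k\<in>K. cnj (w k x) * w k y) = of_nat M ^ CARD('d) * of_bool (x = y)"
proof -
  have small: "\<bar>(y - x) $ i\<bar> < int M" for i using cuboid_diff_less[OF assms(2,1) LM, of i] by simp
  have "(\<Sum>k\<in>K. cnj (w k x) * w k y) = (\<Sum>k\<in>K. w k (y - x))"
    by (simp add: wave_diff mult.commute)
  also have "\<dots> = of_nat M ^ CARD('d) * of_bool (y - x = 0)"
    by (rule sum_wave_small[OF M_pos small])
  finally show ?thesis by (auto simp: of_bool_def)
qed

text \<open>Restricted to \<open>D\<close>, the waves of the torus are too many to be a basis, but
  orthogonality of the torus characters at the points of \<open>D\<close> still makes them a tight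
  frame.\<close>

lemma parseval:
  "(\<Sum>k\<in>K. (cmod (\<Sum>z\<in>D. c z * w k z))\<^sup>2) = real M ^ CARD('d) * (\<Sum>z\<in>D. (cmod (c z))\<^sup>2)"
proof -
  have "complex_of_real (\<Sum>k\<in>K. (cmod (\<Sum>z\<in>D. c z * w k z))\<^sup>2)
      = (\<Sum>k\<in>K. cnj (\<Sum>z\<in>D. c z * w k z) * (\<Sum>z\<in>D. c z * w k z))"
    by (simp only: of_real_sum cnj_mult_self)
  also have "\<dots> = (\<Sum>k\<in>K. \<Sum>x\<in>D. \<Sum>y\<in>D. cnj (c x) * c y * (cnj (w k x) * w k y))"
    unfolding cnj_sum sum_product by (intro sum.cong refl) (simp add: mult_ac)
  also have "\<dots> = (\<Sum>x\<in>D. \<Sum>k\<in>K. \<Sum>y\<in>D. cnj (c x) * c y * (cnj (w k x) * w k y))"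
    by (rule sum.swap)
  also have "\<dots> = (\<Sum>x\<in>D. \<Sum>y\<in>D. \<Sum>k\<in>K. cnj (c x) * c y * (cnj (w k x) * w k y))"
    by (intro sum.cong refl sum.swap)
  also have "\<dots> = (\<Sum>x\<in>D. \<Sum>y\<in>D. cnj (c x) * c y * (of_nat M ^ CARD('d) * of_bool (x = y)))"
    unfolding sum_distrib_left[symmetric]
    by (intro sum.cong refl arg_cong2[where f = "(*)"] sum_wave_pair) (use D in auto)
  also have "\<dots> = (\<Sum>x\<in>D. of_nat M ^ CARD('d) * (cnj (c x) * c x))"
    using finite_D by (intro sum.cong refl) (simp add: of_bool_def if_distrib[where f = "(*) _"] cong: if_cong)
  also have "\<dots> = complex_of_real (real M ^ CARD('d) * (\<Sum>z\<in>D. (cmod (c z))\<^sup>2))"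
    unfolding cnj_mult_self by (simp add: sum_distrib_left)
  finally show ?thesis by (simp only: of_real_eq_iff)
qed

lemma sum_qform_wave:
  "(\<Sum>k\<in>K. qform D \<gamma> (w k)) = of_nat M ^ CARD('d) * (\<Sum>x\<in>D. \<gamma> x x)"
proof -
  have "(\<Sum>k\<in>K. qform D \<gamma> (w k)) = (\<Sum>k\<in>K. \<Sum>x\<in>D. \<Sum>y\<in>D. \<gamma> x y * (cnj (w k x) * w k y))"
    by (simp add: qform_def mult_ac)
  also have "\<dots> = (\<Sum>x\<in>D. \<Sum>k\<in>K. \<Sum>y\<in>D. \<gamma> x y * (cnj (w k x) * w k y))"
    by (rule sum.swap)
  also have "\<dots> = (\<Sum>x\<in>D. \<Sum>y\<in>D. \<Sum>k\<in>K. \<gamma> x y * (cnj (w k x) * w k y))"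
    by (intro sum.cong refl sum.swap)
  also have "\<dots> = (\<Sum>x\<in>D. \<Sum>y\<in>D. \<gamma> x y * (of_nat M ^ CARD('d) * of_bool (x = y)))"
    unfolding sum_distrib_left[symmetric]
    by (intro sum.cong refl arg_cong2[where f = "(*)"] sum_wave_pair) (use D in auto)
  also have "\<dots> = (\<Sum>x\<in>D. of_nat M ^ CARD('d) * \<gamma> x x)"
    using finite_D by (intro sum.cong refl) (simp add: of_bool_def if_distrib[where f = "(*) _"] cong: if_cong)
  finally show ?thesis by (simp only: sum_distrib_left)
qed

lemma sum_dispersion_qform_wave:
  "(\<Sum>k\<in>K. complex_of_real (E k) * qform D \<gamma> (w k)) =
    of_nat M ^ CARD('d) * (kinetic D \<gamma>)"
proof -
  have "(\<Sum>k\<in>K. complex_of_real (E k) * qform D \<gamma> (w k)) =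
      (\<Sum>k\<in>K. \<Sum>x\<in>D. \<Sum>y\<in>D. \<gamma> x y * (complex_of_real (E k) * w k (y - x)))"
    by (simp add: qform_def wave_diff sum_distrib_left mult_ac)
  also have "\<dots> = (\<Sum>x\<in>D. \<Sum>k\<in>K. \<Sum>y\<in>D. \<gamma> x y * (complex_of_real (E k) * w k (y - x)))"
    by (rule sum.swap)
  also have "\<dots> = (\<Sum>x\<in>D. \<Sum>y\<in>D. \<Sum>k\<in>K. \<gamma> x y * (complex_of_real (E k) * w k (y - x)))"
    by (intro sum.cong refl sum.swap)
  also have "\<dots> = (\<Sum>x\<in>D. \<Sum>y\<in>D. \<gamma> x y * - (of_nat M ^ CARD('d) * of_bool (l1_norm (y - x) = 1)))"
    unfolding sum_distrib_left[symmetric]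
    by (intro sum.cong refl arg_cong2[where f = "(*)"] sum_dispersion_wave cuboid_diff_less[OF _ _ LM]) (use D in auto)
  also have "\<dots> = of_nat M ^ CARD('d) * (kinetic D \<gamma>)"
    unfolding sum_distrib_left by (intro sum.cong refl) (simp add: l1_norm_commute)
  finally show ?thesis .
qed

text \<open>The excess of the energy over its bulk value is a sum over momenta of nonnegative terms
  measuring how far \<open>\<gamma>\<close> is from the Fermi projection. At a site \<open>y \<in> D\<close> with a neighbour
  \<open>x \<in> \<Lambda> - D\<close> the entry \<open>\<gamma> x y\<close> is missing whereas the Fermi projection has a nonzero entry there,
  so these terms cannot all be small.\<close>

lemma excess_at_boundary_site:
  fixes \<gamma> :: "'d site \<Rightarrow> 'd site \<Rightarrow> complex"
  assumes dm: "density_matrix D \<gamma>" and y: "y \<in> D"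
    and x: "x \<in> cuboid r (\<lambda>_. L)" "x \<notin> D"
    and F: "F \<subseteq> K" and \<Theta>: "\<Theta> \<subseteq> K" and few: "real (card (K - \<Theta>)) \<le> \<kappa> * real M ^ CARD('d)" and \<kappa>: "0 \<le> \<kappa>"
    and \<pi>: "\<pi> * real M ^ CARD('d) \<le> cmod (\<Sum>k\<in>F. w k (y - x))"
    and q: "0 \<le> q" "q \<le> \<pi> - \<kappa> - sqrt \<kappa>"
  shows "q\<^sup>2 * real M ^ CARD('d) \<le>
    (\<Sum>k\<in>\<Theta>. (cmod ((\<Sum>z\<in>D. \<gamma> y z * w k z) - of_bool (k \<in> F) * w k y))\<^sup>2)"
proof -
  define V where "V = real M ^ CARD('d)"
  have V: "V > 0" using M_pos by (simp add: V_def)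
  have fin: "finite F" "finite \<Theta>" "finite (K - \<Theta>)" using F \<Theta> finite_subset finite_modes by blast+
  define u where "u k = (\<Sum>z\<in>D. \<gamma> y z * w k z)" for k
  define v where "v k = u k - of_bool (k \<in> F) * w k y" for k
  \<comment> \<open>The sum is, up to a factor, the inverse Fourier transform at \<open>x\<close> of
    the row of \<gamma> at \<open>y\<close>, cut off to \<open>D\<close>; and \<open>x\<close> lies
    outside \<open>D\<close>.\<close>
  have all0: "(\<Sum>k\<in>K. cnj (w k x) * u k) = 0"
  proof -
    have "(\<Sum>k\<in>K. cnj (w k x) * u k) = (\<Sum>k\<in>K. \<Sum>z\<in>D. \<gamma> y z * (cnj (w k x) * w k z))"
      by (simp add: u_def sum_distrib_left mult_ac)
    also have "\<dots> = (\<Sum>z\<in>D. \<gamma> y z * (\<Sum>k\<in>K. cnj (w k x) * w k z))"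
      by (subst sum.swap) (simp only: sum_distrib_left)
    also have "\<dots> = 0" using x D by (intro sum.neutral) (auto simp: sum_wave_pair[OF x(1)])
    finally show ?thesis .
  qed
  have split: "(\<Sum>k\<in>K. g k) = (\<Sum>k\<in>\<Theta>. g k) + (\<Sum>k\<in>K - \<Theta>. g k)" for g :: "('d \<Rightarrow> nat) \<Rightarrow> complex"
    using sum.subset_diff[OF \<Theta> finite_modes, of g] by (simp add: add.commute)
  have "(\<Sum>k\<in>\<Theta>. cnj (w k x) * v k) = (\<Sum>k\<in>\<Theta>. cnj (w k x) * u k) - (\<Sum>k\<in>\<Theta>. of_bool (k \<in> F) * w k (y - x))"
    by (simp add: v_def algebra_simps sum_subtractf wave_diff)
  also have "(\<Sum>k\<in>\<Theta>. cnj (w k x) * u k) = - (\<Sum>k\<in>K - \<Theta>. cnj (w k x) * u k)"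
    using all0 split[of "\<lambda>k. cnj (w k x) * u k"] by (simp add: eq_neg_iff_add_eq_0)
  also have "(\<Sum>k\<in>\<Theta>. of_bool (k \<in> F) * w k (y - x)) =
      (\<Sum>k\<in>K. of_bool (k \<in> F) * w k (y - x)) - (\<Sum>k\<in>K - \<Theta>. of_bool (k \<in> F) * w k (y - x))"
    using split[of "\<lambda>k. of_bool (k \<in> F) * w k (y - x)"] by simp
  also have "(\<Sum>k\<in>K. of_bool (k \<in> F) * w k (y - x)) = (\<Sum>k\<in>F. w k (y - x))"
    using F by (intro sum.mono_neutral_cong_right) auto
  \<comment> \<open>The entry of the Fermi projection is split into the deviation on \<Theta> and
    two contributions of the few exceptional momenta outside \<Theta>.\<close>
  finally have S: "(\<Sum>k\<in>F. w k (y - x)) = (\<Sum>k\<in>K - \<Theta>. of_bool (k \<in> F) * w k (y - x))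
      - (\<Sum>k\<in>K - \<Theta>. cnj (w k x) * u k) - (\<Sum>k\<in>\<Theta>. cnj (w k x) * v k)"
    by (simp add: algebra_simps)
  have b1: "cmod (\<Sum>k\<in>K - \<Theta>. of_bool (k \<in> F) * w k (y - x)) \<le> \<kappa> * V"
  proof -
    have "cmod (\<Sum>k\<in>K - \<Theta>. of_bool (k \<in> F) * w k (y - x)) \<le> (\<Sum>k\<in>K - \<Theta>. 1)"
      by (intro sum_norm_le) (simp add: norm_mult)
    then show ?thesis using few by (simp add: V_def)
  qed
  have cs: "(\<Sum>k\<in>A. cmod (g k)) \<le> sqrt (real (card A)) * sqrt (\<Sum>k\<in>A. (cmod (g k))\<^sup>2)"
    for A and g :: "('d \<Rightarrow> nat) \<Rightarrow> complex"
  proof -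
    have "(\<Sum>k\<in>A. 1 * cmod (g k))\<^sup>2 \<le> (\<Sum>k\<in>A. 1\<^sup>2) * (\<Sum>k\<in>A. (cmod (g k))\<^sup>2)"
      by (rule Cauchy_Schwarz_ineq_sum)
    then have "(\<Sum>k\<in>A. cmod (g k))\<^sup>2 \<le> (real (card A)) * (\<Sum>k\<in>A. (cmod (g k))\<^sup>2)" by simp
    then have "(\<Sum>k\<in>A. cmod (g k)) \<le> sqrt (real (card A) * (\<Sum>k\<in>A. (cmod (g k))\<^sup>2))"
      by (rule real_le_rsqrt)
    then show ?thesis by (simp add: real_sqrt_mult)
  qed
  \<comment> \<open>On the exceptional momenta \<open>u\<close> need not be small, but its total
    weight is at most \<open>V\<close> by Parseval. Cauchy-Schwarz against their number, at most
    \<kappa> V, leaves sqrt \<kappa>.\<close>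
  have b2: "cmod (\<Sum>k\<in>K - \<Theta>. cnj (w k x) * u k) \<le> sqrt \<kappa> * V"
  proof -
    have "(\<Sum>k\<in>K - \<Theta>. (cmod (u k))\<^sup>2) \<le> (\<Sum>k\<in>K. (cmod (u k))\<^sup>2)"
      by (intro sum_mono2) auto
    also have "\<dots> = V * (\<Sum>z\<in>D. (cmod (\<gamma> y z))\<^sup>2)" unfolding u_def V_def by (rule parseval)
    also have "(\<Sum>z\<in>D. (cmod (\<gamma> y z))\<^sup>2) = (\<Sum>z\<in>D. (cmod (\<gamma> z y))\<^sup>2)"
      by (intro sum.cong refl) (metis density_matrix_hermitian[OF dm] complex_mod_cnj)
    also have "\<dots> \<le> 1"
      using density_matrix_column_le[OF dm finite_D y] density_matrix_diag(2)[OF dm finite_D y] by linarith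
    finally have u2: "(\<Sum>k\<in>K - \<Theta>. (cmod (u k))\<^sup>2) \<le> V" using V by simp
    have "cmod (\<Sum>k\<in>K - \<Theta>. cnj (w k x) * u k) \<le> (\<Sum>k\<in>K - \<Theta>. cmod (u k))"
      by (intro sum_norm_le) (simp add: norm_mult)
    also have "\<dots> \<le> sqrt (real (card (K - \<Theta>))) * sqrt (\<Sum>k\<in>K - \<Theta>. (cmod (u k))\<^sup>2)" by (rule cs)
    also have "\<dots> \<le> sqrt (\<kappa> * V) * sqrt V"
      using few u2 by (intro mult_mono real_sqrt_le_mono) (auto simp: V_def \<kappa> sum_nonneg)
    also have "\<dots> = sqrt \<kappa> * V" using V by (simp add: real_sqrt_mult)
    finally show ?thesis .
  qed
  have b3: "cmod (\<Sum>k\<in>\<Theta>. cnj (w k x) * v k) \<le> sqrt V * sqrt (\<Sum>k\<in>\<Theta>. (cmod (v k))\<^sup>2)"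
  proof -
    have "cmod (\<Sum>k\<in>\<Theta>. cnj (w k x) * v k) \<le> (\<Sum>k\<in>\<Theta>. cmod (v k))"
      by (intro sum_norm_le) (simp add: norm_mult)
    also have "\<dots> \<le> sqrt (real (card \<Theta>)) * sqrt (\<Sum>k\<in>\<Theta>. (cmod (v k))\<^sup>2)" by (rule cs)
    also have "card \<Theta> \<le> card K" using \<Theta> by (intro card_mono) auto
    then have "real (card \<Theta>) \<le> V" by (simp add: V_def card_K flip: of_nat_power)
    then have "sqrt (real (card \<Theta>)) * sqrt (\<Sum>k\<in>\<Theta>. (cmod (v k))\<^sup>2) \<le> sqrt V * sqrt (\<Sum>k\<in>\<Theta>. (cmod (v k))\<^sup>2)"
      by (intro mult_right_mono real_sqrt_le_mono) (auto simp: sum_nonneg)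
    finally show ?thesis .
  qed
  have "\<pi> * V \<le> \<kappa> * V + sqrt \<kappa> * V + sqrt V * sqrt (\<Sum>k\<in>\<Theta>. (cmod (v k))\<^sup>2)"
  proof -
    have tri: "cmod (a - b - c) \<le> cmod a + cmod b + cmod c" for a b c
      using norm_triangle_ineq4[of "a - b" c] norm_triangle_ineq4[of a b] by linarith
    have "\<pi> * V \<le> cmod (\<Sum>k\<in>F. w k (y - x))" using \<pi> by (simp add: V_def)
    also have "\<dots> \<le> cmod (\<Sum>k\<in>K - \<Theta>. of_bool (k \<in> F) * w k (y - x))
        + cmod (\<Sum>k\<in>K - \<Theta>. cnj (w k x) * u k) + cmod (\<Sum>k\<in>\<Theta>. cnj (w k x) * v k)"
      unfolding S by (rule tri)
    finally show ?thesis using b1 b2 b3 by linarith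
  qed
  moreover have "q * V \<le> (\<pi> - \<kappa> - sqrt \<kappa>) * V" using q V by (intro mult_right_mono) auto
  ultimately have "q * V \<le> sqrt V * sqrt (\<Sum>k\<in>\<Theta>. (cmod (v k))\<^sup>2)" by (simp add: algebra_simps)
  then have "(q * V)\<^sup>2 \<le> (sqrt V * sqrt (\<Sum>k\<in>\<Theta>. (cmod (v k))\<^sup>2))\<^sup>2"
    using q V by (intro power_mono) auto
  also have "\<dots> = V * (\<Sum>k\<in>\<Theta>. (cmod (v k))\<^sup>2)"
    using V by (simp add: power_mult_distrib sum_nonneg)
  finally have "q\<^sup>2 * V \<le> (\<Sum>k\<in>\<Theta>. (cmod (v k))\<^sup>2)"
    using V by (simp add: power_mult_distrib power2_eq_square[of V])
  then show ?thesis by (simp add: v_def u_def V_def)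
qed

text \<open>The expectations \<open>g k\<close> lie between 0 and \<open>card D\<close>. Below the
  level, \<open>card D - g k\<close> dominates the squared norm of (1 - \<gamma>) applied to the
  wave, and above it \<open>g k\<close> dominates that of \<gamma> applied to the wave, because
  \<gamma>^2 \<le> \<gamma> and (1 - \<gamma>)^2 \<le> 1 - \<gamma>. Each unit of deviation at a
  momentum of \<Theta> costs at least \<eta>.\<close>

lemma excess:
  fixes \<gamma> :: "'d site \<Rightarrow> 'd site \<Rightarrow> complex"
  assumes dm: "density_matrix D \<gamma>" and fill: "filling K E n \<mu> f"
    and few: "real (card {k\<in>K. \<bar>E k - \<mu>\<bar> < \<eta>}) \<le> \<kappa> * real M ^ CARD('d)" and \<eta>: "0 < \<eta>" and \<kappa>: "0 \<le> \<kappa>"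
    and \<pi>: "\<And>z. l1_norm z = 1 \<Longrightarrow> \<pi> * real M ^ CARD('d) \<le> cmod (\<Sum>k\<in>{k\<in>K. E k < \<mu>}. w k z)"
    and q: "0 \<le> q" "q \<le> \<pi> - \<kappa> - sqrt \<kappa>"
  shows "\<mu> * ((\<Sum>x\<in>D. Re (\<gamma> x x)) - n * real (card D)) + real (card D) * band_energy M f
      + \<eta> * q\<^sup>2 / (2 * real CARD('d)) * real (boundary (cuboid r (\<lambda>_. L)) D)
    \<le> Re (kinetic D \<gamma>)"
proof -
  define V where "V = real M ^ CARD('d)"
  have V: "V > 0" using M_pos by (simp add: V_def)
  define \<Lambda> where "\<Lambda> = cuboid r (\<lambda>_. L)"
  define F \<Theta> where "F = {k\<in>K. E k < \<mu>}" and "\<Theta> = {k\<in>K. \<eta> \<le> \<bar>E k - \<mu>\<bar>}"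
  define g where "g k = Re (qform D \<gamma> (w k))" for k
  define T where "T = (kinetic D \<gamma>)"
  define d where "d k y = (\<Sum>z\<in>D. \<gamma> y z * w k z) - of_bool (k \<in> F) * w k y" for k y
  define R where "R k = (\<Sum>y\<in>D. (cmod (d k y))\<^sup>2)" for k
  define B where "B = {y\<in>D. \<exists>x\<in>\<Lambda> - D. l1_norm (x - y) = 1}"
  have Vn: "complex_of_nat M ^ CARD('d) = complex_of_real V" by (simp add: V_def)
  have E: "(\<Sum>k\<in>K. E k * g k) = V * Re T"
    using arg_cong[OF sum_dispersion_qform_wave, of Re \<gamma>] unfolding Vn T_def[symmetric] by (simp add: g_def)
  have N: "(\<Sum>k\<in>K. g k) = V * (\<Sum>x\<in>D. Re (\<gamma> x x))"
    using arg_cong[OF sum_qform_wave, of Re \<gamma>] unfolding Vn by (simp add: g_def)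
  have nw: "(\<Sum>x\<in>D. (cmod (w k x))\<^sup>2) = real (card D)" for k by simp
  have tm: "(if k \<in> \<Theta> then \<eta> * R k else 0) \<le> (E k - \<mu>) * g k + real (card D) * (f k * (\<mu> - E k))" if k: "k \<in> K" for k
  proof -
    have g: "0 \<le> g k" "g k \<le> real (card D)"
      using density_matrix_nonneg[OF dm, of "w k"] density_matrix_le[OF dm, of "w k"] by (simp_all add: g_def)
    show ?thesis
    proof (cases "E k < \<mu>")
      case True
      then have "R k = (\<Sum>y\<in>D. (cmod (w k y - (\<Sum>z\<in>D. \<gamma> y z * w k z)))\<^sup>2)"
        using k by (simp add: R_def d_def F_def norm_minus_commute)
      then have R: "R k \<le> real (card D) - g k"
        using density_matrix_apply_compl_le[OF dm, of "w k"] by (simp add: g_def)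
      have "(if k \<in> \<Theta> then \<eta> * R k else 0) \<le> (\<mu> - E k) * (real (card D) - g k)"
      proof (cases "k \<in> \<Theta>")
        case t: True
        then have "\<eta> \<le> \<mu> - E k" using True by (simp add: \<Theta>_def)
        then show ?thesis using t R g \<eta> by (auto intro!: mult_mono simp: R_def sum_nonneg)
      next
        case False
        then show ?thesis using True g by simp
      qed
      also have "\<dots> = (E k - \<mu>) * g k + real (card D) * (f k * (\<mu> - E k))"
        using fill True k by (simp add: filling_def algebra_simps)
      finally show ?thesis .
    next
      case False
      then have "R k = (\<Sum>y\<in>D. (cmod (\<Sum>z\<in>D. \<gamma> y z * w k z))\<^sup>2)" by (simp add: R_def d_def F_def)
      then have R: "R k \<le> g k" using density_matrix_apply_le[OF dm, of "w k"] by (simp add: g_def)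
      \<comment> \<open>A fractional occupation occurs only at energy \<mu>, where it is multiplied
        by zero.\<close>
      have "f k * (\<mu> - E k) = 0" using fill False k by (cases "E k = \<mu>") (auto simp: filling_def)
      moreover have "(if k \<in> \<Theta> then \<eta> * R k else 0) \<le> (E k - \<mu>) * g k"
      proof (cases "k \<in> \<Theta>")
        case t: True
        then have "\<eta> \<le> E k - \<mu>" using False by (simp add: \<Theta>_def)
        then show ?thesis using t R g \<eta> by (auto intro!: mult_mono simp: R_def sum_nonneg)
      next
        case f: False
        then show ?thesis using False g by simp
      qed
      ultimately show ?thesis by (simp only: mult_zero_right add_0_right)
    qed
  qed
  have \<Theta>K: "\<Theta> \<subseteq> K" "F \<subseteq> K" by (auto simp: \<Theta>_def F_def)
  have "K - \<Theta> = {k\<in>K. \<bar>E k - \<mu>\<bar> < \<eta>}" by (auto simp: \<Theta>_def)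
  then have few': "real (card (K - \<Theta>)) \<le> \<kappa> * real M ^ CARD('d)" using few by simp
  have site: "q\<^sup>2 * V \<le> (\<Sum>k\<in>\<Theta>. (cmod (d k y))\<^sup>2)" if y: "y \<in> B" for y
  proof -
    obtain x where x: "x \<in> \<Lambda>" "x \<notin> D" "l1_norm (x - y) = 1" using y by (auto simp: B_def)
    have "l1_norm (y - x) = 1" using x(3) by (simp add: l1_norm_commute)
    then have "\<pi> * real M ^ CARD('d) \<le> cmod (\<Sum>k\<in>F. w k (y - x))" using \<pi>[of "y - x"] by (simp only: F_def)
    moreover have "y \<in> D" "x \<in> cuboid r (\<lambda>_. L)" using y x(1) by (simp_all add: B_def \<Lambda>_def)
    ultimately show ?thesis unfolding d_def V_def
      using excess_at_boundary_site[OF dm _ _ x(2) \<Theta>K(2,1) few' \<kappa> _ q] by blast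
  qed
  \<comment> \<open>The excess is counted once per boundary site, whereas a site can have up to 2d
    neighbours outside; this is the denominator in the coefficient of the boundary.\<close>
  have "real (boundary \<Lambda> D) \<le> 2 * real CARD('d) * real (card B)"
  proof -
    have "boundary \<Lambda> D \<le> 2 * CARD('d) * card B" unfolding B_def by (rule boundary_le[OF finite_D])
    then have "real (boundary \<Lambda> D) \<le> real (2 * CARD('d) * card B)" by (simp only: of_nat_le_iff)
    then show ?thesis by simp
  qed
  then have "\<eta> * q\<^sup>2 / (2 * real CARD('d)) * real (boundary \<Lambda> D) \<le> \<eta> * q\<^sup>2 / (2 * real CARD('d)) * (2 * real CARD('d) * real (card B))"
    using \<eta> by (intro mult_left_mono) auto
  also have "\<dots> = \<eta> * (q\<^sup>2 * real (card B))" by simp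
  finally have "V * (\<eta> * q\<^sup>2 / (2 * real CARD('d)) * real (boundary \<Lambda> D)) \<le> V * (\<eta> * (q\<^sup>2 * real (card B)))"
    using V by (intro mult_left_mono) auto
  also have "\<dots> = \<eta> * (\<Sum>y\<in>B. q\<^sup>2 * V)" by simp
  also have "\<dots> \<le> \<eta> * (\<Sum>y\<in>B. \<Sum>k\<in>\<Theta>. (cmod (d k y))\<^sup>2)"
    using \<eta> by (intro mult_left_mono sum_mono site) auto
  also have "\<dots> \<le> \<eta> * (\<Sum>y\<in>D. \<Sum>k\<in>\<Theta>. (cmod (d k y))\<^sup>2)"
    using \<eta> finite_D by (intro mult_left_mono sum_mono2) (auto simp: B_def sum_nonneg)
  also have "\<dots> = (\<Sum>k\<in>\<Theta>. \<eta> * R k)"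
    by (subst sum.swap) (simp only: R_def sum_distrib_left)
  also have "\<dots> = (\<Sum>k\<in>K. if k \<in> \<Theta> then \<eta> * R k else 0)"
    using \<Theta>K by (intro sum.mono_neutral_cong_left) auto
  also have "\<dots> \<le> (\<Sum>k\<in>K. (E k - \<mu>) * g k + real (card D) * (f k * (\<mu> - E k)))"
    by (intro sum_mono tm)
  also have "\<dots> = V * Re T - \<mu> * (V * (\<Sum>x\<in>D. Re (\<gamma> x x))) + real (card D) * (\<mu> * sum f K - (\<Sum>k\<in>K. f k * E k))"
    unfolding E[symmetric] N[symmetric]
    by (simp add: algebra_simps sum.distrib sum_subtractf sum_distrib_left)
  also have "sum f K = n * V" using fill by (simp add: filling_def card_K V_def)
  also have "V * Re T - \<mu> * (V * (\<Sum>x\<in>D. Re (\<gamma> x x))) + real (card D) * (\<mu> * (n * V) - (\<Sum>k\<in>K. f k * E k))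
     = V * (Re T - \<mu> * ((\<Sum>x\<in>D. Re (\<gamma> x x)) - n * real (card D)) - real (card D) * ((\<Sum>k\<in>K. f k * E k) / V))"
    using V by (simp add: field_simps)
  finally have "\<eta> * q\<^sup>2 / (2 * real CARD('d)) * real (boundary \<Lambda> D) \<le>
      Re T - \<mu> * ((\<Sum>x\<in>D. Re (\<gamma> x x)) - n * real (card D)) - real (card D) * ((\<Sum>k\<in>K. f k * E k) / V)"
    using V by (simp only: mult_le_cancel_left_pos)
  then show ?thesis unfolding T_def V_def \<Lambda>_def by linarith
qed

end

section \<open>Lower bound on the nearest-neighbour entry of the Fermi projection\<close>

lemma sum_dispersion_zero:
  assumes "M \<ge> 2"
  shows "(\<Sum>k\<in>modes (\<lambda>_::'d::finite. M). dispersion (\<lambda>_. M) k) = 0"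
proof -
  have "(\<Sum>k\<in>modes (\<lambda>_::'d. M). complex_of_real (dispersion (\<lambda>_. M) k) * wave (\<lambda>_. M) k 0) = 0"
    using assms by (subst sum_dispersion_wave) (auto simp: l1_norm_def)
  then have "complex_of_real (\<Sum>k\<in>modes (\<lambda>_::'d. M). dispersion (\<lambda>_. M) k) = 0" by simp
  then show ?thesis by (simp only: of_real_eq_0_iff)
qed

text \<open>Both the energies and the deviations f - n sum to zero, so the sum of f E equals that of
  (f - n) (E - \<mu>), in which no term is positive: each is at most - min n (1 - n) times the
  distance of the energy from \<mu>. For at least half of the momenta this distance is at least
  \<eta>.\<close>

lemma filling_energy_gap:
  fixes M :: nat
  defines "K \<equiv> modes (\<lambda>_::'d::finite. M)" and "E \<equiv> dispersion (\<lambda>_::'d. M)"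
  assumes M: "M \<ge> 2" and fill: "filling K E n \<mu> f" and n: "0 \<le> n" "n \<le> 1" and \<eta>: "\<eta> > 0"
    and few: "real (card {k\<in>K. \<bar>E k - \<mu>\<bar> < \<eta>}) \<le> real M ^ CARD('d) / 2"
  shows "min n (1 - n) * \<eta> / 2 * real M ^ CARD('d) \<le> - (\<Sum>k\<in>K. f k * E k)"
proof -
  define V where "V = real M ^ CARD('d)"
  have cK: "real (card K) = V" by (simp add: K_def card_modes V_def)
  have fK: "finite K" by (simp add: K_def)
  define A where "A = {k\<in>K. \<bar>E k - \<mu>\<bar> < \<eta>}"
  have "min n (1 - n) * \<eta> / 2 * V = min n (1 - n) * (\<eta> * (V - V / 2))" by (simp add: field_simps)
  also have "\<dots> \<le> min n (1 - n) * (\<eta> * (real (card K) - real (card A)))"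
    using n \<eta> few unfolding A_def cK by (intro mult_left_mono diff_mono) (auto simp: V_def)
  also have "real (card K) - real (card A) = real (card (K - A))"
    using fK by (subst card_Diff_subset) (auto simp: A_def of_nat_diff card_mono)
  also have "\<eta> * real (card (K - A)) = (\<Sum>k\<in>K - A. \<eta>)" by simp
  also have "\<dots> \<le> (\<Sum>k\<in>K - A. \<bar>E k - \<mu>\<bar>)" by (intro sum_mono) (auto simp: A_def)
  also have "\<dots> \<le> (\<Sum>k\<in>K. \<bar>E k - \<mu>\<bar>)" using fK by (intro sum_mono2) auto
  also have "min n (1 - n) * (\<Sum>k\<in>K. \<bar>E k - \<mu>\<bar>) = (\<Sum>k\<in>K. min n (1 - n) * \<bar>E k - \<mu>\<bar>)"
    by (rule sum_distrib_left)
  also have "\<dots> \<le> (\<Sum>k\<in>K. - ((f k - n) * (E k - \<mu>)))"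
  proof (rule sum_mono)
    fix k assume k: "k \<in> K"
    show "min n (1 - n) * \<bar>E k - \<mu>\<bar> \<le> - ((f k - n) * (E k - \<mu>))"
    proof (cases "E k < \<mu>")
      case True
      then have "f k = 1" using fill k by (simp add: filling_def)
      moreover have "min n (1 - n) * (\<mu> - E k) \<le> (1 - n) * (\<mu> - E k)" using True by (intro mult_right_mono) auto
      ultimately show ?thesis using True by (simp add: algebra_simps)
    next
      case False
      show ?thesis
      proof (cases "E k = \<mu>")
        case False
        then have gt: "\<mu> < E k" using \<open>\<not> E k < \<mu>\<close> by simp
        then have "f k = 0" using fill k by (simp add: filling_def)
        moreover have "min n (1 - n) * (E k - \<mu>) \<le> n * (E k - \<mu>)" using gt by (intro mult_right_mono) auto
        ultimately show ?thesis using gt by simp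
      qed simp
    qed
  qed
  also have "\<dots> = - (\<Sum>k\<in>K. f k * E k) + n * (\<Sum>k\<in>K. E k) + \<mu> * (sum f K - n * real (card K))"
    by (simp add: algebra_simps sum.distrib sum_subtractf sum_distrib_left sum_negf)
  also have "\<dots> = - (\<Sum>k\<in>K. f k * E k)"
    using sum_dispersion_zero[OF M, where 'd = 'd] fill by (simp add: filling_def K_def E_def)
  finally show ?thesis using n \<eta> by (simp add: V_def mult_left_mono)
qed

lemma Re_wave_neighbour:
  assumes "l1_norm z = 1"
  shows "\<exists>i. \<forall>k. Re (wave l k z) = cos (2 * pi * real (k i) / real (l i))"
proof -
  obtain i where "z = axis i 1 \<or> z = - axis i 1" using assms l1_norm_eq_1_iff by blast
  then show ?thesis by (auto simp: wave_minus wave_axis)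
qed

lemma dispersion_transpose:
  fixes M :: nat
  shows "dispersion (\<lambda>_::'d::finite. M) (k \<circ> Transposition.transpose i j) = dispersion (\<lambda>_. M) k"
proof -
  have "Transposition.transpose i j permutes (UNIV :: 'd set)" by (intro permutes_swap_id) auto
  from sum.permute[OF this, of "\<lambda>i. 2 * cos (2 * pi * real (k i) / real M)"]
  show ?thesis by (simp add: dispersion_def o_def)
qed

text \<open>By symmetry under permutations of the coordinates, the Fermi projection has the same
  nearest-neighbour entry in all directions, so this entry is proportional to the energy.\<close>

lemma fermi_hopping:
  fixes M :: nat
  assumes "l1_norm z = 1"
  shows "Re (\<Sum>k\<in>{k\<in>modes (\<lambda>_::'d::finite. M). dispersion (\<lambda>_. M) k < \<mu>}. wave (\<lambda>_. M) k z) =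
     - (\<Sum>k\<in>{k\<in>modes (\<lambda>_::'d. M). dispersion (\<lambda>_. M) k < \<mu>}. dispersion (\<lambda>_. M) k) / (2 * real CARD('d))"
proof -
  define F where "F = {k\<in>modes (\<lambda>_::'d. M). dispersion (\<lambda>_. M) k < \<mu>}"
  define c where "c i = (\<Sum>k\<in>F. cos (2 * pi * real (k i) / real M))" for i
  obtain i where i: "\<And>k. Re (wave (\<lambda>_. M) k z) = cos (2 * pi * real (k i) / real M)"
    using Re_wave_neighbour[OF assms, of "\<lambda>_. M"] by auto
  have cc: "c j = c i" for j
  proof -
    let ?T = "\<lambda>k::'d \<Rightarrow> nat. k \<circ> Transposition.transpose i j"
    have in_F: "?T k \<in> F" if "k \<in> F" for k
      using that by (auto simp: F_def dispersion_transpose) (auto simp: modes_def)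
    have inv: "?T (?T k) = k" for k by (simp add: comp_assoc)
    show ?thesis unfolding c_def
      by (rule sum.reindex_bij_witness[of _ ?T ?T]) (auto simp: inv in_F)
  qed
  have "(\<Sum>k\<in>F. dispersion (\<lambda>_. M) k) = - (\<Sum>j\<in>UNIV. 2 * c j)"
    unfolding dispersion_def sum_negf c_def sum_distrib_left by (subst sum.swap) simp
  also have "(\<Sum>j\<in>UNIV. 2 * c j) = (\<Sum>j\<in>(UNIV::'d set). 2 * c i)"
    by (intro sum.cong refl arg_cong[where f = "(*) 2"] cc)
  also have "\<dots> = 2 * real CARD('d) * c i" by simp
  finally show ?thesis unfolding F_def[symmetric] Re_sum i by (simp add: c_def)
qed

text \<open>The constants are fixed before the cube, \<open>D\<close> and \<gamma>. A first
  level-set bound yields the gap \<open>p\<close> of the band energy; \<open>p\<close> determines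
  which fraction \<kappa> of exceptional momenta is tolerable; \<kappa> determines the width \<eta>
  of the second level set, and with it \<open>a\<close>.\<close>

lemma uniform_excess:
  fixes n :: real
  assumes n: "0 < n" "n < 1"
  shows "\<exists>a M0. a > 0 \<and> (\<forall>M L r D \<gamma> \<mu> f.
    M \<ge> M0 \<and> L < M \<and> D \<subseteq> cuboid r (\<lambda>_::'d::finite. L) \<and> density_matrix D \<gamma> \<and>
    filling (modes (\<lambda>_::'d. M)) (dispersion (\<lambda>_::'d. M)) n \<mu> f \<longrightarrow>
    \<mu> * ((\<Sum>x\<in>D. Re (\<gamma> x x)) - n * real (card D))
      + real (card D) * band_energy M f
      + a * real (boundary (cuboid r (\<lambda>_. L)) D)
    \<le> Re (kinetic D \<gamma>))"
proof -
  define dd where "dd = real CARD('d)"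
  have dd: "dd \<ge> 1" by (simp add: dd_def Suc_leI)
  obtain \<eta>1 M1 where 1: "\<eta>1 > 0" "\<And>M \<mu>. M \<ge> M1 \<Longrightarrow>
      real (card {k\<in>modes (\<lambda>_::'d. M). \<bar>dispersion (\<lambda>_. M) k - \<mu>\<bar> < \<eta>1}) \<le> (1 / 2) * real M ^ CARD('d)"
    using level_set_small[of "1 / 2", where 'd = 'd] by auto
  define p where "p = min n (1 - n) * \<eta>1 / 2"
  have p: "p > 0" using n 1(1) by (simp add: p_def)
  \<comment> \<open>\<open>s\<close> is the square root of \<kappa>, and \<kappa> \<le> s \<le> q.
    Since \<pi> = 4 q - \<kappa>, subtracting \<kappa> and sqrt \<kappa> leaves at least q.\<close>
  define s where "s = min 1 (p / (8 * dd))"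
  define \<kappa> where "\<kappa> = s\<^sup>2"
  have s: "s > 0" "s \<le> 1" "s \<le> p / (8 * dd)" using p dd by (auto simp: s_def)
  have \<kappa>: "\<kappa> > 0" "\<kappa> \<le> s" "sqrt \<kappa> = s" using s by (simp_all add: \<kappa>_def power2_eq_square mult_left_le)
  define \<pi> where "\<pi> = (p - 2 * dd * \<kappa>) / (2 * dd)"
  define q where "q = p / (8 * dd)"
  have q: "q > 0" using p dd by (simp add: q_def)
  have "\<pi> = p / (2 * dd) - \<kappa>" using dd by (simp add: \<pi>_def field_simps)
  moreover have "p / (2 * dd) = 4 * q" by (simp add: q_def)
  moreover have "s \<le> q" using s by (simp add: q_def)
  ultimately have q\<pi>: "q \<le> \<pi> - \<kappa> - sqrt \<kappa>" unfolding \<kappa>(3) using \<kappa>(2) by linarith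
  obtain \<eta> M2 where 2: "\<eta> > 0" "\<And>M \<mu>. M \<ge> M2 \<Longrightarrow>
      real (card {k\<in>modes (\<lambda>_::'d. M). \<bar>dispersion (\<lambda>_. M) k - \<mu>\<bar> < \<eta>}) \<le> \<kappa> * real M ^ CARD('d)"
    using level_set_small[OF \<kappa>(1), where 'd = 'd] by auto
  define a where "a = \<eta> * q\<^sup>2 / (2 * real CARD('d))"
  have a: "a > 0" using 2(1) q by (simp add: a_def)
  define M0 where "M0 = max 2 (max M1 M2)"
  show ?thesis
  proof (intro exI[of _ a] exI[of _ M0] conjI a allI impI, elim conjE)
    fix M L :: nat and r :: "'d site" and D \<gamma> \<mu> and f :: "('d \<Rightarrow> nat) \<Rightarrow> real"
    assume M: "M \<ge> M0" "L < M" "D \<subseteq> cuboid r (\<lambda>_. L)" and dm: "density_matrix D \<gamma>"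
      and fill: "filling (modes (\<lambda>_::'d. M)) (dispersion (\<lambda>_::'d. M)) n \<mu> f"
    have Ms: "M \<ge> 2" "M \<ge> M1" "M \<ge> M2" using M(1) by (simp_all add: M0_def)
    define V where "V = real M ^ CARD('d)"
    define K where "K = modes (\<lambda>_::'d. M)"
    define E where "E = dispersion (\<lambda>_::'d. M)"
    have fK: "finite K" by (simp add: K_def)
    \<comment> \<open>The gap concerns the occupation \<open>f\<close>, the hopping entry concerns
      the states strictly below \<mu>. They differ on \<open>G\<close>, which has at most \<kappa> V
      momenta of energy at most 2d in modulus: hence the loss in the definition of \<pi>.\<close>
    define F G where "F = {k\<in>K. E k < \<mu>}" and "G = {k\<in>K. E k = \<mu>}"
    have gap: "p * V \<le> - (\<Sum>k\<in>K. f k * E k)"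
      using filling_energy_gap[OF Ms(1) fill _ _ 1(1)] 1(2)[OF Ms(2)] n by (simp add: p_def V_def K_def E_def)
    have "(\<Sum>k\<in>K. f k * E k) = (\<Sum>k\<in>F \<union> G. f k * E k)"
      using fill fK by (intro sum.mono_neutral_right) (auto simp: F_def G_def filling_def K_def E_def)
    also have "\<dots> = (\<Sum>k\<in>F. f k * E k) + (\<Sum>k\<in>G. f k * E k)"
      using fK by (intro sum.union_disjoint) (auto simp: F_def G_def)
    also have "(\<Sum>k\<in>F. f k * E k) = (\<Sum>k\<in>F. E k)"
      using fill by (intro sum.cong refl) (auto simp: F_def filling_def K_def E_def)
    finally have split: "(\<Sum>k\<in>K. f k * E k) = (\<Sum>k\<in>F. E k) + (\<Sum>k\<in>G. f k * E k)" .
    have "- (\<Sum>k\<in>G. f k * E k) \<le> \<bar>\<Sum>k\<in>G. f k * E k\<bar>" by simp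
    also have "\<dots> \<le> (\<Sum>k\<in>G. \<bar>f k * E k\<bar>)" by (rule sum_abs)
    also have "\<dots> \<le> (\<Sum>k\<in>G. 1 * (2 * dd))"
      unfolding abs_mult using fill
      by (intro sum_mono mult_mono) (auto simp: G_def filling_def K_def E_def dd_def intro: dispersion_bound)
    also have "\<dots> = 2 * dd * real (card G)" by simp
    also have "\<dots> \<le> 2 * dd * (\<kappa> * V)"
    proof -
      have "card G \<le> card {k\<in>K. \<bar>E k - \<mu>\<bar> < \<eta>}"
        using fK 2(1) by (intro card_mono) (auto simp: G_def)
      then have "real (card G) \<le> \<kappa> * V" using 2(2)[OF Ms(3), of \<mu>] by (simp add: K_def E_def V_def)
      then show ?thesis using dd by (intro mult_left_mono) auto
    qed
    finally have "(p - 2 * dd * \<kappa>) * V \<le> - (\<Sum>k\<in>F. E k)" using gap split by (simp add: algebra_simps)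
    then have F: "\<pi> * V \<le> - (\<Sum>k\<in>F. E k) / (2 * dd)"
      using dd divide_right_mono[of "(p - 2 * dd * \<kappa>) * V" "- (\<Sum>k\<in>F. E k)" "2 * dd"] by (simp add: \<pi>_def)
    have "\<pi> * real M ^ CARD('d) \<le> cmod (\<Sum>k\<in>{k\<in>modes (\<lambda>_::'d. M). dispersion (\<lambda>_. M) k < \<mu>}. wave (\<lambda>_. M) k z)"
      if z: "l1_norm z = 1" for z :: "'d site"
    proof -
      have "\<pi> * real M ^ CARD('d) \<le> Re (\<Sum>k\<in>{k\<in>modes (\<lambda>_::'d. M). dispersion (\<lambda>_. M) k < \<mu>}. wave (\<lambda>_. M) k z)"
        unfolding fermi_hopping[OF z] using F by (simp add: F_def K_def E_def V_def dd_def)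
      then show ?thesis using complex_Re_le_cmod order_trans by blast
    qed
    from excess[OF M(2,3) dm fill 2(2)[OF Ms(3)] 2(1) _ this _ q\<pi>] \<kappa>(1) q
    show "\<mu> * ((\<Sum>x\<in>D. Re (\<gamma> x x)) - n * real (card D))
      + real (card D) * band_energy M f
      + a * real (boundary (cuboid r (\<lambda>_. L)) D)
      \<le> Re (kinetic D \<gamma>)"
      unfolding a_def by simp
  qed
qed

section \<open>Finite repulsion\<close>

lemma boundary_compl:
  assumes "W \<subseteq> \<Lambda>"
  shows "boundary \<Lambda> (\<Lambda> - W) = boundary \<Lambda> W"
proof -
  have "{(x, y). x \<in> \<Lambda> - (\<Lambda> - W) \<and> y \<in> \<Lambda> - W \<and> l1_norm (x - y) = 1}
      = prod.swap ` {(x, y). x \<in> \<Lambda> - W \<and> y \<in> W \<and> l1_norm (x - y) = 1}"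
    using assms by (auto simp: image_iff l1_norm_commute)
  then show ?thesis unfolding boundary_def by (simp add: card_image)
qed

lemma sum_adjacent_le:
  fixes u :: "'d::finite site \<Rightarrow> real"
  assumes "finite A" "finite B" "\<And>x. x \<in> A \<Longrightarrow> 0 \<le> u x"
  shows "(\<Sum>x\<in>A. \<Sum>y\<in>B. of_bool (l1_norm (x - y) = 1) * u x) \<le> 2 * real CARD('d) * (\<Sum>x\<in>A. u x)"
proof -
  have "(\<Sum>y\<in>B. of_bool (l1_norm (x - y) = 1)) \<le> 2 * real CARD('d)" for x :: "'d site"
  proof -
    have "(\<Sum>y\<in>B. of_bool (l1_norm (x - y) = 1)) = real (card {y\<in>B. l1_norm (y - x) = 1})"
      using assms(2) by (simp add: of_bool_def sum.If_cases l1_norm_commute[of x] Int_def)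
    also have "card {y\<in>B. l1_norm (y - x) = 1} \<le> 2 * CARD('d)"
      by (rule order_trans[OF card_mono[OF finite_neighbours[of x]] card_neighbours[of x]]) auto
    then have "real (card {y\<in>B. l1_norm (y - x) = 1}) \<le> real (2 * CARD('d))" by (simp only: of_nat_le_iff)
    finally show ?thesis by simp
  qed
  then have "(\<Sum>x\<in>A. (\<Sum>y\<in>B. of_bool (l1_norm (x - y) = 1)) * u x) \<le> (\<Sum>x\<in>A. 2 * real CARD('d) * u x)"
    using assms(3) by (intro sum_mono mult_right_mono) auto
  then show ?thesis by (simp add: sum_distrib_right sum_distrib_left)
qed

text \<open>Removing the sites outside \<open>D\<close> costs little if \<open>\<beta>\<close>, which is the density of the particles or
  of the holes there, has small trace outside \<open>D\<close>.\<close>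

lemma hopping_restrict:
  fixes \<gamma> \<beta> :: "'d::finite site \<Rightarrow> 'd site \<Rightarrow> complex"
  assumes dm: "density_matrix \<Lambda> \<beta>" and fin: "finite \<Lambda>" and D: "D \<subseteq> \<Lambda>"
    and abs: "\<And>x y. x \<noteq> y \<Longrightarrow> cmod (\<gamma> x y) = cmod (\<beta> x y)" and \<nu>: "\<nu> > 0"
  shows "Re (kinetic D \<gamma>)
      - 2 * real CARD('d) * (1 + \<nu>) * (\<Sum>x\<in>\<Lambda> - D. Re (\<beta> x x)) - real (boundary \<Lambda> D) / \<nu>
    \<le> Re (kinetic \<Lambda> \<gamma>)"
proof -
  define D' where "D' = \<Lambda> - D"
  have fD: "finite D" "finite D'" "D' \<subseteq> \<Lambda>" using fin D finite_subset by (auto simp: D'_def)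
  have \<Lambda>: "\<Lambda> = D \<union> D'" "D \<inter> D' = {}" using D by (auto simp: D'_def)
  define b where "b x y = Re (- of_bool (l1_norm (x - y) = 1) * \<gamma> x y)" for x y
  define c where "c x y = of_bool (l1_norm (x - y) = 1) * cmod (\<beta> x y)" for x y
  have herm: "cmod (\<beta> y x) = cmod (\<beta> x y)" for x y
    using density_matrix_hermitian[OF dm, of y x] by (metis complex_mod_cnj)
  have csym: "c x y = c y x" for x y unfolding c_def using herm[of x y] l1_norm_commute[of x y] by simp
  have l0: "l1_norm (0 :: 'd site) = 0" by (simp add: l1_norm_def)
  have bc: "- c x y \<le> b x y" for x y
  proof (cases "l1_norm (x - y) = 1")
    case True
    then have "x \<noteq> y" using l0 by auto
    then show ?thesis using True abs[of x y] complex_Re_le_cmod[of "\<gamma> x y"] by (simp add: b_def c_def)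
  qed (simp add: b_def c_def)
  have nn: "0 \<le> Re (\<beta> x x)" if "x \<in> D'" for x
    using density_matrix_diag(1)[OF dm fin, of x] that fD(3) by auto
  have split: "(\<Sum>x\<in>\<Lambda>. \<Sum>y\<in>\<Lambda>. b x y) = (\<Sum>x\<in>D. \<Sum>y\<in>D. b x y) + (\<Sum>x\<in>D. \<Sum>y\<in>D'. b x y)
      + (\<Sum>x\<in>D'. \<Sum>y\<in>D. b x y) + (\<Sum>x\<in>D'. \<Sum>y\<in>D'. b x y)"
    unfolding \<Lambda>(1) using fD \<Lambda>(2) by (simp add: sum.union_disjoint sum.distrib)
  have lower: "- (\<Sum>x\<in>A. \<Sum>y\<in>B. c x y) \<le> (\<Sum>x\<in>A. \<Sum>y\<in>B. b x y)" for A B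
    unfolding sum_negf[symmetric] by (intro sum_mono bc)
  define t where "t = (\<Sum>x\<in>D'. Re (\<beta> x x))"
  \<comment> \<open>Within the removed region an off-diagonal entry is bounded by the mean of two
    diagonal ones, and each site has at most 2d neighbours.\<close>
  have out: "(\<Sum>x\<in>D'. \<Sum>y\<in>D'. c x y) \<le> 2 * real CARD('d) * t"
  proof -
    have "(\<Sum>x\<in>D'. \<Sum>y\<in>D'. c x y) \<le> (\<Sum>x\<in>D'. \<Sum>y\<in>D'. of_bool (l1_norm (x - y) = 1) * (Re (\<beta> x x) / 2)
        + of_bool (l1_norm (y - x) = 1) * (Re (\<beta> y y) / 2))"
    proof (intro sum_mono)
      fix x y assume xy: "x \<in> D'" "y \<in> D'"
      show "c x y \<le> of_bool (l1_norm (x - y) = 1) * (Re (\<beta> x x) / 2) + of_bool (l1_norm (y - x) = 1) * (Re (\<beta> y y) / 2)"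
      proof (cases "l1_norm (x - y) = 1")
        case True
        then have "x \<noteq> y" using l0 by auto
        then have "2 * cmod (\<beta> x y) \<le> Re (\<beta> x x) + Re (\<beta> y y)"
          using xy fD(3) by (intro density_matrix_entry_mean[OF dm fin]) auto
        then show ?thesis using True l1_norm_commute[of x y] by (simp add: c_def)
      qed (simp add: c_def l1_norm_commute[of y x])
    qed
    also have "\<dots> = 2 * (\<Sum>x\<in>D'. \<Sum>y\<in>D'. of_bool (l1_norm (x - y) = 1) * (Re (\<beta> x x) / 2))"
      using sum.swap[of "\<lambda>x y. of_bool (l1_norm (y - x) = 1) * (Re (\<beta> y y) / 2)" D' D']
      by (simp add: sum.distrib)
    also have "\<dots> \<le> 2 * (2 * real CARD('d) * (\<Sum>x\<in>D'. Re (\<beta> x x) / 2))"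
      using nn fD by (intro mult_left_mono sum_adjacent_le) auto
    also have "\<dots> = 2 * real CARD('d) * t" by (simp add: t_def sum_divide_distrib[symmetric])
    finally show ?thesis .
  qed
  \<comment> \<open>Across the boundary only one of the two diagonal entries is under control, and
    the entry is bounded by its square root. Young's inequality with weight \<nu> trades this root
    for trace plus boundary.\<close>
  have cross: "2 * (\<Sum>x\<in>D'. \<Sum>y\<in>D. c x y) \<le> 2 * real CARD('d) * \<nu> * t + real (boundary \<Lambda> D) / \<nu>"
  proof -
    have "2 * (\<Sum>x\<in>D'. \<Sum>y\<in>D. c x y) = (\<Sum>x\<in>D'. \<Sum>y\<in>D. 2 * c x y)" by (simp add: sum_distrib_left)
    also have "\<dots> \<le> (\<Sum>x\<in>D'. \<Sum>y\<in>D. of_bool (l1_norm (x - y) = 1) * (\<nu> * Re (\<beta> x x)) + of_bool (l1_norm (x - y) = 1) / \<nu>)"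
    proof (intro sum_mono)
      fix x y assume xy: "x \<in> D'" "y \<in> D"
      have "(cmod (\<beta> x y))\<^sup>2 \<le> Re (\<beta> x x)"
        using density_matrix_entry_sqrt[OF dm fin, of y x] xy fD(3) D herm[of x y] by auto
      then have "\<nu> * (cmod (\<beta> x y))\<^sup>2 \<le> \<nu> * Re (\<beta> x x)" using \<nu> by simp
      moreover have "2 * cmod (\<beta> x y) \<le> \<nu> * (cmod (\<beta> x y))\<^sup>2 + 1 / \<nu>"
      proof -
        have "0 \<le> (\<nu> * cmod (\<beta> x y) - 1)\<^sup>2 / \<nu>" using \<nu> by simp
        also have "\<dots> = \<nu> * (cmod (\<beta> x y))\<^sup>2 + 1 / \<nu> - 2 * cmod (\<beta> x y)"
          using \<nu> by (simp add: power2_eq_square field_simps)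
        finally show ?thesis by simp
      qed
      ultimately have "2 * cmod (\<beta> x y) \<le> \<nu> * Re (\<beta> x x) + 1 / \<nu>" by linarith
      then show "2 * c x y \<le> of_bool (l1_norm (x - y) = 1) * (\<nu> * Re (\<beta> x x)) + of_bool (l1_norm (x - y) = 1) / \<nu>"
        by (simp add: c_def)
    qed
    also have "\<dots> = (\<Sum>x\<in>D'. \<Sum>y\<in>D. of_bool (l1_norm (x - y) = 1) * (\<nu> * Re (\<beta> x x)))
        + (\<Sum>x\<in>D'. \<Sum>y\<in>D. of_bool (l1_norm (x - y) = 1)) / \<nu>"
      by (simp add: sum.distrib sum_divide_distrib)
    also have "(\<Sum>x\<in>D'. \<Sum>y\<in>D. of_bool (l1_norm (x - y) = 1)) = real (boundary \<Lambda> D)"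
    proof -
      have "{(x, y). x \<in> \<Lambda> - D \<and> y \<in> D \<and> l1_norm (x - y) = 1} = (SIGMA x:D'. {y \<in> D. l1_norm (x - y) = 1})"
        by (auto simp: D'_def)
      then show ?thesis using fD(1,2) unfolding boundary_def
        by (simp add: card_SigmaI of_bool_def sum.If_cases Int_def)
    qed
    also have "(\<Sum>x\<in>D'. \<Sum>y\<in>D. of_bool (l1_norm (x - y) = 1) * (\<nu> * Re (\<beta> x x))) \<le> 2 * real CARD('d) * (\<Sum>x\<in>D'. \<nu> * Re (\<beta> x x))"
      using nn fD \<nu> by (intro sum_adjacent_le) auto
    finally show ?thesis by (simp add: t_def sum_distrib_left mult.assoc)
  qed
  have "(\<Sum>x\<in>D. \<Sum>y\<in>D'. c x y) = (\<Sum>x\<in>D'. \<Sum>y\<in>D. c x y)"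
    by (subst sum.swap) (simp only: csym)
  then have "(\<Sum>x\<in>D. \<Sum>y\<in>D. b x y) - 2 * real CARD('d) * (1 + \<nu>) * t - real (boundary \<Lambda> D) / \<nu> \<le> (\<Sum>x\<in>\<Lambda>. \<Sum>y\<in>\<Lambda>. b x y)"
    using split lower[of D D'] lower[of D' D] lower[of D' D'] out cross by (simp add: algebra_simps)
  then show ?thesis by (simp only: b_def t_def D'_def Re_sum)
qed

text \<open>One-particle Hamiltonian of a light particle when the heavy ones occupy
  \<open>W\<close>. With \<open>U = 0\<close> it is plain hopping, which also serves for the heavy
  particles.\<close>

definition hubbard_matrix :: "real \<Rightarrow> 'd::finite site set \<Rightarrow> 'd site \<Rightarrow> 'd site \<Rightarrow> complex" where
  "hubbard_matrix U W x y = - of_bool (l1_norm (x - y) = 1) + of_real U * of_bool (x = y \<and> x \<in> W)"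

lemma hubbard_matrix_trace:
  assumes "finite \<Lambda>" "W \<subseteq> \<Lambda>"
  shows "Re (\<Sum>x\<in>\<Lambda>. \<Sum>y\<in>\<Lambda>. hubbard_matrix U W x y * \<gamma> y x) =
    Re (kinetic \<Lambda> \<gamma>) + U * (\<Sum>x\<in>W. Re (\<gamma> x x))"
proof -
  have "(\<Sum>x\<in>\<Lambda>. \<Sum>y\<in>\<Lambda>. hubbard_matrix U W x y * \<gamma> y x) =
      (\<Sum>x\<in>\<Lambda>. \<Sum>y\<in>\<Lambda>. - of_bool (l1_norm (y - x) = 1) * \<gamma> y x)
      + (\<Sum>x\<in>\<Lambda>. \<Sum>y\<in>\<Lambda>. of_real U * of_bool (x = y \<and> x \<in> W) * \<gamma> y x)"
    unfolding sum.distrib[symmetric]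
    by (intro sum.cong refl) (simp add: hubbard_matrix_def l1_norm_commute algebra_simps)
  also have "(\<Sum>x\<in>\<Lambda>. \<Sum>y\<in>\<Lambda>. - of_bool (l1_norm (y - x) = 1) * \<gamma> y x) =
      (kinetic \<Lambda> \<gamma>)"
    by (rule sum.swap)
  also have "(\<Sum>x\<in>\<Lambda>. \<Sum>y\<in>\<Lambda>. of_real U * of_bool (x = y \<and> x \<in> W) * \<gamma> y x) = (\<Sum>x\<in>\<Lambda>. if x \<in> W then of_real U * \<gamma> x x else 0)"
  proof (rule sum.cong[OF refl])
    fix x assume "x \<in> \<Lambda>"
    have "(\<Sum>y\<in>\<Lambda>. of_real U * of_bool (x = y \<and> x \<in> W) * \<gamma> y x) = (\<Sum>y\<in>\<Lambda>. if y = x then (if x \<in> W then of_real U * \<gamma> x x else 0) else 0)"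
      by (intro sum.cong refl) auto
    then show "(\<Sum>y\<in>\<Lambda>. of_real U * of_bool (x = y \<and> x \<in> W) * \<gamma> y x) = (if x \<in> W then of_real U * \<gamma> x x else 0)"
      using assms(1) \<open>x \<in> \<Lambda>\<close> by simp
  qed
  also have "\<dots> = (\<Sum>x\<in>W. of_real U * \<gamma> x x)"
    using assms by (intro sum.mono_neutral_cong_right) auto
  finally show ?thesis by (simp add: sum_distrib_left)
qed

context
  fixes \<Lambda> W :: "'d::finite site set" and \<gamma> :: "'d site \<Rightarrow> 'd site \<Rightarrow> complex" and a \<mu> U e n :: real
  assumes fin: "finite \<Lambda>" and W: "W \<subseteq> \<Lambda>" and dm: "density_matrix \<Lambda> \<gamma>" and a: "a > 0"
    and \<mu>: "\<bar>\<mu>\<bar> \<le> 2 * real CARD('d)" and U: "U \<ge> 4 * real CARD('d) + 4 * real CARD('d) / a"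
begin

text \<open>With \<nu> = 2 / a, restricting to \<open>D\<close> uses up half of the boundary energy
  and costs 2d (1 + 2 / a) per misplaced particle or hole. Another 2d bounds the Fermi level.
  Together this is the threshold 4d + 4d / a.\<close>

private lemma cost: "2 * real CARD('d) * (1 + 2 / a) \<le> U - \<bar>\<mu>\<bar>"
  using \<mu> U by (simp add: distrib_left)

text \<open>\<open>t\<close> is the expected number of light particles on top of heavy ones. They
  are missing in the complement of \<open>W\<close>, which changes the bulk term by - \<mu> t, and
  they contribute U t; the difference pays for the restriction.\<close>

lemma hubbard_lower_bound_low_filling:
  assumes ex: "\<mu> * ((\<Sum>x\<in>\<Lambda> - W. Re (\<gamma> x x)) - n * real (card (\<Lambda> - W))) + real (card (\<Lambda> - W)) * e + a * real (boundary \<Lambda> (\<Lambda> - W))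
      \<le> Re (kinetic (\<Lambda> - W) \<gamma>)"
    and tr: "(\<Sum>x\<in>\<Lambda>. Re (\<gamma> x x)) = n * real (card (\<Lambda> - W))"
  shows "real (card (\<Lambda> - W)) * e + a / 2 * real (boundary \<Lambda> W) \<le> Re (\<Sum>x\<in>\<Lambda>. \<Sum>y\<in>\<Lambda>. hubbard_matrix U W x y * \<gamma> y x)"
proof -
  define t where "t = (\<Sum>x\<in>W. Re (\<gamma> x x))"
  have t: "0 \<le> t" unfolding t_def using density_matrix_diag(1)[OF dm fin] W by (intro sum_nonneg) auto
  have "(\<Sum>x\<in>\<Lambda> - W. Re (\<gamma> x x)) = n * real (card (\<Lambda> - W)) - t"
    using tr sum.subset_diff[OF W fin, of "\<lambda>x. Re (\<gamma> x x)"] by (simp add: t_def)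
  then have ex': "- \<mu> * t + real (card (\<Lambda> - W)) * e + a * real (boundary \<Lambda> W)
      \<le> Re (kinetic (\<Lambda> - W) \<gamma>)"
    using ex by (simp add: boundary_compl[OF W])
  have "\<Lambda> - (\<Lambda> - W) = W" using W by auto
  then have hr: "Re (kinetic (\<Lambda> - W) \<gamma>)
      - 2 * real CARD('d) * (1 + 2 / a) * t - real (boundary \<Lambda> W) / (2 / a)
    \<le> Re (kinetic \<Lambda> \<gamma>)"
    using hopping_restrict[OF dm fin, of "\<Lambda> - W" \<gamma> "2 / a"] a by (simp add: boundary_compl[OF W] t_def)
  have "2 * real CARD('d) * (1 + 2 / a) * t \<le> (U - \<bar>\<mu>\<bar>) * t" using cost t by (rule mult_right_mono)
  moreover have "(U - \<bar>\<mu>\<bar>) * t \<le> (U - \<mu>) * t" using t by (intro mult_right_mono) auto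
  ultimately have "2 * real CARD('d) * (1 + 2 / a) * t \<le> U * t - \<mu> * t" by (simp add: left_diff_distrib)
  moreover have "real (boundary \<Lambda> W) / (2 / a) = a / 2 * real (boundary \<Lambda> W)" "a * real (boundary \<Lambda> W) = a / 2 * real (boundary \<Lambda> W) + a / 2 * real (boundary \<Lambda> W)"
    by simp_all
  ultimately show ?thesis
    unfolding hubbard_matrix_trace[OF fin W] t_def[symmetric] using ex' hr by linarith
qed

text \<open>Particle-hole dual of the low filling: \<open>t\<close> is the expected number of holes
  outside \<open>W\<close>. Each hole puts one more light particle into \<open>W\<close>, at the
  price U + \<mu>, which pays for the restriction to \<open>W\<close>.\<close>

lemma hubbard_lower_bound_high_filling:
  assumes ex: "\<mu> * ((\<Sum>x\<in>W. Re (\<gamma> x x)) - n * real (card W)) + real (card W) * e + a * real (boundary \<Lambda> W)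
      \<le> Re (kinetic W \<gamma>)"
    and tr: "(\<Sum>x\<in>\<Lambda>. Re (\<gamma> x x)) = real (card (\<Lambda> - W)) + n * real (card W)"
  shows "real (card W) * e + U * (n * real (card W)) + a / 2 * real (boundary \<Lambda> W)
    \<le> Re (\<Sum>x\<in>\<Lambda>. \<Sum>y\<in>\<Lambda>. hubbard_matrix U W x y * \<gamma> y x)"
proof -
  define \<beta> where "\<beta> = (\<lambda>x y. of_bool (x = y) - \<gamma> x y)"
  have dm\<beta>: "density_matrix \<Lambda> \<beta>" unfolding \<beta>_def by (rule density_matrix_compl[OF dm fin])
  define t where "t = (\<Sum>x\<in>\<Lambda> - W. Re (\<beta> x x))"
  have t: "0 \<le> t" unfolding t_def using density_matrix_diag(1)[OF dm\<beta> fin] by (intro sum_nonneg) auto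
  have "t = real (card (\<Lambda> - W)) - (\<Sum>x\<in>\<Lambda> - W. Re (\<gamma> x x))" by (simp add: t_def \<beta>_def sum_subtractf)
  then have trW: "(\<Sum>x\<in>W. Re (\<gamma> x x)) = n * real (card W) + t"
    using tr sum.subset_diff[OF W fin, of "\<lambda>x. Re (\<gamma> x x)"] by simp
  have abs: "cmod (\<gamma> x y) = cmod (\<beta> x y)" if "x \<noteq> y" for x y using that by (simp add: \<beta>_def)
  have hr: "Re (kinetic W \<gamma>)
      - 2 * real CARD('d) * (1 + 2 / a) * t - real (boundary \<Lambda> W) / (2 / a)
    \<le> Re (kinetic \<Lambda> \<gamma>)"
    using hopping_restrict[OF dm\<beta> fin W abs, of "2 / a"] a by (simp add: t_def)
  have "2 * real CARD('d) * (1 + 2 / a) * t \<le> (U - \<bar>\<mu>\<bar>) * t" using cost t by (rule mult_right_mono)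
  moreover have "(U - \<bar>\<mu>\<bar>) * t \<le> (U + \<mu>) * t" using t by (intro mult_right_mono) auto
  ultimately have "2 * real CARD('d) * (1 + 2 / a) * t \<le> U * t + \<mu> * t" by (simp add: distrib_right)
  moreover have "real (boundary \<Lambda> W) / (2 / a) = a / 2 * real (boundary \<Lambda> W)" "a * real (boundary \<Lambda> W) = a / 2 * real (boundary \<Lambda> W) + a / 2 * real (boundary \<Lambda> W)"
    by simp_all
  moreover have "\<mu> * t + real (card W) * e + a * real (boundary \<Lambda> W)
      \<le> Re (kinetic W \<gamma>)"
    using ex unfolding trW by simp
  moreover have "U * (\<Sum>x\<in>W. Re (\<gamma> x x)) = U * (n * real (card W)) + U * t"
    unfolding trW by (rule distrib_left)
  ultimately show ?thesis
    unfolding hubbard_matrix_trace[OF fin W] using hr by linarith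
qed

end

section \<open>Trial orbitals\<close>

text \<open>Bathtub principle: among occupations with values in [0, 1] and given total, filling the
  lowest levels minimizes the energy. The last term pays for a total of \<open>p\<close> different
  from the integer \<open>m\<close>.\<close>

lemma ex_lowest_subset:
  fixes E :: "'k \<Rightarrow> real"
  assumes fin: "finite K" and m: "m \<le> card K" and p: "\<And>k. k \<in> K \<Longrightarrow> 0 \<le> p k \<and> p k \<le> 1"
    and b: "\<And>k. k \<in> K \<Longrightarrow> \<bar>E k\<bar> \<le> b"
  shows "\<exists>A. A \<subseteq> K \<and> card A = m \<and> sum E A \<le> (\<Sum>k\<in>K. p k * E k) + b * \<bar>real m - sum p K\<bar>"
proof (cases "K = {}")
  case False
  then have cK: "card K > 0" using fin by (simp add: card_gt_0_iff)
  obtain \<mu> f where f: "filling K E (real m / real (card K)) \<mu> f"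
    using ex_filling[OF fin False, of "real m / real (card K)" E] m cK by auto
  have sf: "sum f K = real m" using f cK by (simp add: filling_def)
  have \<mu>: "\<bar>\<mu>\<bar> \<le> b" using f b by (auto simp: filling_def)
  define A B where "A = {k\<in>K. E k < \<mu>}" and "B = {k\<in>K. E k \<le> \<mu>}"
  have fA: "finite A" "finite B" "A \<subseteq> B" "B \<subseteq> K" using fin by (auto simp: A_def B_def)
  have "real (card A) = (\<Sum>k\<in>A. f k)" using f by (simp add: A_def filling_def)
  also have "\<dots> \<le> sum f K" using f fin by (intro sum_mono2) (auto simp: A_def filling_def)
  finally have "card A \<le> m" using sf by simp
  moreover have "real m \<le> real (card B)"
  proof -
    have "sum f K = sum f B" using f fin by (intro sum.mono_neutral_right) (auto simp: B_def filling_def)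
    also have "\<dots> \<le> (\<Sum>k\<in>B. 1)" using f by (intro sum_mono) (auto simp: B_def filling_def)
    finally show ?thesis using sf by simp
  qed
  \<comment> \<open>All states strictly below \<mu> are taken; the rest is chosen arbitrarily among
    the states at \<mu>.\<close>
  ultimately obtain C where C: "A \<subseteq> C" "C \<subseteq> B" "card C = m"
    using exists_subset_between[of A m B] fA by auto
  have CK: "C \<subseteq> K" using C fA by auto
  have "sum E C - \<mu> * real m = (\<Sum>k\<in>C. E k - \<mu>)" using C by (simp add: sum_subtractf)
  also have "\<dots> = (\<Sum>k\<in>K. if k \<in> C then E k - \<mu> else 0)"
    using CK fin by (intro sum.mono_neutral_cong_left) auto
  also have "\<dots> \<le> (\<Sum>k\<in>K. p k * (E k - \<mu>))"
  proof (rule sum_mono)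
    fix k assume k: "k \<in> K"
    show "(if k \<in> C then E k - \<mu> else 0) \<le> p k * (E k - \<mu>)"
    proof (cases "k \<in> C")
      case True
      then have "E k - \<mu> \<le> 0" using C by (auto simp: B_def)
      then have "1 * (E k - \<mu>) \<le> p k * (E k - \<mu>)" using p[OF k] by (intro mult_right_mono_neg) auto
      then show ?thesis using True by simp
    next
      case False
      then have "0 \<le> E k - \<mu>" using C k by (auto simp: A_def)
      then show ?thesis using p[OF k] False by simp
    qed
  qed
  also have "\<dots> = (\<Sum>k\<in>K. p k * E k) - \<mu> * sum p K"
    by (simp add: algebra_simps sum_subtractf sum_distrib_left)
  finally have "sum E C \<le> (\<Sum>k\<in>K. p k * E k) + \<mu> * (real m - sum p K)" by (simp add: algebra_simps)
  also have "\<mu> * (real m - sum p K) \<le> \<bar>\<mu>\<bar> * \<bar>real m - sum p K\<bar>" by (simp add: abs_mult[symmetric])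
  also have "\<dots> \<le> b * \<bar>real m - sum p K\<bar>" using \<mu> by (intro mult_right_mono) auto
  finally show ?thesis using C CK by auto
qed (use m in auto)

section \<open>Energy of plane waves truncated to a box\<close>

lemma card_cuboid_shell:
  fixes l :: "'d::finite \<Rightarrow> nat"
  assumes l: "\<And>i. l i > 0" and e: "e = axis i 1 \<or> e = - axis i 1"
  shows "real (card {y\<in>cuboid r l. y + e \<notin> cuboid r l}) \<le> real (card (cuboid r l)) / real (l i)"
proof -
  define c where "c = (if e = axis i 1 then r $ i + int (l i) - 1 else r $ i)"
  define r' where "r' = (\<chi> j. if j = i then c else r $ j)"
  define l' where "l' j = (if j = i then 1 else l j)" for j
  have "{y\<in>cuboid r l. y + e \<notin> cuboid r l} \<subseteq> cuboid r' l'"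
  proof
    fix y assume y: "y \<in> {y\<in>cuboid r l. y + e \<notin> cuboid r l}"
    have yr: "r $ j \<le> y $ j" "y $ j < r $ j + int (l j)" for j using y by (auto simp: cuboid_def)
    have ej: "(y + e) $ j = y $ j" if "j \<noteq> i" for j using e that by (auto simp: axis_def)
    have "y + e \<notin> cuboid r l" using y by simp
    then obtain j where j: "\<not> (r $ j \<le> (y + e) $ j \<and> (y + e) $ j < r $ j + int (l j))" unfolding cuboid_def by blast
    have ji: "j = i" using j ej[of j] yr[of j] by (cases "j = i") auto
    have "y $ i = c"
    proof (cases "e = axis i 1")
      case True
      then show ?thesis using j yr[of i] unfolding ji c_def by (simp add: axis_def)
    next
      case False
      then have "e $ i = - 1" using e by (auto simp: axis_def)
      then show ?thesis using False j yr[of i] unfolding ji c_def by simp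
    qed
    then show "y \<in> cuboid r' l'" using yr unfolding cuboid_def by (simp add: r'_def l'_def)
  qed
  then have "card {y\<in>cuboid r l. y + e \<notin> cuboid r l} \<le> card (cuboid r' l')" by (intro card_mono) auto
  also have "card (cuboid r' l') = (\<Prod>j\<in>UNIV - {i}. l j)"
    unfolding card_cuboid by (subst prod.remove[of _ i]) (auto simp: l'_def intro: prod.cong)
  finally have "real (card {y\<in>cuboid r l. y + e \<notin> cuboid r l}) \<le> real (\<Prod>j\<in>UNIV - {i}. l j)" by (simp only: of_nat_le_iff)
  also have "card (cuboid r l) = l i * (\<Prod>j\<in>UNIV - {i}. l j)"
    unfolding card_cuboid by (subst prod.remove[of _ i]) auto
  then have "real (\<Prod>j\<in>UNIV - {i}. l j) = real (card (cuboid r l)) / real (l i)" using l[of i] by simp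
  finally show ?thesis .
qed

text \<open>The function can deviate from \<open>c\<close> only on the face through which the shift
  leaves the box, and there by at most 2.\<close>

lemma sum_shift_ge:
  fixes l :: "'d::finite \<Rightarrow> nat"
  assumes l: "\<And>i. l i > 0" and e: "e = axis i 1 \<or> e = - axis i 1" and c: "\<bar>c\<bar> \<le> 1"
    and h: "\<And>y. y \<in> cuboid r l \<Longrightarrow> y + e \<in> cuboid r l \<Longrightarrow> h y = c"
    and hb: "\<And>y. y \<in> cuboid r l \<Longrightarrow> \<bar>h y\<bar> \<le> (1::real)"
  shows "real (card (cuboid r l)) * c - 2 * (real (card (cuboid r l)) / real (l i)) \<le> (\<Sum>y\<in>cuboid r l. h y)"
proof -
  let ?R = "cuboid r l"
  have "real (card ?R) * c - 2 * (real (card ?R) / real (l i)) \<le> real (card ?R) * c - 2 * real (card {y\<in>?R. y + e \<notin> ?R})"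
    using card_cuboid_shell[where l = l, OF l e, of r] by linarith
  also have "\<dots> = (\<Sum>y\<in>?R. c - 2 * of_bool (y + e \<notin> ?R))"
    by (simp add: sum_subtractf sum_distrib_left[symmetric] of_bool_def sum.If_cases Int_def)
  also have "\<dots> \<le> (\<Sum>y\<in>?R. h y)"
  proof (rule sum_mono)
    fix y assume "y \<in> ?R"
    then show "c - 2 * of_bool (y + e \<notin> ?R) \<le> h y"
      using h[of y] hb[of y] c by (cases "y + e \<in> ?R") auto
  qed
  finally show ?thesis .
qed

lemma sum_adjacent:
  fixes g :: "'d::finite site \<Rightarrow> complex"
  assumes "finite R"
  shows "(\<Sum>x\<in>R. of_bool (l1_norm (x - y) = 1) * g x) =
    (\<Sum>i\<in>UNIV. of_bool (y + axis i 1 \<in> R) * g (y + axis i 1) + of_bool (y - axis i 1 \<in> R) * g (y - axis i 1))"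
proof -
  have "(\<Sum>x\<in>R. of_bool (l1_norm (x - y) = 1) * g x) =
      (\<Sum>x\<in>R. \<Sum>i\<in>UNIV. of_bool (x = y + axis i 1) * g x + of_bool (x = y - axis i 1) * g x)"
  proof (rule sum.cong[OF refl])
    fix x
    have e: "x - y = axis i 1 \<longleftrightarrow> x = y + axis i 1" "x - y = - axis i 1 \<longleftrightarrow> x = y - axis i 1" for i
      by (auto simp: algebra_simps)
    show "of_bool (l1_norm (x - y) = 1) * g x = (\<Sum>i\<in>UNIV. of_bool (x = y + axis i 1) * g x + of_bool (x = y - axis i 1) * g x)"
      unfolding sum_axis_eq[symmetric] sum_distrib_right distrib_right e ..
  qed
  also have "\<dots> = (\<Sum>i\<in>UNIV. (\<Sum>x\<in>R. of_bool (x = y + axis i 1) * g x) + (\<Sum>x\<in>R. of_bool (x = y - axis i 1) * g x))"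
    by (subst sum.swap) (simp only: sum.distrib)
  also have "\<dots> = (\<Sum>i\<in>UNIV. of_bool (y + axis i 1 \<in> R) * g (y + axis i 1) + of_bool (y - axis i 1 \<in> R) * g (y - axis i 1))"
  proof -
    have "(\<Sum>x\<in>R. of_bool (x = z) * g x) = of_bool (z \<in> R) * g z" for z
      using assms by (simp add: of_bool_def if_distrib[where f = "\<lambda>c. c * _"] cong: if_cong)
    then show ?thesis by simp
  qed
  finally show ?thesis .
qed

text \<open>Compared with the periodic box, the bonds joining opposite faces are missing. In each
  direction two faces are affected, each with a fraction \<open>1 / l i\<close> of the sites and an
  error of at most 2 per site.\<close>

lemma wave_energy_le:
  fixes l :: "'d::finite \<Rightarrow> nat"
  assumes l: "\<And>i. l i > 0"
  shows "Re (\<Sum>x\<in>cuboid r l. \<Sum>y\<in>cuboid r l. - of_bool (l1_norm (x - y) = 1) * (cnj (wave l k x) * wave l k y))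
    \<le> real (card (cuboid r l)) * (dispersion l k + (\<Sum>i\<in>UNIV. 4 / real (l i)))"
proof -
  let ?R = "cuboid r l"
  define c where "c i = cos (2 * pi * real (k i) / real (l i))" for i
  define h1 h2 where "h1 i y = of_bool (y + axis i 1 \<in> ?R) * c i" and "h2 i y = of_bool (y - axis i 1 \<in> ?R) * c i" for i y
  have "(\<Sum>x\<in>?R. \<Sum>y\<in>?R. - of_bool (l1_norm (x - y) = 1) * (cnj (wave l k x) * wave l k y))
      = (\<Sum>y\<in>?R. \<Sum>x\<in>?R. - of_bool (l1_norm (x - y) = 1) * (cnj (wave l k x) * wave l k y))"
    by (rule sum.swap)
  also have "\<dots> = - (\<Sum>y\<in>?R. \<Sum>x\<in>?R. of_bool (l1_norm (x - y) = 1) * wave l k (y - x))"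
    by (simp add: sum_negf wave_diff mult.commute)
  also have "\<dots> = - (\<Sum>y\<in>?R. \<Sum>i\<in>UNIV. of_bool (y + axis i 1 \<in> ?R) * wave l k (- axis i 1)
      + of_bool (y - axis i 1 \<in> ?R) * wave l k (axis i 1))"
    unfolding sum_adjacent[OF finite_cuboid] by simp
  also have "Re \<dots> = - (\<Sum>y\<in>?R. \<Sum>i\<in>UNIV. h1 i y + h2 i y)"
  proof -
    have "Re (of_bool b * z) = of_bool b * Re z" for b z by simp
    then show ?thesis by (simp only: h1_def h2_def c_def wave_minus wave_axis Re_sum plus_complex.sel
        uminus_complex.sel cnj.sel cis.sel)
  qed
  also have "\<dots> = - (\<Sum>i\<in>UNIV. (\<Sum>y\<in>?R. h1 i y) + (\<Sum>y\<in>?R. h2 i y))"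
    by (subst sum.swap) (simp only: sum.distrib)
  also have "\<dots> \<le> - (\<Sum>i\<in>UNIV. (real (card ?R) * c i - 2 * (real (card ?R) / real (l i)))
      + (real (card ?R) * c i - 2 * (real (card ?R) / real (l i))))"
  proof (intro le_imp_neg_le sum_mono add_mono)
    fix i
    show "real (card ?R) * c i - 2 * (real (card ?R) / real (l i)) \<le> (\<Sum>y\<in>?R. h1 i y)"
      by (rule sum_shift_ge[where e = "axis i 1"]) (auto simp: l h1_def c_def)
    show "real (card ?R) * c i - 2 * (real (card ?R) / real (l i)) \<le> (\<Sum>y\<in>?R. h2 i y)"
      by (rule sum_shift_ge[where e = "- axis i 1"]) (auto simp: l h2_def c_def)
  qed
  also have "\<dots> = real (card ?R) * (dispersion l k + (\<Sum>i\<in>UNIV. 4 / real (l i)))"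
    by (simp add: dispersion_def c_def sum_distrib_left sum.distrib[symmetric] sum_negf[symmetric] algebra_simps)
  finally show ?thesis .
qed

section \<open>Overlaps between the waves of a box and those of the torus\<close>

lemma sum_wave_box_eq:
  fixes l :: "'d::finite \<Rightarrow> nat"
  assumes l: "\<And>i. l i > 0" and xy: "x \<in> cuboid r l" "y \<in> cuboid r l"
  shows "(\<forall>i. int (l i) dvd (x - y) $ i) \<longleftrightarrow> x = y"
proof
  assume d: "\<forall>i. int (l i) dvd (x - y) $ i"
  have "(x - y) $ i = 0" for i
  proof (rule ccontr)
    assume "(x - y) $ i \<noteq> 0"
    then have "int (l i) \<le> \<bar>(x - y) $ i\<bar>" using d by (metis abs_of_nat dvd_imp_le_int)
    moreover have "r $ i \<le> x $ i" "x $ i < r $ i + int (l i)" "r $ i \<le> y $ i" "y $ i < r $ i + int (l i)"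
      using xy by (auto simp: cuboid_def)
    ultimately show False by simp
  qed
  then show "x = y" by (simp add: vec_eq_iff)
qed simp

text \<open>Weighting \<open>wave l \<kappa> e\<close> with the squared overlaps of \<open>u\<close>
  and the box waves gives the expectation in \<open>u\<close> of the periodic shift of the box by
  \<open>e\<close>. Since a shift multiplies \<open>u\<close> by \<open>c\<close>, each site
  contributes \<open>c\<close> unless the shift wraps around there.\<close>

lemma sum_modes_shift_ge:
  fixes l :: "'d::finite \<Rightarrow> nat" and u :: "'d site \<Rightarrow> complex" and r :: "'d site"
  assumes l: "\<And>i. l i > 0" and e: "e = axis i 1 \<or> e = - axis i 1"
    and u: "\<And>x. cmod (u x) = 1" "\<And>x. u (x + e) * cnj (u x) = c"
  defines "R \<equiv> cuboid r l"
  shows "real (card R) * (real (card R) * Re c - 2 * (real (card R) / real (l i))) \<le>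
    Re (\<Sum>\<kappa>\<in>modes l. wave l \<kappa> e * complex_of_real ((cmod (\<Sum>x\<in>R. cnj (wave l \<kappa> x) * u x))\<^sup>2))"
proof -
  \<comment> \<open>\<open>P x y\<close> says that \<open>x\<close> is \<open>y + e\<close> up to
    the periods of the box.\<close>
  define P where "P x y \<longleftrightarrow> (\<forall>j. int (l j) dvd (e + y - x) $ j)" for x y
  have uniq: "x = x'" if "P x y" "P x' y" "x \<in> R" "x' \<in> R" for x x' y
  proof -
    have "int (l j) dvd (x' - x) $ j" for j
    proof -
      have "(x' - x) $ j = (e + y - x) $ j - (e + y - x') $ j" by simp
      then show ?thesis using that(1,2) unfolding P_def by (metis dvd_diff)
    qed
    then show ?thesis using sum_wave_box_eq[where l = l, OF l, of x' r x] that(3,4) unfolding R_def by blast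
  qed
  have fR: "finite R" by (simp add: R_def)
  have cR: "(\<Prod>i\<in>UNIV. l i) = card R" by (simp add: R_def card_cuboid)
  define G where "G y = (\<Sum>x\<in>R. of_bool (P x y) * (u x * cnj (u y)))" for y
  have "wave l \<kappa> e * complex_of_real ((cmod (\<Sum>x\<in>R. cnj (wave l \<kappa> x) * u x))\<^sup>2) =
      (\<Sum>y\<in>R. \<Sum>x\<in>R. u x * cnj (u y) * wave l \<kappa> (e + y - x))" for \<kappa>
    unfolding cnj_mult_self[symmetric] cnj_sum sum_product unfolding sum_distrib_left
    by (intro sum.cong refl) (simp add: wave_add wave_diff mult_ac)
  then have "(\<Sum>\<kappa>\<in>modes l. wave l \<kappa> e * complex_of_real ((cmod (\<Sum>x\<in>R. cnj (wave l \<kappa> x) * u x))\<^sup>2)) =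
      (\<Sum>\<kappa>\<in>modes l. \<Sum>y\<in>R. \<Sum>x\<in>R. u x * cnj (u y) * wave l \<kappa> (e + y - x))" by (simp only:)
  also have "\<dots> = (\<Sum>y\<in>R. \<Sum>\<kappa>\<in>modes l. \<Sum>x\<in>R. u x * cnj (u y) * wave l \<kappa> (e + y - x))"
    by (rule sum.swap)
  also have "\<dots> = (\<Sum>y\<in>R. \<Sum>x\<in>R. u x * cnj (u y) * (\<Sum>\<kappa>\<in>modes l. wave l \<kappa> (e + y - x)))"
    unfolding sum_distrib_left by (intro sum.cong refl sum.swap)
  also have "\<dots> = of_nat (card R) * (\<Sum>y\<in>R. G y)"
    unfolding sum_wave[where l = l, OF l] cR G_def sum_distrib_left P_def[symmetric] by (intro sum.cong refl) simp
  finally have eq: "(\<Sum>\<kappa>\<in>modes l. wave l \<kappa> e * complex_of_real ((cmod (\<Sum>x\<in>R. cnj (wave l \<kappa> x) * u x))\<^sup>2))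
      = of_nat (card R) * (\<Sum>y\<in>R. G y)" .
  have single: "G y = u x * cnj (u y)" if "x \<in> R" "P x y" for x y
  proof -
    have "G y = (\<Sum>z\<in>{x}. of_bool (P z y) * (u z * cnj (u y)))"
      unfolding G_def using fR that uniq by (intro sum.mono_neutral_right) auto
    then show ?thesis using that by simp
  qed
  have Gb: "cmod (G y) \<le> 1" for y
  proof (cases "\<exists>x\<in>R. P x y")
    case True
    then show ?thesis using single by (auto simp: norm_mult u)
  next
    case False
    then have "G y = 0" unfolding G_def by (intro sum.neutral) auto
    then show ?thesis by simp
  qed
  have Ge: "G y = c" if "y + e \<in> R" for y
    using single[of "y + e" y] that u(2)[of y] by (simp add: P_def)
  have "cmod c = cmod (u (0 + e)) * cmod (cnj (u 0))" unfolding u(2)[of 0, symmetric] by (rule norm_mult)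
  then have "cmod c = 1" by (simp add: u(1))
  then have c1: "\<bar>Re c\<bar> \<le> 1" using abs_Re_le_cmod[of c] by simp
  have "real (card R) * Re c - 2 * (real (card R) / real (l i)) \<le> (\<Sum>y\<in>R. Re (G y))"
    unfolding R_def
  proof (rule sum_shift_ge[OF l e c1])
    show "Re (G y) = Re c" if "y + e \<in> cuboid r l" for y using Ge that by (simp add: R_def)
    show "\<bar>Re (G y)\<bar> \<le> 1" for y using Gb[of y] abs_Re_le_cmod[of "G y"] by linarith
  qed
  then have "real (card R) * (real (card R) * Re c - 2 * (real (card R) / real (l i))) \<le> real (card R) * (\<Sum>y\<in>R. Re (G y))"
    by (rule mult_left_mono) simp
  then show ?thesis unfolding eq by simp
qed

lemma sum_modes_parseval:
  fixes l :: "'d::finite \<Rightarrow> nat" and u :: "'d site \<Rightarrow> complex" and r :: "'d site"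
  assumes l: "\<And>i. l i > 0"
  defines "R \<equiv> cuboid r l"
  shows "(\<Sum>\<kappa>\<in>modes l. (cmod (\<Sum>x\<in>R. cnj (wave l \<kappa> x) * u x))\<^sup>2) = real (card R) * (\<Sum>x\<in>R. (cmod (u x))\<^sup>2)"
proof -
  have cR: "(\<Prod>i\<in>UNIV. l i) = card R" by (simp add: R_def card_cuboid)
  have fR: "finite R" by (simp add: R_def)
  have "complex_of_real (\<Sum>\<kappa>\<in>modes l. (cmod (\<Sum>x\<in>R. cnj (wave l \<kappa> x) * u x))\<^sup>2)
      = (\<Sum>\<kappa>\<in>modes l. \<Sum>y\<in>R. \<Sum>x\<in>R. u x * cnj (u y) * wave l \<kappa> (y - x))"
    unfolding of_real_sum cnj_mult_self[symmetric] cnj_sum sum_product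
    by (intro sum.cong refl) (simp add: wave_diff mult_ac)
  also have "\<dots> = (\<Sum>y\<in>R. \<Sum>\<kappa>\<in>modes l. \<Sum>x\<in>R. u x * cnj (u y) * wave l \<kappa> (y - x))"
    by (rule sum.swap)
  also have "\<dots> = (\<Sum>y\<in>R. \<Sum>x\<in>R. u x * cnj (u y) * (\<Sum>\<kappa>\<in>modes l. wave l \<kappa> (y - x)))"
    unfolding sum_distrib_left by (intro sum.cong refl sum.swap)
  also have "\<dots> = (\<Sum>y\<in>R. \<Sum>x\<in>R. if x = y then of_nat (card R) * (cnj (u y) * u y) else 0)"
    unfolding sum_wave[where l = l, OF l] cR using sum_wave_box_eq[where l = l and r = r, OF l] by (intro sum.cong refl) (auto simp: R_def)
  also have "\<dots> = (\<Sum>y\<in>R. of_nat (card R) * (cnj (u y) * u y))" using fR by simp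
  also have "\<dots> = complex_of_real (real (card R) * (\<Sum>x\<in>R. (cmod (u x))\<^sup>2))"
    unfolding cnj_mult_self by (simp add: sum_distrib_left)
  finally show ?thesis by (simp only: of_real_eq_iff)
qed

text \<open>Trial orbitals: comparing the plane waves of a box with the restriction to the box of the
  Fermi projection of the large torus. The overlaps \<open>|A \<kappa> k|\<^sup>2\<close> form, up to a factor, a doubly
  stochastic matrix.\<close>

lemma trial_orbitals:
  fixes l :: "'d::finite \<Rightarrow> nat" and r :: "'d site" and M L m :: nat
  assumes l: "\<And>i. l i > 0" "\<And>i. l i \<le> L" and LM: "L < M" and n: "0 \<le> n" "n \<le> 1"
    and fill: "filling (modes (\<lambda>_::'d. M)) (dispersion (\<lambda>_::'d. M)) n \<mu> f" and m: "m \<le> card (cuboid r l)"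
  defines "R \<equiv> cuboid r l"
  shows "\<exists>A. A \<subseteq> modes l \<and> card A = m \<and>
    (\<Sum>k\<in>A. Re (kinetic R (\<lambda>x y. cnj (wave l k x) * wave l k y)) / real (card R))
    \<le> real (card R) * band_energy M f
      + 8 * (\<Sum>i\<in>UNIV. real (card R) / real (l i)) + 2 * real CARD('d) * \<bar>real m - n * real (card R)\<bar>"
proof -
  define V where "V = real M ^ CARD('d)"
  have V: "V > 0" using LM by (simp add: V_def)
  define K where "K = modes (\<lambda>_::'d. M)"
  define E where "E = dispersion (\<lambda>_::'d. M)"
  define w where "w = wave (\<lambda>_::'d. M)"
  define N where "N = real (card R)"
  define s where "s = (\<Sum>i\<in>UNIV. N / real (l i))"
  have cR: "card R = card (modes l)" by (simp add: R_def card_cuboid card_modes)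
  have "card R > 0" using l(1) by (simp add: R_def card_cuboid prod_pos)
  then have N: "N > 0" by (simp add: N_def)
  have fK: "finite K" by (simp add: K_def)
  have f01: "0 \<le> f k" "f k \<le> 1" if "k \<in> K" for k using fill that by (auto simp: filling_def K_def)
  have sf: "sum f K = n * V" using fill by (simp add: filling_def K_def V_def card_modes)
  have RL: "R \<subseteq> cuboid r (\<lambda>_. L)"
  proof
    fix x assume "x \<in> R"
    then have "r $ i \<le> x $ i \<and> x $ i < r $ i + int L" for i
      using l(2)[of i] unfolding R_def cuboid_def by (auto intro: less_le_trans[of _ "r $ i + int (l i)"])
    then show "x \<in> cuboid r (\<lambda>_. L)" by (simp add: cuboid_def)
  qed
  define A where "A \<kappa> k = (cmod (\<Sum>x\<in>R. cnj (wave l \<kappa> x) * w k x))\<^sup>2" for \<kappa> k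
  have A0: "0 \<le> A \<kappa> k" for \<kappa> k by (simp add: A_def)
  have A1: "(\<Sum>k\<in>K. A \<kappa> k) = V * N" for \<kappa>
    unfolding A_def K_def w_def V_def parseval[OF LM RL] by (simp add: N_def)
  have A2: "(\<Sum>\<kappa>\<in>modes l. A \<kappa> k) = N * N" for k
    unfolding A_def N_def R_def sum_modes_parseval[where l = l, OF l(1)] by (simp add: w_def)
  \<comment> \<open>Weighted with the overlaps of the torus wave \<open>k\<close>, the box energies
    average to at most the torus energy of \<open>k\<close> plus a surface term.\<close>
  have A3: "(\<Sum>\<kappa>\<in>modes l. dispersion l \<kappa> * A \<kappa> k) \<le> N * (N * E k + 4 * s)" for k
  proof -
    define T where "T e = Re (\<Sum>\<kappa>\<in>modes l. wave l \<kappa> e * complex_of_real (A \<kappa> k))" for e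
    have T: "N * (N * cos (2 * pi * real (k i) / real M) - 2 * (N / real (l i))) \<le> T e"
      if e: "e = axis i 1 \<or> e = - axis i 1" for e i
    proof -
      have "Re (w k e) = cos (2 * pi * real (k i) / real M)"
        using e by (auto simp: w_def wave_minus wave_axis)
      moreover have "w k (x + e) * cnj (w k x) = w k e" for x
        using wave_diff[of "\<lambda>_. M" k "x + e" x] by (simp add: w_def)
      then have "N * (N * Re (w k e) - 2 * (N / real (l i))) \<le> T e"
        unfolding T_def A_def N_def R_def by (intro sum_modes_shift_ge[where l = l, OF l(1) e]) (simp_all add: w_def)
      ultimately show ?thesis by simp
    qed
    have "complex_of_real (\<Sum>\<kappa>\<in>modes l. dispersion l \<kappa> * A \<kappa> k) =
        (\<Sum>\<kappa>\<in>modes l. - (\<Sum>i\<in>UNIV. wave l \<kappa> (axis i 1) * complex_of_real (A \<kappa> k) + wave l \<kappa> (- axis i 1) * complex_of_real (A \<kappa> k)))"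
      unfolding of_real_sum of_real_mult dispersion_wave by (simp only: sum_distrib_right distrib_right mult_minus_left)
    also have "\<dots> = - (\<Sum>i\<in>UNIV. (\<Sum>\<kappa>\<in>modes l. wave l \<kappa> (axis i 1) * complex_of_real (A \<kappa> k))
        + (\<Sum>\<kappa>\<in>modes l. wave l \<kappa> (- axis i 1) * complex_of_real (A \<kappa> k)))"
      unfolding sum_negf by (subst sum.swap) (simp only: sum.distrib)
    finally have "(\<Sum>\<kappa>\<in>modes l. dispersion l \<kappa> * A \<kappa> k) = - (\<Sum>i\<in>UNIV. T (axis i 1) + T (- axis i 1))"
      unfolding T_def by (metis (no_types, lifting) Re_complex_of_real Re_sum plus_complex.sel(1) sum.cong uminus_complex.sel(1))
    also have "\<dots> \<le> - (\<Sum>i\<in>UNIV. N * (N * cos (2 * pi * real (k i) / real M) - 2 * (N / real (l i)))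
        + N * (N * cos (2 * pi * real (k i) / real M) - 2 * (N / real (l i))))"
      by (intro le_imp_neg_le sum_mono add_mono T) auto
    also have "\<dots> = N * (N * E k + 4 * s)"
      by (simp add: E_def dispersion_def s_def sum_distrib_left sum.distrib[symmetric] sum_negf[symmetric] algebra_simps)
    finally show ?thesis .
  qed
  \<comment> \<open>The occupation of the box wave \<kappa> in the Fermi sea of the torus cut down
    to the box. The sums of \<open>A\<close> over either index give it values in [0, 1] and the
    total n \<open>N\<close>.\<close>
  define p where "p \<kappa> = (\<Sum>k\<in>K. f k * A \<kappa> k) / (V * N)" for \<kappa>
  have p01: "0 \<le> p \<kappa> \<and> p \<kappa> \<le> 1" for \<kappa>
  proof -
    have "(\<Sum>k\<in>K. f k * A \<kappa> k) \<le> (\<Sum>k\<in>K. 1 * A \<kappa> k)" using f01 A0 by (intro sum_mono mult_right_mono) auto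
    then have "(\<Sum>k\<in>K. f k * A \<kappa> k) \<le> V * N" using A1 by simp
    moreover have "0 \<le> (\<Sum>k\<in>K. f k * A \<kappa> k)" using f01 A0 by (intro sum_nonneg mult_nonneg_nonneg) auto
    ultimately show ?thesis using V N by (simp add: p_def)
  qed
  have sp: "sum p (modes l) = n * N"
  proof -
    have "sum p (modes l) = (\<Sum>k\<in>K. f k * (\<Sum>\<kappa>\<in>modes l. A \<kappa> k)) / (V * N)"
      unfolding p_def sum_divide_distrib[symmetric] by (subst sum.swap) (simp only: sum_distrib_left)
    also have "\<dots> = sum f K * (N * N) / (V * N)" unfolding A2 by (simp add: sum_distrib_right)
    finally show ?thesis using V N by (simp add: sf)
  qed
  have pE: "(\<Sum>\<kappa>\<in>modes l. p \<kappa> * dispersion l \<kappa>) \<le> N * ((\<Sum>k\<in>K. f k * E k) / V) + 4 * s"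
  proof -
    have t: "p \<kappa> * dispersion l \<kappa> = (\<Sum>k\<in>K. f k * (dispersion l \<kappa> * A \<kappa> k)) / (V * N)" for \<kappa>
      unfolding p_def times_divide_eq_left sum_distrib_right by (simp only: mult_ac)
    have "(\<Sum>\<kappa>\<in>modes l. p \<kappa> * dispersion l \<kappa>) = (\<Sum>\<kappa>\<in>modes l. \<Sum>k\<in>K. f k * (dispersion l \<kappa> * A \<kappa> k)) / (V * N)"
      unfolding t sum_divide_distrib[symmetric] ..
    also have "\<dots> = (\<Sum>k\<in>K. f k * (\<Sum>\<kappa>\<in>modes l. dispersion l \<kappa> * A \<kappa> k)) / (V * N)"
      by (subst sum.swap) (simp only: sum_distrib_left)
    also have "\<dots> \<le> (\<Sum>k\<in>K. f k * (N * (N * E k + 4 * s))) / (V * N)"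
      using f01 V N by (intro divide_right_mono sum_mono mult_left_mono A3) auto
    also have "(\<Sum>k\<in>K. f k * (N * (N * E k + 4 * s))) = N * N * (\<Sum>k\<in>K. f k * E k) + N * (4 * s) * sum f K"
      by (simp add: sum_distrib_left sum_distrib_right sum.distrib algebra_simps)
    also have "(N * N * (\<Sum>k\<in>K. f k * E k) + N * (4 * s) * sum f K) / (V * N) = N * ((\<Sum>k\<in>K. f k * E k) / V) + n * (4 * s)"
      using V N by (simp add: sf field_simps)
    also have "n * (4 * s) \<le> 1 * (4 * s)" using n N by (intro mult_right_mono) (auto simp: s_def sum_nonneg)
    finally show ?thesis by simp
  qed
  obtain B where B: "B \<subseteq> modes l" "card B = m"
    "sum (dispersion l) B \<le> (\<Sum>\<kappa>\<in>modes l. p \<kappa> * dispersion l \<kappa>) + 2 * real CARD('d) * \<bar>real m - sum p (modes l)\<bar>"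
    using ex_lowest_subset[of "modes l" m p "dispersion l" "2 * real CARD('d)"] p01 dispersion_bound m cR R_def by auto
  have "(\<Sum>k\<in>B. Re (kinetic R (\<lambda>x y. cnj (wave l k x) * wave l k y)) / N)
      \<le> (\<Sum>k\<in>B. dispersion l k + (\<Sum>i\<in>UNIV. 4 / real (l i)))"
    using wave_energy_le[where l = l and r = r, OF l(1)] N by (intro sum_mono) (simp add: N_def R_def divide_le_eq mult.commute)
  also have "\<dots> = sum (dispersion l) B + real m * (\<Sum>i\<in>UNIV. 4 / real (l i))"
    by (simp add: sum.distrib B(2))
  also have "real m * (\<Sum>i\<in>UNIV. 4 / real (l i)) \<le> N * (\<Sum>i\<in>UNIV. 4 / real (l i))"
    using m by (intro mult_right_mono sum_nonneg) (auto simp: N_def R_def)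
  also have "N * (\<Sum>i\<in>UNIV. 4 / real (l i)) = 4 * s" by (simp add: s_def sum_distrib_left mult.commute)
  \<comment> \<open>Of the surface term, 4 s stems from averaging the energies and 4 s from
    truncating the box waves.\<close>
  finally have "(\<Sum>k\<in>B. Re (kinetic R (\<lambda>x y. cnj (wave l k x) * wave l k y)) / N)
      \<le> N * ((\<Sum>k\<in>K. f k * E k) / V) + 8 * s + 2 * real CARD('d) * \<bar>real m - n * N\<bar>"
    using B(3) pE sp by simp
  then show ?thesis using B(1,2) unfolding N_def K_def E_def V_def s_def by blast
qed

section \<open>The Hamiltonian in first quantization\<close>

lemma fock_scale: "\<psi> \<in> fock \<Lambda> \<Longrightarrow> (\<lambda>xs. c * \<psi> xs) \<in> fock \<Lambda>"
  by (auto simp: fock_def)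

lemma fock_n_scale: "\<psi> \<in> fock_n \<Lambda> N \<Longrightarrow> (\<lambda>xs. c * \<psi> xs) \<in> fock_n \<Lambda> N"
  by (auto simp: fock_n_def fock_scale)

text \<open>Antisymmetry turns the sign in \<open>create\<close> into the one needed to bring the
  new entry back to position i, and the square roots cancel. Hopping thus just replaces an entry; on
  the empty list both sides vanish.\<close>

lemma create_annihilate:
  assumes "\<psi> \<in> fock \<Lambda>"
  shows "create x (annihilate y \<psi>) xs = (\<Sum>i | i < length xs \<and> xs ! i = x. \<psi> (xs[i := y]))"
proof -
  have "(-1) ^ i * annihilate y \<psi> (take i xs @ drop (Suc i) xs) = of_real (sqrt (real (length xs))) * \<psi> (xs[i := y])"
    if i: "i < length xs" for i
  proof -
    have "\<psi> (xs[i := y] ! i # take i (xs[i := y]) @ drop (Suc i) (xs[i := y])) = (-1) ^ i * \<psi> (xs[i := y])"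
      using i by (intro fock_move_front[OF assms]) auto
    then have "\<psi> (y # take i xs @ drop (Suc i) xs) = (-1) ^ i * \<psi> (xs[i := y])" using i by simp
    moreover have "length (take i xs @ drop (Suc i) xs) + 1 = length xs" using i by simp
    ultimately show ?thesis unfolding annihilate_def by (simp add: power_mult_distrib[symmetric] mult_ac flip: power_add)
  qed
  then have "create x (annihilate y \<psi>) xs = of_real (1 / sqrt (real (length xs))) *
      (\<Sum>i | i < length xs \<and> xs ! i = x. of_real (sqrt (real (length xs))) * \<psi> (xs[i := y]))"
    unfolding create_def by simp
  also have "\<dots> = (\<Sum>i | i < length xs \<and> xs ! i = x. \<psi> (xs[i := y]))"
    by (cases "length xs = 0") (simp_all add: sum_distrib_left[symmetric])
  finally show ?thesis .
qed

lemma create_annihilate_same: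
  assumes "\<psi> \<in> fock \<Lambda>"
  shows "create x (annihilate x \<psi>) xs = of_bool (x \<in> set xs) * \<psi> xs"
proof (cases "distinct xs")
  case True
  have "(\<Sum>i | i < length xs \<and> xs ! i = x. \<psi> (xs[i := x])) = (\<Sum>i | i < length xs \<and> xs ! i = x. \<psi> xs)"
    by (intro sum.cong refl) auto
  also have "\<dots> = of_bool (x \<in> set xs) * \<psi> xs"
  proof (cases "x \<in> set xs")
    case in_set: True
    then obtain i where i: "i < length xs" "xs ! i = x" by (auto simp: in_set_conv_nth)
    then have "{i. i < length xs \<and> xs ! i = x} = {i}" using True by (auto simp: nth_eq_iff_index_eq)
    then show ?thesis using in_set by simp
  next
    case False
    then have "{i. i < length xs \<and> xs ! i = x} = {}" by auto
    then show ?thesis using False by simp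
  qed
  finally show ?thesis unfolding create_annihilate[OF assms] .
next
  case False
  then have "\<psi> xs = 0" by (rule fock_not_distinct[OF assms])
  moreover have "(\<Sum>i | i < length xs \<and> xs ! i = x. \<psi> (xs[i := x])) = 0"
  proof (rule sum.neutral, rule ballI)
    fix i assume "i \<in> {i. i < length xs \<and> xs ! i = x}"
    then have "xs[i := x] = xs" by auto
    then show "\<psi> (xs[i := x]) = 0" using \<open>\<psi> xs = 0\<close> by simp
  qed
  ultimately show ?thesis unfolding create_annihilate[OF assms] by simp
qed

lemma sum_bonds_create_annihilate:
  assumes "\<psi> \<in> fock \<Lambda>" "finite \<Lambda>" "set xs \<subseteq> \<Lambda>"
  shows "(\<Sum>(x, y)\<in>bonds \<Lambda>. create x (annihilate y \<psi>) xs) =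
    (\<Sum>i<length xs. \<Sum>y\<in>\<Lambda>. of_bool (l1_norm (xs ! i - y) = 1) * \<psi> (xs[i := y]))"
proof -
  have "(\<Sum>(x, y)\<in>bonds \<Lambda>. create x (annihilate y \<psi>) xs) =
      (\<Sum>p\<in>\<Lambda> \<times> \<Lambda>. case p of (x, y) \<Rightarrow> of_bool (l1_norm (x - y) = 1) * create x (annihilate y \<psi>) xs)"
    using assms(2) by (intro sum.mono_neutral_cong_left) (auto simp: bonds_def)
  also have "\<dots> = (\<Sum>x\<in>\<Lambda>. \<Sum>y\<in>\<Lambda>. of_bool (l1_norm (x - y) = 1) * create x (annihilate y \<psi>) xs)"
    by (simp add: sum.cartesian_product case_prod_unfold)
  also have "\<dots> = (\<Sum>x\<in>\<Lambda>. \<Sum>y\<in>\<Lambda>. \<Sum>i | i < length xs \<and> xs ! i = x. of_bool (l1_norm (x - y) = 1) * \<psi> (xs[i := y]))"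
    unfolding create_annihilate[OF assms(1)] sum_distrib_left ..
  also have "\<dots> = (\<Sum>x\<in>\<Lambda>. \<Sum>i | i < length xs \<and> xs ! i = x. \<Sum>y\<in>\<Lambda>. of_bool (l1_norm (x - y) = 1) * \<psi> (xs[i := y]))"
    by (intro sum.cong refl sum.swap)
  also have "\<dots> = (\<Sum>x\<in>\<Lambda>. \<Sum>i | i \<in> {..<length xs} \<and> xs ! i = x. \<Sum>y\<in>\<Lambda>. of_bool (l1_norm (xs ! i - y) = 1) * \<psi> (xs[i := y]))"
    by (intro sum.cong refl) auto
  also have "\<dots> = (\<Sum>i<length xs. \<Sum>y\<in>\<Lambda>. of_bool (l1_norm (xs ! i - y) = 1) * \<psi> (xs[i := y]))"
    using assms by (intro sum.group) auto
  finally show ?thesis .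
qed

lemma onebody_hubbard_matrix:
  assumes "\<psi> \<in> fock \<Lambda>" "finite \<Lambda>" "set xs \<subseteq> \<Lambda>"
  shows "onebody \<Lambda> (hubbard_matrix U W) \<psi> xs =
    - (\<Sum>(x, y)\<in>bonds \<Lambda>. create x (annihilate y \<psi>) xs) + of_real U * (of_nat (card (set xs \<inter> W)) * \<psi> xs)"
proof -
  have "onebody \<Lambda> (hubbard_matrix U W) \<psi> xs =
      - (\<Sum>i<length xs. \<Sum>y\<in>\<Lambda>. of_bool (l1_norm (xs ! i - y) = 1) * \<psi> (xs[i := y]))
      + (\<Sum>i<length xs. \<Sum>y\<in>\<Lambda>. of_real U * of_bool (xs ! i = y \<and> xs ! i \<in> W) * \<psi> (xs[i := y]))"
    unfolding onebody_def hubbard_matrix_def by (simp add: algebra_simps sum.distrib sum_negf sum_subtractf)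
  also have "(\<Sum>i<length xs. \<Sum>y\<in>\<Lambda>. of_real U * of_bool (xs ! i = y \<and> xs ! i \<in> W) * \<psi> (xs[i := y]))
      = (\<Sum>i<length xs. of_real U * of_bool (xs ! i \<in> W) * \<psi> xs)"
  proof (rule sum.cong[OF refl])
    fix i assume "i \<in> {..<length xs}"
    then have i: "xs ! i \<in> \<Lambda>" using assms(3) by auto
    have "(\<Sum>y\<in>\<Lambda>. of_real U * of_bool (xs ! i = y \<and> xs ! i \<in> W) * \<psi> (xs[i := y]))
        = (\<Sum>y\<in>\<Lambda>. if y = xs ! i then of_real U * of_bool (xs ! i \<in> W) * \<psi> xs else 0)"
      by (intro sum.cong refl) auto
    then show "(\<Sum>y\<in>\<Lambda>. of_real U * of_bool (xs ! i = y \<and> xs ! i \<in> W) * \<psi> (xs[i := y])) = of_real U * of_bool (xs ! i \<in> W) * \<psi> xs"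
      using i assms(2) by simp
  qed
  also have "\<dots> = of_real U * (of_nat (card (set xs \<inter> W)) * \<psi> xs)"
  proof (cases "distinct xs")
    case True
    have "(\<Sum>i<length xs. of_bool (xs ! i \<in> W)) = (\<Sum>x\<in>set xs. of_bool (x \<in> W) :: complex)"
      using sum.reindex_bij_betw[OF bij_betw_nth[OF True refl refl], of "\<lambda>x. of_bool (x \<in> W) :: complex"] by simp
    also have "\<dots> = of_nat (card (set xs \<inter> W))" by (simp add: of_bool_def sum.If_cases Int_def)
    finally show ?thesis by (simp add: sum_distrib_left[symmetric] sum_distrib_right[symmetric])
  next
    case False
    then show ?thesis by (simp add: fock_not_distinct[OF assms(1)])
  qed
  finally show ?thesis unfolding sum_bonds_create_annihilate[OF assms] .
qed

lemma tensor_slices: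
  assumes "\<Psi> \<in> tensor (fock_n \<Lambda> N1) (fock_n \<Lambda> N2)"
  shows "(\<lambda>xs. \<Psi> (xs, ys)) \<in> fock_n \<Lambda> N1" "(\<lambda>ys. \<Psi> (xs, ys)) \<in> fock_n \<Lambda> N2"
  using assms by (simp_all add: tensor_def)

lemma n2_eq:
  assumes "\<Psi> \<in> tensor (fock_n \<Lambda> N1) (fock_n \<Lambda> N2)"
  shows "n2 x \<Psi> (xs, ys) = of_bool (x \<in> set ys) * \<Psi> (xs, ys)"
  using create_annihilate_same[OF fock_n_fock[OF tensor_slices(2)[OF assms]]]
  by (simp add: n2_def c2_def c2_dag_def on_second_def)

text \<open>For fixed positions \<open>ys\<close> the repulsion is a potential acting on the light
  particles, so it joins their hopping in a single one-body operator.\<close>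

lemma hamiltonian_eq:
  fixes \<Psi> :: "'d::finite site state"
  assumes \<Psi>: "\<Psi> \<in> tensor (fock_n \<Lambda> N1) (fock_n \<Lambda> N2)" and fin: "finite \<Lambda>"
    and xs: "set xs \<subseteq> \<Lambda>" and ys: "set ys \<subseteq> \<Lambda>"
  shows "hamiltonian \<Lambda> t U \<Psi> (xs, ys) =
    onebody \<Lambda> (hubbard_matrix U (set ys)) (\<lambda>xs. \<Psi> (xs, ys)) xs +
    of_real t * onebody \<Lambda> (hubbard_matrix 0 {}) (\<lambda>ys. \<Psi> (xs, ys)) ys"
proof -
  have f1: "(\<lambda>xs. \<Psi> (xs, ys)) \<in> fock \<Lambda>" and f2: "(\<lambda>ys. \<Psi> (xs, ys)) \<in> fock \<Lambda>"
    using tensor_slices[OF \<Psi>] fock_n_fock by blast+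
  have n1: "n1 x (n2 x \<Psi>) (xs, ys) = of_bool (x \<in> set xs) * (of_bool (x \<in> set ys) * \<Psi> (xs, ys))" for x
    using create_annihilate_same[OF fock_scale[OF f1], of x "of_bool (x \<in> set ys)" xs]
    by (simp add: n1_def c1_def c1_dag_def on_first_def n2_eq[OF \<Psi>])
  have "(\<Sum>x\<in>\<Lambda>. n1 x (n2 x \<Psi>) (xs, ys)) = (\<Sum>x\<in>\<Lambda>. of_bool (x \<in> set xs \<inter> set ys)) * \<Psi> (xs, ys)"
    unfolding n1 sum_distrib_right by (intro sum.cong refl) simp
  also have "(\<Sum>x\<in>\<Lambda>. of_bool (x \<in> set xs \<inter> set ys)) = (of_nat (card (set xs \<inter> set ys)) :: complex)"
  proof -
    have "\<Lambda> \<inter> (set xs \<inter> set ys) = set xs \<inter> set ys" using xs by auto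
    then show ?thesis using fin by (simp add: of_bool_def sum.If_cases Int_def[symmetric] Collect_conj_eq)
  qed
  finally show ?thesis
    unfolding hamiltonian_def onebody_hubbard_matrix[OF f1 fin xs] onebody_hubbard_matrix[OF f2 fin ys]
    by (simp add: c1_def c1_dag_def c2_def c2_dag_def on_first_def on_second_def)
qed

text \<open>\<Phi> vanishes on lists with repetitions and on lists of the wrong length, so distinct
  lists of any length may be replaced by tuples of the right length.\<close>

lemma inner_state_eq:
  assumes \<Phi>: "\<Phi> \<in> tensor (fock_n \<Lambda> N1) (fock_n \<Lambda> N2)" and fin: "finite \<Lambda>"
  shows "inner_state \<Lambda> \<Phi> \<Psi> = (\<Sum>ys\<in>words \<Lambda> N2. mbinner \<Lambda> N1 (\<lambda>xs. \<Phi> (xs, ys)) (\<lambda>xs. \<Psi> (xs, ys)))"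
proof -
  define P where "P = {xs. set xs \<subseteq> \<Lambda> \<and> distinct xs}"
  have fP: "finite P" unfolding P_def using finite_subset_distinct[OF fin] by (simp add: conj_commute)
  have nz: "xs \<in> P \<inter> words \<Lambda> N1 \<and> ys \<in> P \<inter> words \<Lambda> N2" if "\<Phi> (xs, ys) \<noteq> 0" for xs ys
    using fock_n_nonzero[OF tensor_slices(1)[OF \<Phi>, of ys], of xs] fock_n_nonzero[OF tensor_slices(2)[OF \<Phi>, of xs], of ys] that
    by (auto simp: P_def words_def)
  have "inner_state \<Lambda> \<Phi> \<Psi> = (\<Sum>p\<in>P \<times> P. cnj (\<Phi> p) * \<Psi> p)"
    by (simp add: inner_state_def P_def Let_def)
  also have "\<dots> = (\<Sum>p\<in>(P \<inter> words \<Lambda> N1) \<times> (P \<inter> words \<Lambda> N2). cnj (\<Phi> p) * \<Psi> p)"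
    using fP nz by (intro sum.mono_neutral_right) auto
  also have "\<dots> = (\<Sum>p\<in>words \<Lambda> N1 \<times> words \<Lambda> N2. cnj (\<Phi> p) * \<Psi> p)"
    using finite_words[OF fin] nz by (intro sum.mono_neutral_left) auto
  also have "\<dots> = (\<Sum>xs\<in>words \<Lambda> N1. \<Sum>ys\<in>words \<Lambda> N2. cnj (\<Phi> (xs, ys)) * \<Psi> (xs, ys))"
    by (simp add: sum.cartesian_product case_prod_unfold)
  also have "\<dots> = (\<Sum>ys\<in>words \<Lambda> N2. \<Sum>xs\<in>words \<Lambda> N1. cnj (\<Phi> (xs, ys)) * \<Psi> (xs, ys))"
    by (rule sum.swap)
  finally show ?thesis by (simp add: mbinner_def)
qed

lemma energy_eq:
  fixes \<Psi> :: "'d::finite site state"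
  assumes \<Psi>: "\<Psi> \<in> tensor (fock_n \<Lambda> N1) (fock_n \<Lambda> N2)" and fin: "finite \<Lambda>"
  shows "inner_state \<Lambda> \<Psi> (hamiltonian \<Lambda> t U \<Psi>) =
    (\<Sum>ys\<in>words \<Lambda> N2. mbinner \<Lambda> N1 (\<lambda>xs. \<Psi> (xs, ys)) (onebody \<Lambda> (hubbard_matrix U (set ys)) (\<lambda>xs. \<Psi> (xs, ys)))) +
    of_real t * (\<Sum>xs\<in>words \<Lambda> N1. mbinner \<Lambda> N2 (\<lambda>ys. \<Psi> (xs, ys)) (onebody \<Lambda> (hubbard_matrix 0 {}) (\<lambda>ys. \<Psi> (xs, ys))))"
proof -
  have "inner_state \<Lambda> \<Psi> (hamiltonian \<Lambda> t U \<Psi>) =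
    (\<Sum>ys\<in>words \<Lambda> N2. \<Sum>xs\<in>words \<Lambda> N1. cnj (\<Psi> (xs, ys)) * (onebody \<Lambda> (hubbard_matrix U (set ys)) (\<lambda>xs. \<Psi> (xs, ys)) xs +
      of_real t * onebody \<Lambda> (hubbard_matrix 0 {}) (\<lambda>ys. \<Psi> (xs, ys)) ys))"
    unfolding inner_state_eq[OF \<Psi> fin] mbinner_def
    by (intro sum.cong refl arg_cong2[where f = "(*)"] hamiltonian_eq[OF \<Psi> fin]) (auto simp: words_def)
  also have "\<dots> = (\<Sum>ys\<in>words \<Lambda> N2. \<Sum>xs\<in>words \<Lambda> N1. cnj (\<Psi> (xs, ys)) * onebody \<Lambda> (hubbard_matrix U (set ys)) (\<lambda>xs. \<Psi> (xs, ys)) xs)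
     + (\<Sum>ys\<in>words \<Lambda> N2. \<Sum>xs\<in>words \<Lambda> N1. of_real t * (cnj (\<Psi> (xs, ys)) * onebody \<Lambda> (hubbard_matrix 0 {}) (\<lambda>ys. \<Psi> (xs, ys)) ys))"
    by (simp add: distrib_left sum.distrib mult.left_commute)
  also have "(\<Sum>ys\<in>words \<Lambda> N2. \<Sum>xs\<in>words \<Lambda> N1. of_real t * (cnj (\<Psi> (xs, ys)) * onebody \<Lambda> (hubbard_matrix 0 {}) (\<lambda>ys. \<Psi> (xs, ys)) ys))
     = (\<Sum>xs\<in>words \<Lambda> N1. \<Sum>ys\<in>words \<Lambda> N2. of_real t * (cnj (\<Psi> (xs, ys)) * onebody \<Lambda> (hubbard_matrix 0 {}) (\<lambda>ys. \<Psi> (xs, ys)) ys))"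
    by (rule sum.swap)
  finally show ?thesis by (simp add: mbinner_def sum_distrib_left)
qed

text \<open>Hopping of a heavy particle is only possible across the boundary of the heavy region.\<close>

lemma heavy_hopping_ge:
  fixes \<psi> :: "'d::finite site list \<Rightarrow> complex"
  assumes \<psi>: "\<psi> \<in> fock_n \<Lambda> N" and fin: "finite \<Lambda>"
  shows "- (\<Sum>ys\<in>words \<Lambda> N. (cmod (\<psi> ys))\<^sup>2 * real (boundary \<Lambda> (set ys))) \<le>
    Re (mbinner \<Lambda> N \<psi> (onebody \<Lambda> (hubbard_matrix 0 {}) \<psi>))"
proof -
  let ?J = "words \<Lambda> N \<times> {..<N} \<times> \<Lambda>"
  have f: "\<psi> \<in> fock \<Lambda>" using \<psi> by (rule fock_n_fock)
  \<comment> \<open>The weight of a hop of the particle at position \<open>j\<close> to an empty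
    neighbour \<open>z\<close>; \<sigma> reverses the hop.\<close>
  define q where "q = (\<lambda>(ys, j, z). of_bool (l1_norm (z - ys ! j) = 1 \<and> z \<notin> set ys) * (cmod (\<psi> ys))\<^sup>2)"
  define \<sigma> where "\<sigma> = (\<lambda>(ys, j, z). (ys[j := z], j :: nat, ys ! j :: 'd site))"
  have eq: "mbinner \<Lambda> N \<psi> (onebody \<Lambda> (hubbard_matrix 0 {}) \<psi>) =
      (\<Sum>(ys, j, z)\<in>?J. - (of_bool (l1_norm (ys ! j - z) = 1) * (cnj (\<psi> ys) * \<psi> (ys[j := z]))))"
    unfolding mbinner_def onebody_def sum.cartesian_product[symmetric]
    by (intro sum.cong refl) (auto simp: words_def hubbard_matrix_def sum_distrib_left intro!: sum.cong)
  have ptw: "- ((q p + q (\<sigma> p)) / 2) \<le> Re (case p of (ys, j, z) \<Rightarrow> - (of_bool (l1_norm (ys ! j - z) = 1) * (cnj (\<psi> ys) * \<psi> (ys[j := z]))))"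
    if p: "p \<in> ?J" for p
  proof -
    obtain ys j z where p': "p = (ys, j, z)" by (cases p)
    have q0: "0 \<le> q p" "0 \<le> q (\<sigma> p)" by (auto simp: q_def p' \<sigma>_def)
    have j: "j < length ys" using p by (auto simp: p' words_def)
    show ?thesis
    proof (cases "l1_norm (ys ! j - z) = 1 \<and> \<psi> ys \<noteq> 0 \<and> \<psi> (ys[j := z]) \<noteq> 0")
      case True
      have d: "distinct ys" "distinct (ys[j := z])" using True fock_not_distinct[OF f] by blast+
      have ne: "z \<noteq> ys ! j" using True by (auto simp: l1_norm_def)
      have z: "z \<notin> set ys"
      proof
        assume "z \<in> set ys"
        then obtain i where i: "i < length ys" "ys ! i = z" by (auto simp: in_set_conv_nth)
        then have "i \<noteq> j" using ne by auto
        then have "ys[j := z] ! i = ys[j := z] ! j" using i j by simp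
        then show False using nth_eq_iff_index_eq[OF d(2), of i j] i(1) j \<open>i \<noteq> j\<close> by simp
      qed
      have y: "ys ! j \<notin> set (ys[j := z])"
      proof
        assume "ys ! j \<in> set (ys[j := z])"
        then obtain i where i: "i < length ys" "ys[j := z] ! i = ys ! j" by (auto simp: in_set_conv_nth)
        then have "i \<noteq> j" using ne j by auto
        then have "ys ! i = ys ! j" using i by simp
        then show False using nth_eq_iff_index_eq[OF d(1), of i j] i(1) j \<open>i \<noteq> j\<close> by simp
      qed
      have q: "q p = (cmod (\<psi> ys))\<^sup>2" "q (\<sigma> p) = (cmod (\<psi> (ys[j := z])))\<^sup>2"
        using True z y j by (simp_all add: q_def \<sigma>_def p' l1_norm_commute[of z])
      \<comment> \<open>The amplitude of a hop is charged in equal parts to the configurations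
        before and after it.\<close>
      have "Re (cnj (\<psi> ys) * \<psi> (ys[j := z])) \<le> cmod (\<psi> ys) * cmod (\<psi> (ys[j := z]))"
        using complex_Re_le_cmod[of "cnj (\<psi> ys) * \<psi> (ys[j := z])"] by (simp add: norm_mult)
      also have "\<dots> \<le> ((cmod (\<psi> ys))\<^sup>2 + (cmod (\<psi> (ys[j := z])))\<^sup>2) / 2"
        using sum_squares_bound[of "cmod (\<psi> ys)" "cmod (\<psi> (ys[j := z]))"] by simp
      finally have le: "Re (cnj (\<psi> ys) * \<psi> (ys[j := z])) \<le> ((cmod (\<psi> ys))\<^sup>2 + (cmod (\<psi> (ys[j := z])))\<^sup>2) / 2" .
      have "(case p of (ys, j, z) \<Rightarrow> - (of_bool (l1_norm (ys ! j - z) = 1) * (cnj (\<psi> ys) * \<psi> (ys[j := z]))))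
          = - (cnj (\<psi> ys) * \<psi> (ys[j := z]))"
        using True by (simp add: p')
      then show ?thesis unfolding q using le by (simp only: uminus_complex.sel)
    next
      case False
      then have "Re (case p of (ys, j, z) \<Rightarrow> - (of_bool (l1_norm (ys ! j - z) = 1) * (cnj (\<psi> ys) * \<psi> (ys[j := z])))) = 0"
        by (auto simp: p')
      then show ?thesis using q0 by simp
    qed
  qed
  have "(\<Sum>p\<in>?J. q (\<sigma> p)) = (\<Sum>p\<in>?J. q p)"
    by (rule sum.reindex_bij_witness[of _ \<sigma> \<sigma>])
      (auto simp: \<sigma>_def words_update words_nth, auto simp: words_def)
  then have "- (\<Sum>p\<in>?J. q p) = (\<Sum>p\<in>?J. - ((q p + q (\<sigma> p)) / 2))"
    by (simp add: sum_negf sum.distrib sum_divide_distrib[symmetric])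
  also have "\<dots> \<le> Re (mbinner \<Lambda> N \<psi> (onebody \<Lambda> (hubbard_matrix 0 {}) \<psi>))"
    unfolding eq Re_sum by (intro sum_mono ptw)
  finally have "- (\<Sum>p\<in>?J. q p) \<le> Re (mbinner \<Lambda> N \<psi> (onebody \<Lambda> (hubbard_matrix 0 {}) \<psi>))" .
  moreover have "(\<Sum>p\<in>?J. q p) = (\<Sum>ys\<in>words \<Lambda> N. (cmod (\<psi> ys))\<^sup>2 * real (boundary \<Lambda> (set ys)))"
  proof -
    have "(\<Sum>p\<in>?J. q p) = (\<Sum>ys\<in>words \<Lambda> N. \<Sum>j<N. \<Sum>z\<in>\<Lambda>. q (ys, j, z))"
      by (simp add: sum.cartesian_product)
    also have "\<dots> = (\<Sum>ys\<in>words \<Lambda> N. (cmod (\<psi> ys))\<^sup>2 * real (boundary \<Lambda> (set ys)))"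
    proof (rule sum.cong[OF refl])
      fix ys assume ys: "ys \<in> words \<Lambda> N"
      show "(\<Sum>j<N. \<Sum>z\<in>\<Lambda>. q (ys, j, z)) = (cmod (\<psi> ys))\<^sup>2 * real (boundary \<Lambda> (set ys))"
      proof (cases "distinct ys")
        case True
        have l: "length ys = N" "set ys \<subseteq> \<Lambda>" using ys by (auto simp: words_def)
        have "(\<Sum>j<N. \<Sum>z\<in>\<Lambda>. q (ys, j, z)) = (\<Sum>j<N. \<Sum>z\<in>\<Lambda>. of_bool (l1_norm (z - ys ! j) = 1 \<and> z \<notin> set ys)) * (cmod (\<psi> ys))\<^sup>2"
          by (simp add: q_def sum_distrib_right)
        also have "(\<Sum>j<N. \<Sum>z\<in>\<Lambda>. of_bool (l1_norm (z - ys ! j) = 1 \<and> z \<notin> set ys) :: real)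
            = (\<Sum>y\<in>set ys. \<Sum>z\<in>\<Lambda>. of_bool (l1_norm (z - y) = 1 \<and> z \<notin> set ys))"
          using sum.reindex_bij_betw[OF bij_betw_nth[OF True _ refl], of "{..<N}"
              "\<lambda>y. \<Sum>z\<in>\<Lambda>. of_bool (l1_norm (z - y) = 1 \<and> z \<notin> set ys) :: real"] l by simp
        also have "\<dots> = (\<Sum>y\<in>set ys. real (card {z\<in>\<Lambda>. l1_norm (z - y) = 1 \<and> z \<notin> set ys}))"
          using fin by (simp add: of_bool_def sum.If_cases Int_def)
        also have "\<dots> = real (card (SIGMA y:set ys. {z\<in>\<Lambda>. l1_norm (z - y) = 1 \<and> z \<notin> set ys}))"
          using fin by (subst card_SigmaI) auto
        also have "(SIGMA y:set ys. {z\<in>\<Lambda>. l1_norm (z - y) = 1 \<and> z \<notin> set ys}) =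
            prod.swap ` {(x, y). x \<in> \<Lambda> - set ys \<and> y \<in> set ys \<and> l1_norm (x - y) = 1}"
          by (auto simp: image_iff)
        finally show ?thesis unfolding boundary_def by (simp add: card_image mult.commute)
      next
        case False
        then have "\<psi> ys = 0" by (rule fock_not_distinct[OF f])
        then show ?thesis by (simp add: q_def)
      qed
    qed
    finally show ?thesis .
  qed
  ultimately show ?thesis by simp
qed

lemma onebody_scale: "onebody S a (\<lambda>xs. c * \<psi> xs) xs = c * onebody S a \<psi> xs"
  by (simp add: onebody_def sum_distrib_left mult.left_commute)

lemma mbinner_scale:
  "mbinner S N (\<lambda>xs. c * \<phi> xs) (\<lambda>xs. d * \<psi> xs) = cnj c * d * mbinner S N \<phi> \<psi>"
  by (simp add: mbinner_def sum_distrib_left mult_ac)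

text \<open>Scaling reduces to unit vectors. The premise \<open>unit\<close> may use that \<psi> is
  nonzero: for a slice of a state at a heavy configuration, this is what guarantees that the
  configuration is admissible.\<close>

lemma onebody_expectation_ge:
  assumes fin: "finite S" and \<psi>: "\<psi> \<in> fock_n S N"
    and unit: "\<And>\<phi>. \<phi> \<in> fock_n S N \<Longrightarrow> mbnorm2 S N \<phi> = 1 \<Longrightarrow> \<psi> \<noteq> (\<lambda>_. 0) \<Longrightarrow> c \<le> Re (mbinner S N \<phi> (onebody S a \<phi>))"
  shows "mbnorm2 S N \<psi> * c \<le> Re (mbinner S N \<psi> (onebody S a \<psi>))"
proof (cases "mbnorm2 S N \<psi> = 0")
  case True
  then have "\<forall>xs\<in>words S N. \<psi> xs = 0"
    using finite_words[OF fin] by (simp add: mbnorm2_def sum_nonneg_eq_0_iff)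
  then have "mbinner S N \<psi> (onebody S a \<psi>) = 0" by (simp add: mbinner_def)
  then show ?thesis using True by simp
next
  case False
  then have pos: "mbnorm2 S N \<psi> > 0" using mbnorm2_nonneg[of S N \<psi>] by linarith
  have nz: "\<psi> \<noteq> (\<lambda>_. 0)" using False by (auto simp: mbnorm2_def)
  define s where "s = complex_of_real (1 / sqrt (mbnorm2 S N \<psi>))"
  have ss: "cnj s * s = complex_of_real (1 / mbnorm2 S N \<psi>)"
    using pos by (simp add: s_def flip: of_real_mult)
  have "complex_of_real (mbnorm2 S N (\<lambda>xs. s * \<psi> xs)) = complex_of_real (1 / mbnorm2 S N \<psi>) * complex_of_real (mbnorm2 S N \<psi>)"
    unfolding mbinner_self[symmetric] mbinner_scale ss ..
  also have "\<dots> = complex_of_real 1" using pos by simp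
  finally have "mbnorm2 S N (\<lambda>xs. s * \<psi> xs) = 1" by (simp only: of_real_eq_iff)
  from unit[OF fock_n_scale[OF \<psi>] this nz]
  have "c \<le> Re (mbinner S N (\<lambda>xs. s * \<psi> xs) (\<lambda>xs. s * onebody S a \<psi> xs))"
    by (simp add: onebody_scale[abs_def])
  also have "\<dots> = Re (mbinner S N \<psi> (onebody S a \<psi>)) / mbnorm2 S N \<psi>"
    unfolding mbinner_scale ss by simp
  finally show ?thesis using pos by (simp add: field_simps)
qed

section \<open>The correlation operator\<close>

lemma fock_n_mult_set: "\<psi> \<in> fock_n \<Lambda> N \<Longrightarrow> (\<lambda>xs. g (set xs) * \<psi> xs) \<in> fock_n \<Lambda> N"
  by (simp add: fock_n_def fock_def)

lemma tensor_mult_set: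
  assumes "\<Psi> \<in> tensor (fock_n \<Lambda> N1) (fock_n \<Lambda> N2)"
  shows "(\<lambda>(xs, ys). g (set ys) * \<Psi> (xs, ys)) \<in> tensor (fock_n \<Lambda> N1) (fock_n \<Lambda> N2)"
  using fock_n_scale[OF tensor_slices(1)[OF assms]] fock_n_mult_set[OF tensor_slices(2)[OF assms]]
  by (simp add: tensor_def)

text \<open>Everything is diagonal in the heavy positions: the squared difference of two occupation
  numbers is 1 if they differ and 0 otherwise. After one factor the vector is still in the same
  sector, so the second factor can be evaluated in the same way.\<close>

lemma correlation_eq:
  assumes \<Psi>: "\<Psi> \<in> tensor (fock_n \<Lambda> N1) (fock_n \<Lambda> N2)" and fin: "finite \<Lambda>"
  shows "correlation \<Lambda> x \<Psi> (xs, ys) =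
    of_real (real (card {y\<in>\<Lambda>. (y \<in> set ys) \<noteq> (y + x \<in> set ys)}) / real (card \<Lambda>)) * \<Psi> (xs, ys)"
proof -
  define g where "g y S = (of_bool (y \<in> S) - of_bool (y + x \<in> S) :: complex)" for y and S
  define T where "T y \<Phi> q = n2 y \<Phi> q - n2 (y + x) \<Phi> q" for y :: "'a site" and \<Phi> q
  have T: "T y \<Phi> = (\<lambda>(xs, ys). g y (set ys) * \<Phi> (xs, ys))"
    if "\<Phi> \<in> tensor (fock_n \<Lambda> N1) (fock_n \<Lambda> N2)" for y \<Phi>
    by (auto simp: fun_eq_iff T_def g_def n2_eq[OF that] algebra_simps)
  have TT: "(T y ^^ 2) \<Psi> (xs, ys) = of_bool ((y \<in> set ys) \<noteq> (y + x \<in> set ys)) * \<Psi> (xs, ys)" for y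
  proof -
    have "T y \<Psi> \<in> tensor (fock_n \<Lambda> N1) (fock_n \<Lambda> N2)"
      unfolding T[OF \<Psi>] by (rule tensor_mult_set[OF \<Psi>])
    then have "T y (T y \<Psi>) (xs, ys) = g y (set ys) * (g y (set ys) * \<Psi> (xs, ys))"
      by (simp only: T T[OF \<Psi>] prod.case)
    then show ?thesis by (auto simp: numeral_2_eq_2 g_def)
  qed
  have "(\<Sum>y\<in>\<Lambda>. (T y ^^ 2) \<Psi> (xs, ys)) = (\<Sum>y\<in>\<Lambda>. of_bool ((y \<in> set ys) \<noteq> (y + x \<in> set ys))) * \<Psi> (xs, ys)"
    unfolding TT by (simp only: sum_distrib_right)
  also have "(\<Sum>y\<in>\<Lambda>. of_bool ((y \<in> set ys) \<noteq> (y + x \<in> set ys)) :: complex) = of_nat (card {y\<in>\<Lambda>. (y \<in> set ys) \<noteq> (y + x \<in> set ys)})"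
    using fin by (simp add: of_bool_def sum.If_cases Int_def)
  finally show ?thesis unfolding correlation_def T_def by simp
qed

lemma correlation_expectation:
  assumes \<Psi>: "\<Psi> \<in> tensor (fock_n \<Lambda> N1) (fock_n \<Lambda> N2)" and fin: "finite \<Lambda>"
  shows "inner_state \<Lambda> \<Psi> (correlation \<Lambda> x \<Psi>) =
    of_real (\<Sum>ys\<in>words \<Lambda> N2. mbnorm2 \<Lambda> N1 (\<lambda>xs. \<Psi> (xs, ys)) *
      (real (card {y\<in>\<Lambda>. (y \<in> set ys) \<noteq> (y + x \<in> set ys)}) / real (card \<Lambda>)))"
  unfolding inner_state_eq[OF \<Psi> fin] correlation_eq[OF \<Psi> fin] of_real_sum
  unfolding of_real_mult mbinner_self[symmetric] mbinner_def sum_distrib_right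
  by (intro sum.cong refl) (simp only: mult_ac)

lemma finite_differ: "finite W \<Longrightarrow> finite {y. (y \<in> W) \<noteq> (y + x \<in> (W :: 'd::finite site set))}"
proof -
  assume W: "finite W"
  have "{y. (y \<in> W) \<noteq> (y + x \<in> W)} \<subseteq> W \<union> (\<lambda>y. y - x) ` W"
    by (auto simp: image_iff) (metis add_diff_cancel_right')+
  then show ?thesis using W finite_subset by blast
qed

text \<open>If the occupation changes between \<open>y\<close> and \<open>y + (x + z)\<close>, it
  changes in one of the two steps via \<open>y + x\<close>.\<close>

lemma card_differ_add:
  fixes W :: "'d::finite site set"
  assumes "finite W"
  shows "card {y. (y \<in> W) \<noteq> (y + (x + z) \<in> W)} \<le> card {y. (y \<in> W) \<noteq> (y + x \<in> W)} + card {y. (y \<in> W) \<noteq> (y + z \<in> W)}"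
proof -
  have "{y. (y \<in> W) \<noteq> (y + (x + z) \<in> W)} \<subseteq> {y. (y \<in> W) \<noteq> (y + x \<in> W)} \<union> (\<lambda>y. y - x) ` {y. (y \<in> W) \<noteq> (y + z \<in> W)}"
  proof
    fix y assume y: "y \<in> {y. (y \<in> W) \<noteq> (y + (x + z) \<in> W)}"
    have "y + x \<in> {y. (y \<in> W) \<noteq> (y + z \<in> W)} \<or> y \<in> {y. (y \<in> W) \<noteq> (y + x \<in> W)}"
      using y by (auto simp: add.assoc)
    moreover have "y = (y + x) - x" by simp
    ultimately show "y \<in> {y. (y \<in> W) \<noteq> (y + x \<in> W)} \<union> (\<lambda>y. y - x) ` {y. (y \<in> W) \<noteq> (y + z \<in> W)}"
      by blast
  qed
  then have "card {y. (y \<in> W) \<noteq> (y + (x + z) \<in> W)} \<le> card ({y. (y \<in> W) \<noteq> (y + x \<in> W)} \<union> (\<lambda>y. y - x) ` {y. (y \<in> W) \<noteq> (y + z \<in> W)})"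
    using finite_differ[OF assms] by (intro card_mono) auto
  also have "\<dots> \<le> card {y. (y \<in> W) \<noteq> (y + x \<in> W)} + card ((\<lambda>y. y - x) ` {y. (y \<in> W) \<noteq> (y + z \<in> W)})"
    by (rule card_Un_le)
  also have "card ((\<lambda>y. y - x) ` {y. (y \<in> W) \<noteq> (y + z \<in> W)}) \<le> card {y. (y \<in> W) \<noteq> (y + z \<in> W)}"
    using finite_differ[OF assms] by (rule card_image_le)
  finally show ?thesis by simp
qed

text \<open>A change along a unit step is a bond leaving \<open>W\<close>, traversed in one of two
  senses. Such a bond either belongs to the boundary inside the cube or leaves the cube through a
  face.\<close>

lemma card_differ_axis:
  fixes W :: "'d::finite site set"
  assumes W: "W \<subseteq> cuboid r (\<lambda>_. L)" and L: "L > 0" and e: "e = axis i 1 \<or> e = - axis i 1"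
  defines "\<Lambda> \<equiv> cuboid r (\<lambda>_. L)"
  shows "real (card {y. (y \<in> W) \<noteq> (y + e \<in> W)}) \<le> 2 * (real (boundary \<Lambda> W) + real (card \<Lambda>) / real L)"
proof -
  have e1: "l1_norm e = 1" "l1_norm (- e) = 1" using e l1_norm_eq_1_iff by (auto simp: l1_norm_minus)
  have fW: "finite W" "finite \<Lambda>" using finite_subset[OF W finite_cuboid] by (simp_all add: \<Lambda>_def)
  define P where "P = {(x, y). x \<in> \<Lambda> - W \<and> y \<in> W \<and> l1_norm (x - y) = 1}"
  have fP: "finite P" by (rule finite_subset[of _ "\<Lambda> \<times> W"]) (use fW in \<open>auto simp: P_def\<close>)
  have half: "real (card {y\<in>W. y + e' \<notin> W}) \<le> real (boundary \<Lambda> W) + real (card \<Lambda>) / real L"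
    if e': "e' = axis i 1 \<or> e' = - axis i 1" for e'
  proof -
    have "l1_norm e' = 1" using e' l1_norm_eq_1_iff by blast
    then have "{y\<in>W. y + e' \<notin> W} \<subseteq> snd ` {p\<in>P. fst p = snd p + e'} \<union> {y\<in>\<Lambda>. y + e' \<notin> \<Lambda>}"
      using W by (force simp: P_def \<Lambda>_def image_iff)
    then have "card {y\<in>W. y + e' \<notin> W} \<le> card (snd ` {p\<in>P. fst p = snd p + e'} \<union> {y\<in>\<Lambda>. y + e' \<notin> \<Lambda>})"
      using fP fW by (intro card_mono) auto
    also have "\<dots> \<le> card (snd ` {p\<in>P. fst p = snd p + e'}) + card {y\<in>\<Lambda>. y + e' \<notin> \<Lambda>}" by (rule card_Un_le)
    also have "card (snd ` {p\<in>P. fst p = snd p + e'}) \<le> card P"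
      using fP by (intro order_trans[OF card_image_le card_mono]) auto
    finally have "real (card {y\<in>W. y + e' \<notin> W}) \<le> real (card P) + real (card {y\<in>\<Lambda>. y + e' \<notin> \<Lambda>})" by linarith
    also have "real (card {y\<in>\<Lambda>. y + e' \<notin> \<Lambda>}) \<le> real (card \<Lambda>) / real L"
      using card_cuboid_shell[where l = "\<lambda>_. L" and r = r, OF L e'] by (simp add: \<Lambda>_def)
    finally show ?thesis by (simp add: boundary_def P_def)
  qed
  have me: "- e = axis i 1 \<or> - e = - axis i 1" using e by auto
  have "{y. (y \<in> W) \<noteq> (y + e \<in> W)} \<subseteq> {y\<in>W. y + e \<notin> W} \<union> (\<lambda>y. y - e) ` {y\<in>W. y + - e \<notin> W}"
    by (force simp: image_iff)
  then have "card {y. (y \<in> W) \<noteq> (y + e \<in> W)} \<le> card ({y\<in>W. y + e \<notin> W} \<union> (\<lambda>y. y - e) ` {y\<in>W. y + - e \<notin> W})"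
    using fW by (intro card_mono) auto
  also have "\<dots> \<le> card {y\<in>W. y + e \<notin> W} + card ((\<lambda>y. y - e) ` {y\<in>W. y + - e \<notin> W})" by (rule card_Un_le)
  also have "card ((\<lambda>y. y - e) ` {y\<in>W. y + - e \<notin> W}) \<le> card {y\<in>W. y + - e \<notin> W}"
    using fW by (intro card_image_le) auto
  finally have "real (card {y. (y \<in> W) \<noteq> (y + e \<in> W)}) \<le> real (card {y\<in>W. y + e \<notin> W}) + real (card {y\<in>W. y + - e \<notin> W})"
    by linarith
  then show ?thesis using half[OF e] half[OF me] by simp
qed

text \<open>The displacements that have such a constant are closed under addition and include the
  signed unit vectors, hence are all of them. The constant is independent of the cube and of
  \<open>W\<close>.\<close>

lemma card_differ_le_boundary:
  fixes x :: "'d::finite site"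
  obtains c where "c \<ge> 0" and "\<And>L r W. L > 0 \<Longrightarrow> W \<subseteq> cuboid r (\<lambda>_. L) \<Longrightarrow>
    real (card {y. (y \<in> W) \<noteq> (y + x \<in> W)}) \<le>
      c * (real (boundary (cuboid r (\<lambda>_. L)) W) + real (card (cuboid r (\<lambda>_. L))) / real L)"
proof -
  define G :: "'d site \<Rightarrow> bool" where "G x \<longleftrightarrow> (\<exists>c\<ge>0. \<forall>L r W. L > 0 \<and> W \<subseteq> cuboid r (\<lambda>_. L) \<longrightarrow>
    real (card {y. (y \<in> W) \<noteq> (y + x \<in> W)}) \<le>
      c * (real (boundary (cuboid r (\<lambda>_. L)) W) + real (card (cuboid r (\<lambda>_. L))) / real L))" for x
  have add: "G (x + z)" if x: "G x" and z: "G z" for x z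
  proof -
    obtain c where c: "c \<ge> 0" "\<And>L r W. L > 0 \<Longrightarrow> W \<subseteq> cuboid r (\<lambda>_. L) \<Longrightarrow>
      real (card {y. (y \<in> W) \<noteq> (y + x \<in> W)}) \<le>
      c * (real (boundary (cuboid r (\<lambda>_. L)) W) + real (card (cuboid r (\<lambda>_. L))) / real L)"
      using x unfolding G_def by (elim exE conjE) (rule that, assumption, simp)
    obtain c' where c': "c' \<ge> 0" "\<And>L r W. L > 0 \<Longrightarrow> W \<subseteq> cuboid r (\<lambda>_. L) \<Longrightarrow>
      real (card {y. (y \<in> W) \<noteq> (y + z \<in> W)}) \<le>
      c' * (real (boundary (cuboid r (\<lambda>_. L)) W) + real (card (cuboid r (\<lambda>_. L))) / real L)"
      using z unfolding G_def by (elim exE conjE) (rule that, assumption, simp)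
    have "real (card {y. (y \<in> W) \<noteq> (y + (x + z) \<in> W)}) \<le>
      (c + c') * (real (boundary (cuboid r (\<lambda>_. L)) W) + real (card (cuboid r (\<lambda>_. L))) / real L)"
      if "L > 0" "W \<subseteq> cuboid r (\<lambda>_. L)" for L r W
    proof -
      have "finite W" using that(2) finite_subset finite_cuboid by blast
      then have "real (card {y. (y \<in> W) \<noteq> (y + (x + z) \<in> W)}) \<le>
          real (card {y. (y \<in> W) \<noteq> (y + x \<in> W)}) + real (card {y. (y \<in> W) \<noteq> (y + z \<in> W)})"
        using card_differ_add[of W x z] by linarith
      then show ?thesis using c(2)[OF that] c'(2)[OF that] by (simp add: distrib_right)
    qed
    then show ?thesis unfolding G_def using c(1) c'(1) by (intro exI[of _ "c + c'"]) auto
  qed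
  have zero: "G 0" unfolding G_def by (intro exI[of _ 0]) auto
  have unit: "G e" if "e = axis i 1 \<or> e = - axis i 1" for e i
    unfolding G_def using card_differ_axis[OF _ _ that] by (intro exI[of _ 2]) auto
  have ax: "G (axis i n)" for i n
  proof (induction n rule: int_induct[where k = 0])
    case base
    have "axis i (0::int) = 0" by (simp add: vec_eq_iff axis_def)
    then show ?case using zero by (simp only:)
  next
    case (step1 n)
    have "axis i (n + 1) = axis i n + axis i 1" by (simp add: vec_eq_iff axis_def)
    then show ?case using add[OF step1(2) unit[of "axis i 1" i]] by simp
  next
    case (step2 n)
    have "axis i (n - 1) = axis i n + - axis i 1" by (simp add: vec_eq_iff axis_def)
    then show ?case using add[OF step2(2) unit[of "- axis i 1" i]] by simp
  qed
  have "G (\<Sum>i\<in>A. axis i (x $ i))" if "finite A" for A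
    using that by (induction A rule: finite_induct) (auto simp: zero intro: add ax)
  then have "G (\<Sum>i\<in>UNIV. axis i (x $ i))" by simp
  also have "(\<Sum>i\<in>UNIV. axis i (x $ i)) = x"
    by (simp add: vec_eq_iff axis_def sum_component if_distrib cong: if_cong)
  finally obtain c where c: "c \<ge> 0" "\<forall>L r W. L > 0 \<and> W \<subseteq> cuboid r (\<lambda>_. L) \<longrightarrow>
    real (card {y. (y \<in> W) \<noteq> (y + x \<in> W)}) \<le>
      c * (real (boundary (cuboid r (\<lambda>_. L)) W) + real (card (cuboid r (\<lambda>_. L))) / real L)"
    unfolding G_def by blast
  show ?thesis by (rule that[OF c(1)]) (rule c(2)[rule_format], rule conjI)
qed

section \<open>Trial states\<close>

text \<open>Slater determinants with orbitals indexed by an arbitrary finite set. The last clause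
  locates the support of determinants of localized orbitals.\<close>

lemma slater_energy:
  assumes "finite S" and "finite J"
    and ortho: "\<And>i j. i \<in> J \<Longrightarrow> j \<in> J \<Longrightarrow> (\<Sum>x\<in>S. cnj (f i x) * f j x) = (if i = j then 1 else 0)"
  shows "\<exists>\<psi>. \<psi> \<in> fock_n S (card J) \<and> mbnorm2 S (card J) \<psi> = 1 \<and>
    (\<forall>a. mbinner S (card J) \<psi> (onebody S a \<psi>) = (\<Sum>j\<in>J. \<Sum>x\<in>S. \<Sum>y\<in>S. cnj (f j x) * a x y * f j y)) \<and>
    (\<forall>xs i. \<psi> xs \<noteq> 0 \<longrightarrow> i < card J \<longrightarrow> (\<exists>j\<in>J. f j (xs ! i) \<noteq> 0))"
proof -
  obtain h where h: "bij_betw h {..<card J} J"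
    using ex_bij_betw_nat_finite[OF assms(2)] by (auto simp: atLeast0LessThan)
  have hJ: "h i \<in> J" if "i < card J" for i using h that by (auto simp: bij_betw_def)
  have hi: "h i = h j \<longleftrightarrow> i = j" if "i < card J" "j < card J" for i j
    using h that by (auto simp: bij_betw_def dest: inj_onD)
  define g where "g = (\<lambda>i. f (h i))"
  define \<psi> where "\<psi> = slater S (card J) g"
  have og: "(\<Sum>x\<in>S. cnj (g i x) * g j x) = (if i = j then 1 else 0)" if "i < card J" "j < card J" for i j
    using ortho[OF hJ[OF that(1)] hJ[OF that(2)]] hi[OF that] by (simp add: g_def)
  have "mbinner S (card J) \<psi> (onebody S a \<psi>) = (\<Sum>j\<in>J. \<Sum>x\<in>S. \<Sum>y\<in>S. cnj (f j x) * a x y * f j y)" for a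
  proof -
    have "mbinner S (card J) \<psi> (onebody S a \<psi>) = (\<Sum>i<card J. \<Sum>x\<in>S. \<Sum>y\<in>S. cnj (g i x) * a x y * g i y)"
      unfolding \<psi>_def by (rule slater_onebody[OF assms(1) og])
    also have "\<dots> = (\<Sum>j\<in>J. \<Sum>x\<in>S. \<Sum>y\<in>S. cnj (f j x) * a x y * f j y)"
      unfolding g_def by (rule sum.reindex_bij_betw[OF h])
    finally show ?thesis .
  qed
  moreover have "\<exists>j\<in>J. f j (xs ! i) \<noteq> 0" if nz: "\<psi> xs \<noteq> 0" and i: "i < card J" for xs i
  proof -
    obtain \<pi> where \<pi>: "\<pi> permutes {..<card J}" "\<And>i. i < card J \<Longrightarrow> g (\<pi> i) (xs ! i) \<noteq> 0"
      using nz unfolding \<psi>_def by (rule slater_nonzero) blast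
    have "\<pi> i < card J" using permutes_in_image[OF \<pi>(1), of i] i by simp
    then show ?thesis using \<pi>(2)[OF i] hJ by (auto simp: g_def)
  qed
  ultimately show ?thesis
    using slater_fock_n[of S "card J" g] slater_norm[where f = g, OF assms(1) og] unfolding \<psi>_def by blast
qed

lemma sum_delta_mult:
  assumes "finite S" "z \<in> S"
  shows "(\<Sum>x\<in>S. of_bool (x = z) * (g x :: complex)) = g z"
  using assms by (simp add: of_bool_def if_distrib[where f = "\<lambda>c. c * _"] cong: if_cong)

text \<open>Orbitals localized at single sites: hopping has no diagonal entries, so the energy
  vanishes, and \<open>t\<close> does not enter the upper bound.\<close>

lemma heavy_trial_state:
  assumes fin: "finite \<Lambda>" and W: "W \<subseteq> \<Lambda>"
  shows "\<exists>\<psi>. \<psi> \<in> fock_n \<Lambda> (card W) \<and> mbnorm2 \<Lambda> (card W) \<psi> = 1 \<and>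
    mbinner \<Lambda> (card W) \<psi> (onebody \<Lambda> (hubbard_matrix 0 {}) \<psi>) = 0 \<and> (\<forall>ys. \<psi> ys \<noteq> 0 \<longrightarrow> set ys = W)"
proof -
  define f where "f z x = (of_bool (x = z) :: complex)" for z x :: "'a site"
  have fW: "finite W" using W fin finite_subset by blast
  have ortho: "(\<Sum>x\<in>\<Lambda>. cnj (f i x) * f j x) = (if i = j then 1 else 0)" if "i \<in> W" "j \<in> W" for i j
  proof -
    have "cnj (f i x) = of_bool (x = i)" for x by (simp add: f_def)
    then show ?thesis using sum_delta_mult[OF fin, of i "f j"] that W by (auto simp: f_def)
  qed
  obtain \<psi> where \<psi>: "\<psi> \<in> fock_n \<Lambda> (card W)" "mbnorm2 \<Lambda> (card W) \<psi> = 1"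
    "\<And>a. mbinner \<Lambda> (card W) \<psi> (onebody \<Lambda> a \<psi>) = (\<Sum>j\<in>W. \<Sum>x\<in>\<Lambda>. \<Sum>y\<in>\<Lambda>. cnj (f j x) * a x y * f j y)"
    "\<And>xs i. \<psi> xs \<noteq> 0 \<Longrightarrow> i < card W \<Longrightarrow> \<exists>j\<in>W. f j (xs ! i) \<noteq> 0"
    using slater_energy[OF fin fW ortho] by blast
  have "cnj (f j x) * hubbard_matrix 0 {} x y * f j y = 0" for j x y
    by (auto simp: f_def hubbard_matrix_def l1_norm_def)
  then have "mbinner \<Lambda> (card W) \<psi> (onebody \<Lambda> (hubbard_matrix 0 {}) \<psi>) = 0"
    unfolding \<psi>(3) by (simp only: sum.neutral_const)
  moreover have "set ys = W" if nz: "\<psi> ys \<noteq> 0" for ys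
  proof -
    have l: "length ys = card W" "distinct ys" using fock_n_nonzero[OF \<psi>(1) nz] by auto
    have "set ys \<subseteq> W"
    proof
      fix y assume "y \<in> set ys"
      then obtain i where "i < card W" "ys ! i = y" using l by (auto simp: in_set_conv_nth)
      then show "y \<in> W" using \<psi>(4)[OF nz, of i] by (auto simp: f_def)
    qed
    then show ?thesis using card_subset_eq[OF fW] distinct_card[OF l(2)] l(1) by simp
  qed
  ultimately show ?thesis using \<psi>(1,2) by blast
qed

lemma light_trial_state:
  fixes l :: "'d::finite \<Rightarrow> nat" and r :: "'d site"
  assumes fin: "finite \<Lambda>" and l: "\<And>i. l i > 0" and A: "A \<subseteq> modes l"
    and R\<Lambda>: "cuboid r l \<subseteq> \<Lambda>" and Z: "Z \<subseteq> \<Lambda> - cuboid r l" "Z \<inter> W = {}"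
    and u: "\<And>x. x \<in> cuboid r l \<Longrightarrow> of_bool (x \<in> W) = (u :: real)"
  defines "R \<equiv> cuboid r l"
  shows "\<exists>\<psi>. \<psi> \<in> fock_n \<Lambda> (card A + card Z) \<and> mbnorm2 \<Lambda> (card A + card Z) \<psi> = 1 \<and>
    Re (mbinner \<Lambda> (card A + card Z) \<psi> (onebody \<Lambda> (hubbard_matrix U W) \<psi>)) =
     (\<Sum>k\<in>A. Re (kinetic R (\<lambda>x y. cnj (wave l k x) * wave l k y)) / real (card R))
      + u * U * real (card A)"
proof -
  have cR: "(\<Prod>i\<in>UNIV. l i) = card R" by (simp add: R_def card_cuboid)
  have fR: "finite R" "R \<subseteq> \<Lambda>" using R\<Lambda> by (simp_all add: R_def)
  have "card R > 0" using l by (simp add: R_def card_cuboid prod_pos)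
  then have R0: "real (card R) > 0" by simp
  define s where "s = complex_of_real (1 / sqrt (real (card R)))"
  have ss: "cnj s * s = complex_of_real (1 / real (card R))"
    using R0 by (simp add: s_def flip: of_real_mult)
  have fA: "finite A" "finite Z" using A Z fin by (auto intro: finite_subset)
  define f where "f j x = (case j of Inl k \<Rightarrow> if x \<in> R then s * wave l k x else 0 | Inr z \<Rightarrow> of_bool (x = z))" for j x
  define J where "J = A <+> Z"
  have cJ: "card J = card A + card Z" unfolding J_def using fA by (rule card_Plus)
  have restrict: "(\<Sum>x\<in>\<Lambda>. if x \<in> R then g x else 0) = (\<Sum>x\<in>R. g x)" for g :: "'d site \<Rightarrow> complex"
    using fin fR by (simp add: sum.inter_restrict[symmetric] Int_absorb1)
  have ortho: "(\<Sum>x\<in>\<Lambda>. cnj (f i x) * f j x) = (if i = j then 1 else 0)" if ij: "i \<in> J" "j \<in> J" for i j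
  proof (cases i)
    case (Inl k)
    note i = this
    then have k: "k \<in> A" using ij by (auto simp: J_def)
    show ?thesis
    proof (cases j)
      case (Inl k')
      then have k': "k' \<in> A" using ij by (auto simp: J_def)
      have "(\<Sum>x\<in>\<Lambda>. cnj (f i x) * f j x) = (\<Sum>x\<in>\<Lambda>. if x \<in> R then (cnj s * s) * (cnj (wave l k x) * wave l k' x) else 0)"
        by (intro sum.cong refl) (simp add: f_def i Inl)
      also have "\<dots> = (cnj s * s) * (\<Sum>x\<in>R. cnj (wave l k x) * wave l k' x)"
        unfolding restrict by (simp only: sum_distrib_left)
      also have "\<dots> = complex_of_real (1 / real (card R)) * (if k = k' then of_nat (card R) else 0)"
        using wave_orthogonal[where l = l and r = r and k = k and k' = k', OF l subsetD[OF A k] subsetD[OF A k']]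
        unfolding ss cR R_def[symmetric] by (simp only:)
      finally show ?thesis using R0 i Inl by simp
    next
      case (Inr z)
      then have "z \<in> Z" using ij by (auto simp: J_def)
      then have "z \<notin> R" using Z by (auto simp: R_def)
      then have "(\<Sum>x\<in>\<Lambda>. cnj (f i x) * f j x) = 0" by (intro sum.neutral) (auto simp: f_def i Inr)
      then show ?thesis using i Inr by simp
    qed
  next
    case (Inr z)
    note i = this
    then have z: "z \<in> Z" "z \<in> \<Lambda>" "z \<notin> R" using ij Z by (auto simp: J_def R_def)
    have "cnj (f i x) = of_bool (x = z)" for x by (simp add: f_def i)
    then have "(\<Sum>x\<in>\<Lambda>. cnj (f i x) * f j x) = f j z"
      using sum_delta_mult[OF fin z(2), of "f j"] by (simp only:)
    then show ?thesis using z ij by (cases j) (auto simp: f_def i)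
  qed
  have fJ: "finite J" using fA by (simp add: J_def)
  obtain \<psi> where \<psi>: "\<psi> \<in> fock_n \<Lambda> (card J)" "mbnorm2 \<Lambda> (card J) \<psi> = 1"
    "\<And>a. mbinner \<Lambda> (card J) \<psi> (onebody \<Lambda> a \<psi>) = (\<Sum>j\<in>J. \<Sum>x\<in>\<Lambda>. \<Sum>y\<in>\<Lambda>. cnj (f j x) * a x y * f j y)"
    using slater_energy[OF fin fJ ortho] by blast
  define e where "e j = Re (\<Sum>x\<in>\<Lambda>. \<Sum>y\<in>\<Lambda>. cnj (f j x) * hubbard_matrix U W x y * f j y)" for j
  have eZ: "e (Inr z) = 0" if "z \<in> Z" for z
  proof -
    have "cnj (f (Inr z) x) * hubbard_matrix U W x y * f (Inr z) y = 0" for x y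
      using that Z by (auto simp: f_def hubbard_matrix_def l1_norm_def)
    then show ?thesis by (simp only: e_def sum.neutral_const zero_complex.sel)
  qed
  have eA: "e (Inl k) = Re (kinetic R (\<lambda>x y. cnj (wave l k x) * wave l k y)) / real (card R) + u * U" for k
  proof -
    have "(\<Sum>x\<in>\<Lambda>. \<Sum>y\<in>\<Lambda>. cnj (f (Inl k) x) * hubbard_matrix U W x y * f (Inl k) y) =
        (\<Sum>x\<in>\<Lambda>. if x \<in> R then (\<Sum>y\<in>\<Lambda>. if y \<in> R then cnj s * s * (hubbard_matrix U W x y * (cnj (wave l k x) * wave l k y)) else 0) else 0)"
      by (intro sum.cong refl) (auto simp: f_def mult_ac intro!: sum.cong)
    also have "\<dots> = (\<Sum>x\<in>R. \<Sum>y\<in>R. cnj s * s * (hubbard_matrix U W x y * (cnj (wave l k x) * wave l k y)))"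
      unfolding restrict ..
    also have "\<dots> = cnj s * s * (\<Sum>x\<in>R. \<Sum>y\<in>R. hubbard_matrix U W x y * (cnj (wave l k x) * wave l k y))"
      by (simp only: sum_distrib_left)
    also have "(\<Sum>x\<in>R. \<Sum>y\<in>R. hubbard_matrix U W x y * (cnj (wave l k x) * wave l k y)) =
        (kinetic R (\<lambda>x y. cnj (wave l k x) * wave l k y))
        + (\<Sum>x\<in>R. \<Sum>y\<in>R. of_bool (y = x) * (of_real (U * u) * (cnj (wave l k x) * wave l k y)))"
      unfolding sum.distrib[symmetric]
    proof (intro sum.cong refl)
      fix x y assume "x \<in> R" "y \<in> R"
      then have "of_bool (x \<in> W) = u" using u by (simp add: R_def)
      then have "complex_of_real u = of_bool (x \<in> W)" by auto
      then show "hubbard_matrix U W x y * (cnj (wave l k x) * wave l k y) =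
          - of_bool (l1_norm (x - y) = 1) * (cnj (wave l k x) * wave l k y)
          + of_bool (y = x) * (of_real (U * u) * (cnj (wave l k x) * wave l k y))"
        by (auto simp: hubbard_matrix_def algebra_simps)
    qed
    also have "(\<Sum>x\<in>R. \<Sum>y\<in>R. of_bool (y = x) * (of_real (U * u) * (cnj (wave l k x) * wave l k y)))
        = (\<Sum>x\<in>R. complex_of_real (U * u))"
      by (intro sum.cong refl, subst sum_delta_mult[OF fR(1)]) (simp_all add: cnj_mult_self)
    finally have "(\<Sum>x\<in>\<Lambda>. \<Sum>y\<in>\<Lambda>. cnj (f (Inl k) x) * hubbard_matrix U W x y * f (Inl k) y) =
       complex_of_real (1 / real (card R)) * ((kinetic R (\<lambda>x y. cnj (wave l k x) * wave l k y))
        + (\<Sum>x\<in>R. complex_of_real (U * u)))" unfolding ss .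
    then have "e (Inl k) = (1 / real (card R)) * (Re (kinetic R (\<lambda>x y. cnj (wave l k x) * wave l k y))
        + real (card R) * (U * u))"
      unfolding e_def by (simp only: Re_complex_of_real complex_Re_of_nat times_complex.sel Im_complex_of_real plus_complex.sel sum_constant) simp
    then show ?thesis using R0 by (simp add: distrib_left field_simps)
  qed
  have "Re (mbinner \<Lambda> (card J) \<psi> (onebody \<Lambda> (hubbard_matrix U W) \<psi>)) = (\<Sum>j\<in>J. e j)"
    unfolding \<psi>(3) Re_sum[of _ J] e_def ..
  also have "\<dots> = (\<Sum>k\<in>A. e (Inl k)) + (\<Sum>z\<in>Z. e (Inr z))"
    unfolding J_def using fA by (simp add: sum.Plus)
  also have "\<dots> = (\<Sum>k\<in>A. Re (kinetic R (\<lambda>x y. cnj (wave l k x) * wave l k y)) / real (card R)) + u * U * real (card A)"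
    by (simp add: eZ eA sum.distrib)
  finally show ?thesis using \<psi>(1,2) unfolding cJ by blast
qed

text \<open>The heavy factor has a sharp set of positions, so the light factor feels one fixed
  potential and the energies add up.\<close>

lemma product_state:
  fixes \<psi>1 \<psi>2 :: "'d::finite site list \<Rightarrow> complex"
  assumes fin: "finite \<Lambda>" and 1: "\<psi>1 \<in> fock_n \<Lambda> N1" "mbnorm2 \<Lambda> N1 \<psi>1 = 1"
    and 2: "\<psi>2 \<in> fock_n \<Lambda> N2" "mbnorm2 \<Lambda> N2 \<psi>2 = 1" and W: "\<And>ys. \<psi>2 ys \<noteq> 0 \<Longrightarrow> set ys = W"
  defines "\<Psi> \<equiv> \<lambda>(xs, ys). \<psi>1 xs * \<psi>2 ys"
  shows "\<Psi> \<in> tensor (fock_n \<Lambda> N1) (fock_n \<Lambda> N2)" "inner_state \<Lambda> \<Psi> \<Psi> = 1"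
    "inner_state \<Lambda> \<Psi> (hamiltonian \<Lambda> t U \<Psi>) = mbinner \<Lambda> N1 \<psi>1 (onebody \<Lambda> (hubbard_matrix U W) \<psi>1)
      + of_real t * mbinner \<Lambda> N2 \<psi>2 (onebody \<Lambda> (hubbard_matrix 0 {}) \<psi>2)"
proof -
  show T: "\<Psi> \<in> tensor (fock_n \<Lambda> N1) (fock_n \<Lambda> N2)"
  proof -
    have "(\<lambda>xs. \<psi>1 xs * \<psi>2 ys) \<in> fock_n \<Lambda> N1" for ys
      using fock_n_scale[OF 1(1), of "\<psi>2 ys"] by (simp add: mult.commute)
    then show ?thesis using fock_n_scale[OF 2(1)] by (simp add: tensor_def \<Psi>_def)
  qed
  have w2: "(\<Sum>ys\<in>words \<Lambda> N2. cnj (\<psi>2 ys) * \<psi>2 ys * c) = c" for c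
    using mbinner_self[of \<Lambda> N2 \<psi>2] 2(2) by (simp add: mbinner_def sum_distrib_right[symmetric])
  have w1: "(\<Sum>xs\<in>words \<Lambda> N1. cnj (\<psi>1 xs) * \<psi>1 xs * c) = c" for c
    using mbinner_self[of \<Lambda> N1 \<psi>1] 1(2) by (simp add: mbinner_def sum_distrib_right[symmetric])
  have s2: "mbinner \<Lambda> N1 (\<lambda>xs. \<psi>1 xs * \<psi>2 ys) (onebody \<Lambda> a (\<lambda>xs. \<psi>1 xs * \<psi>2 ys)) =
      cnj (\<psi>2 ys) * \<psi>2 ys * mbinner \<Lambda> N1 \<psi>1 (onebody \<Lambda> a \<psi>1)" for a ys
    using mbinner_scale[of \<Lambda> N1 "\<psi>2 ys" \<psi>1 "\<psi>2 ys" "onebody \<Lambda> a \<psi>1"]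
    by (simp add: onebody_scale[abs_def] mult.commute[of "\<psi>1 _"])
  have s1: "mbinner \<Lambda> N2 (\<lambda>ys. \<psi>1 xs * \<psi>2 ys) (onebody \<Lambda> a (\<lambda>ys. \<psi>1 xs * \<psi>2 ys)) =
      cnj (\<psi>1 xs) * \<psi>1 xs * mbinner \<Lambda> N2 \<psi>2 (onebody \<Lambda> a \<psi>2)" for a xs
    using mbinner_scale[of \<Lambda> N2 "\<psi>1 xs" \<psi>2 "\<psi>1 xs" "onebody \<Lambda> a \<psi>2"]
    by (simp add: onebody_scale[abs_def])
  have "inner_state \<Lambda> \<Psi> \<Psi> = (\<Sum>ys\<in>words \<Lambda> N2. cnj (\<psi>2 ys) * \<psi>2 ys * mbinner \<Lambda> N1 \<psi>1 \<psi>1)"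
    unfolding inner_state_eq[OF T fin] using mbinner_scale[of \<Lambda> N1 _ \<psi>1 _ \<psi>1]
    by (simp add: \<Psi>_def mult.commute[of "\<psi>1 _"])
  then show "inner_state \<Lambda> \<Psi> \<Psi> = 1" unfolding w2 using 1(2) by (simp add: mbinner_self)
  have "(\<Sum>ys\<in>words \<Lambda> N2. mbinner \<Lambda> N1 (\<lambda>xs. \<Psi> (xs, ys)) (onebody \<Lambda> (hubbard_matrix U (set ys)) (\<lambda>xs. \<Psi> (xs, ys))))
      = (\<Sum>ys\<in>words \<Lambda> N2. cnj (\<psi>2 ys) * \<psi>2 ys * mbinner \<Lambda> N1 \<psi>1 (onebody \<Lambda> (hubbard_matrix U W) \<psi>1))"
  proof (rule sum.cong[OF refl])
    fix ys
    show "mbinner \<Lambda> N1 (\<lambda>xs. \<Psi> (xs, ys)) (onebody \<Lambda> (hubbard_matrix U (set ys)) (\<lambda>xs. \<Psi> (xs, ys)))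
      = cnj (\<psi>2 ys) * \<psi>2 ys * mbinner \<Lambda> N1 \<psi>1 (onebody \<Lambda> (hubbard_matrix U W) \<psi>1)"
      using s2[of ys "hubbard_matrix U (set ys)"] W[of ys] by (cases "\<psi>2 ys = 0") (simp_all add: \<Psi>_def)
  qed
  moreover have "(\<Sum>xs\<in>words \<Lambda> N1. mbinner \<Lambda> N2 (\<lambda>ys. \<Psi> (xs, ys)) (onebody \<Lambda> (hubbard_matrix 0 {}) (\<lambda>ys. \<Psi> (xs, ys))))
      = (\<Sum>xs\<in>words \<Lambda> N1. cnj (\<psi>1 xs) * \<psi>1 xs * mbinner \<Lambda> N2 \<psi>2 (onebody \<Lambda> (hubbard_matrix 0 {}) \<psi>2))"
    by (intro sum.cong refl) (simp add: \<Psi>_def s1)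
  ultimately show "inner_state \<Lambda> \<Psi> (hamiltonian \<Lambda> t U \<Psi>) = mbinner \<Lambda> N1 \<psi>1 (onebody \<Lambda> (hubbard_matrix U W) \<psi>1)
      + of_real t * mbinner \<Lambda> N2 \<psi>2 (onebody \<Lambda> (hubbard_matrix 0 {}) \<psi>2)"
    unfolding energy_eq[OF T fin] by (simp only: w1 w2)
qed

section \<open>Segregation\<close>

text \<open>The squared norms of the slices are the probabilities of the heavy configurations, in
  any order of the particles.\<close>

lemma sum_slices_eq_one:
  assumes \<Psi>: "\<Psi> \<in> tensor (fock_n \<Lambda> N1) (fock_n \<Lambda> N2)" and fin: "finite \<Lambda>"
    and norm: "inner_state \<Lambda> \<Psi> \<Psi> = 1"
  shows "(\<Sum>ys\<in>words \<Lambda> N2. mbnorm2 \<Lambda> N1 (\<lambda>xs. \<Psi> (xs, ys))) = 1"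
proof -
  have "complex_of_real (\<Sum>ys\<in>words \<Lambda> N2. mbnorm2 \<Lambda> N1 (\<lambda>xs. \<Psi> (xs, ys))) = complex_of_real 1"
    using norm unfolding inner_state_eq[OF \<Psi> fin] mbinner_self of_real_sum by simp
  then show ?thesis by (simp only: of_real_eq_iff)
qed

text \<open>The light energy is bounded separately for each heavy configuration and then averaged;
  heavy hopping takes away at most \<open>t\<close> times the expected boundary. It is essential
  that \<open>E0\<close> is the same for all configurations of \<open>N2\<close> particles.\<close>

lemma energy_lower_bound:
  fixes \<Psi> :: "'d::finite site state"
  assumes \<Psi>: "\<Psi> \<in> tensor (fock_n \<Lambda> N1) (fock_n \<Lambda> N2)" and fin: "finite \<Lambda>"
    and norm: "inner_state \<Lambda> \<Psi> \<Psi> = 1" and t: "0 \<le> t"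
    and light: "\<And>W \<phi>. W \<subseteq> \<Lambda> \<Longrightarrow> card W = N2 \<Longrightarrow> \<phi> \<in> fock_n \<Lambda> N1 \<Longrightarrow> mbnorm2 \<Lambda> N1 \<phi> = 1 \<Longrightarrow>
      E0 + b * real (boundary \<Lambda> W) \<le> Re (mbinner \<Lambda> N1 \<phi> (onebody \<Lambda> (hubbard_matrix U W) \<phi>))"
  shows "E0 + (b - t) * (\<Sum>ys\<in>words \<Lambda> N2. mbnorm2 \<Lambda> N1 (\<lambda>xs. \<Psi> (xs, ys)) * real (boundary \<Lambda> (set ys)))
    \<le> Re (inner_state \<Lambda> \<Psi> (hamiltonian \<Lambda> t U \<Psi>))"
proof -
  define p where "p ys = mbnorm2 \<Lambda> N1 (\<lambda>xs. \<Psi> (xs, ys))" for ys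
  define B where "B ys = real (boundary \<Lambda> (set ys))" for ys
  have p1: "(\<Sum>ys\<in>words \<Lambda> N2. p ys) = 1"
    unfolding p_def by (rule sum_slices_eq_one[OF \<Psi> fin norm])
  have L: "p ys * (E0 + b * B ys) \<le> Re (mbinner \<Lambda> N1 (\<lambda>xs. \<Psi> (xs, ys)) (onebody \<Lambda> (hubbard_matrix U (set ys)) (\<lambda>xs. \<Psi> (xs, ys))))" for ys
    unfolding p_def
  proof (rule onebody_expectation_ge[OF fin tensor_slices(1)[OF \<Psi>]])
    fix \<phi> assume \<phi>: "\<phi> \<in> fock_n \<Lambda> N1" "mbnorm2 \<Lambda> N1 \<phi> = 1" and nz: "(\<lambda>xs. \<Psi> (xs, ys)) \<noteq> (\<lambda>_. 0)"
    then obtain xs where "\<Psi> (xs, ys) \<noteq> 0" by auto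
    then have "set ys \<subseteq> \<Lambda>" "length ys = N2" "distinct ys"
      using fock_n_nonzero[OF tensor_slices(2)[OF \<Psi>, of xs], of ys] by auto
    then show "E0 + b * B ys \<le> Re (mbinner \<Lambda> N1 \<phi> (onebody \<Lambda> (hubbard_matrix U (set ys)) \<phi>))"
      unfolding B_def using \<phi> by (intro light) (auto simp: distinct_card)
  qed
  have H: "- (\<Sum>ys\<in>words \<Lambda> N2. (cmod (\<Psi> (xs, ys)))\<^sup>2 * B ys) \<le>
      Re (mbinner \<Lambda> N2 (\<lambda>ys. \<Psi> (xs, ys)) (onebody \<Lambda> (hubbard_matrix 0 {}) (\<lambda>ys. \<Psi> (xs, ys))))" for xs
    unfolding B_def by (rule heavy_hopping_ge[OF tensor_slices(2)[OF \<Psi>] fin])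
  have pB: "(\<Sum>xs\<in>words \<Lambda> N1. \<Sum>ys\<in>words \<Lambda> N2. (cmod (\<Psi> (xs, ys)))\<^sup>2 * B ys) = (\<Sum>ys\<in>words \<Lambda> N2. p ys * B ys)"
    by (subst sum.swap) (simp add: p_def mbnorm2_def sum_distrib_right)
  have "E0 + (b - t) * (\<Sum>ys\<in>words \<Lambda> N2. p ys * B ys) =
      E0 * (\<Sum>ys\<in>words \<Lambda> N2. p ys) + b * (\<Sum>ys\<in>words \<Lambda> N2. p ys * B ys) - t * (\<Sum>ys\<in>words \<Lambda> N2. p ys * B ys)"
    unfolding p1 by (simp add: left_diff_distrib)
  also have "\<dots> = (\<Sum>ys\<in>words \<Lambda> N2. p ys * (E0 + b * B ys)) + t * (\<Sum>xs\<in>words \<Lambda> N1. - (\<Sum>ys\<in>words \<Lambda> N2. (cmod (\<Psi> (xs, ys)))\<^sup>2 * B ys))"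
    unfolding sum_negf pB by (simp add: sum_distrib_left sum.distrib algebra_simps)
  also have "\<dots> \<le> (\<Sum>ys\<in>words \<Lambda> N2. Re (mbinner \<Lambda> N1 (\<lambda>xs. \<Psi> (xs, ys)) (onebody \<Lambda> (hubbard_matrix U (set ys)) (\<lambda>xs. \<Psi> (xs, ys)))))
      + t * (\<Sum>xs\<in>words \<Lambda> N1. Re (mbinner \<Lambda> N2 (\<lambda>ys. \<Psi> (xs, ys)) (onebody \<Lambda> (hubbard_matrix 0 {}) (\<lambda>ys. \<Psi> (xs, ys)))))"
    by (intro add_mono mult_left_mono sum_mono L H t)
  also have "\<dots> = Re (inner_state \<Lambda> \<Psi> (hamiltonian \<Lambda> t U \<Psi>))"
    unfolding energy_eq[OF \<Psi> fin] by simp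
  finally show ?thesis by (simp add: p_def B_def)
qed

text \<open>At filling \<open>\<rho>1 + \<rho>2 < 1\<close> the light particles live outside the heavy region \<open>W\<close>. In the opposite
  case (\<open>high\<close>) they fill the complement of \<open>W\<close>, and \<open>K\<close> of them are inside \<open>W\<close>.\<close>

lemma light_lower_bound:
  fixes n :: real
  assumes n: "0 < n" "n < 1"
  shows "\<exists>a M0. a > 0 \<and> (\<forall>M L r W \<phi> \<mu> f high N1 K U.
    M \<ge> M0 \<and> L < M \<and> W \<subseteq> cuboid r (\<lambda>_::'d::finite. L) \<and>
    \<phi> \<in> fock_n (cuboid r (\<lambda>_. L)) N1 \<and> mbnorm2 (cuboid r (\<lambda>_. L)) N1 \<phi> = 1 \<and>
    filling (modes (\<lambda>_::'d. M)) (dispersion (\<lambda>_::'d. M)) n \<mu> f \<and>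
    real K = n * real (card (if high then W else cuboid r (\<lambda>_. L) - W)) \<and>
    N1 = (if high then card (cuboid r (\<lambda>_. L) - W) + K else K) \<and>
    U \<ge> 4 * real CARD('d) + 4 * real CARD('d) / a \<longrightarrow>
    real (card (if high then W else cuboid r (\<lambda>_. L) - W)) * band_energy M f
      + of_bool high * U * real K + a / 2 * real (boundary (cuboid r (\<lambda>_. L)) W)
    \<le> Re (mbinner (cuboid r (\<lambda>_. L)) N1 \<phi> (onebody (cuboid r (\<lambda>_. L)) (hubbard_matrix U W) \<phi>)))"
proof -
  obtain a M0 where a: "a > 0" and ex: "\<And>M L r D \<gamma> \<mu> f.
    M \<ge> M0 \<Longrightarrow> L < M \<Longrightarrow> D \<subseteq> cuboid r (\<lambda>_::'d::finite. L) \<Longrightarrow> density_matrix D \<gamma> \<Longrightarrow>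
    filling (modes (\<lambda>_::'d. M)) (dispersion (\<lambda>_::'d. M)) n \<mu> f \<Longrightarrow>
    \<mu> * ((\<Sum>x\<in>D. Re (\<gamma> x x)) - n * real (card D))
      + real (card D) * band_energy M f
      + a * real (boundary (cuboid r (\<lambda>_. L)) D)
    \<le> Re (kinetic D \<gamma>)"
    using uniform_excess[OF n, where 'd = 'd] by blast
  show ?thesis
  proof (intro exI[of _ a] exI[of _ M0] conjI a allI impI, elim conjE)
    fix M L r W \<phi> \<mu> and f :: "('d \<Rightarrow> nat) \<Rightarrow> real" and high N1 K U
    assume M: "M \<ge> M0" "L < M" and W: "W \<subseteq> cuboid r (\<lambda>_::'d. L)"
      and \<phi>: "\<phi> \<in> fock_n (cuboid r (\<lambda>_. L)) N1" "mbnorm2 (cuboid r (\<lambda>_. L)) N1 \<phi> = 1"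
      and fill: "filling (modes (\<lambda>_::'d. M)) (dispersion (\<lambda>_::'d. M)) n \<mu> f"
      and K: "real K = n * real (card (if high then W else cuboid r (\<lambda>_. L) - W))"
      and N1: "N1 = (if high then card (cuboid r (\<lambda>_. L) - W) + K else K)"
      and U: "U \<ge> 4 * real CARD('d) + 4 * real CARD('d) / a"
    define \<Lambda> where "\<Lambda> = cuboid r (\<lambda>_. L)"
    define e where "e = band_energy M f"
    define \<gamma> where "\<gamma> = reduced \<Lambda> N1 \<phi>"
    have fin: "finite \<Lambda>" by (simp add: \<Lambda>_def)
    have W': "W \<subseteq> \<Lambda>" using W by (simp add: \<Lambda>_def)
    have dm: "density_matrix \<Lambda> \<gamma>"
      unfolding \<gamma>_def using density_matrix_reduced[OF fin] \<phi> by (simp add: \<Lambda>_def)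
    have \<mu>: "\<bar>\<mu>\<bar> \<le> 2 * real CARD('d)" using fill dispersion_bound by (auto simp: filling_def)
    have "Re (\<Sum>x\<in>\<Lambda>. \<gamma> x x) = real N1"
      using reduced_trace[of \<phi> \<Lambda> N1] \<phi> by (simp add: \<gamma>_def \<Lambda>_def)
    then have tr: "(\<Sum>x\<in>\<Lambda>. Re (\<gamma> x x)) = real N1" by simp
    have en: "mbinner \<Lambda> N1 \<phi> (onebody \<Lambda> (hubbard_matrix U W) \<phi>) = (\<Sum>x\<in>\<Lambda>. \<Sum>y\<in>\<Lambda>. hubbard_matrix U W x y * \<gamma> y x)"
      unfolding \<gamma>_def using \<phi>(1) by (intro mbinner_onebody) (simp add: \<Lambda>_def)
    have ex': "\<mu> * ((\<Sum>x\<in>D. Re (\<gamma> x x)) - n * real (card D)) + real (card D) * e + a * real (boundary \<Lambda> D)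
        \<le> Re (kinetic D \<gamma>)" if "D \<subseteq> \<Lambda>" for D
      using ex[OF M _ density_matrix_subset[OF dm fin that] fill] that by (simp add: \<Lambda>_def e_def)
    show "real (card (if high then W else cuboid r (\<lambda>_. L) - W)) * band_energy M f
        + of_bool high * U * real K + a / 2 * real (boundary (cuboid r (\<lambda>_. L)) W)
      \<le> Re (mbinner (cuboid r (\<lambda>_. L)) N1 \<phi> (onebody (cuboid r (\<lambda>_. L)) (hubbard_matrix U W) \<phi>))"
      unfolding \<Lambda>_def[symmetric] e_def[symmetric]
    proof (cases high)
      case True
      have "(\<Sum>x\<in>\<Lambda>. Re (\<gamma> x x)) = real (card (\<Lambda> - W)) + n * real (card W)"
        using tr N1 K True by (simp add: \<Lambda>_def)
      then have "real (card W) * e + U * (n * real (card W)) + a / 2 * real (boundary \<Lambda> W)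
          \<le> Re (mbinner \<Lambda> N1 \<phi> (onebody \<Lambda> (hubbard_matrix U W) \<phi>))"
        unfolding en using ex'[OF W'] by (intro hubbard_lower_bound_high_filling[OF fin W' dm a \<mu> U])
      then show "real (card (if high then W else \<Lambda> - W)) * e + of_bool high * U * real K + a / 2 * real (boundary \<Lambda> W)
          \<le> Re (mbinner \<Lambda> N1 \<phi> (onebody \<Lambda> (hubbard_matrix U W) \<phi>))"
        using K True by simp
    next
      case False
      have "(\<Sum>x\<in>\<Lambda>. Re (\<gamma> x x)) = n * real (card (\<Lambda> - W))"
        using tr N1 K False by (simp add: \<Lambda>_def)
      then have "real (card (\<Lambda> - W)) * e + a / 2 * real (boundary \<Lambda> W)
          \<le> Re (mbinner \<Lambda> N1 \<phi> (onebody \<Lambda> (hubbard_matrix U W) \<phi>))"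
        unfolding en using ex'[of "\<Lambda> - W"] by (intro hubbard_lower_bound_low_filling[OF fin W' dm a \<mu> U]) auto
      then show "real (card (if high then W else \<Lambda> - W)) * e + of_bool high * U * real K + a / 2 * real (boundary \<Lambda> W)
          \<le> Re (mbinner \<Lambda> N1 \<phi> (onebody \<Lambda> (hubbard_matrix U W) \<phi>))"
        using False by simp
    qed
  qed
qed

text \<open>Trial state: the region of prescribed size in which the \<open>K\<close> light particles move is a slab
  \<open>R\<close> completed by fewer than \<open>L\<^sup>d\<^sup>-\<^sup>1\<close> sites.\<close>

lemma trial_energy:
  fixes n :: real and r :: "'d::finite site"
  assumes n: "0 \<le> n" "n \<le> 1" and L: "0 < L" "L < M" and fill: "filling (modes (\<lambda>_::'d. M)) (dispersion (\<lambda>_::'d. M)) n \<mu> f"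
    and N2: "N2 \<le> L ^ CARD('d)" and q: "q = (if high then N2 else L ^ CARD('d) - N2)"
    and K: "real K = n * real q" and big: "real L ^ (CARD('d) - 1) \<le> (1 - n) * real q"
    and N1: "N1 = (if high then L ^ CARD('d) - N2 + K else K)"
  defines "\<Lambda> \<equiv> cuboid r (\<lambda>_. L)"
  shows "\<exists>\<Psi>. \<Psi> \<in> tensor (fock_n \<Lambda> N1) (fock_n \<Lambda> N2) \<and> inner_state \<Lambda> \<Psi> \<Psi> = 1 \<and>
    Re (inner_state \<Lambda> \<Psi> (hamiltonian \<Lambda> t U \<Psi>)) \<le>
      real q * band_energy M f
      + of_bool high * U * real K + 12 * real CARD('d) * real L ^ (CARD('d) - 1)"
proof -
  define i0 :: 'd where "i0 = undefined"
  define S where "S = L ^ (CARD('d) - 1)"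
  have S: "S > 0" using L by (simp add: S_def)
  have LS: "L ^ CARD('d) = L * S"
    unfolding S_def using power_minus_mult[of "CARD('d)" L] by (simp add: mult.commute)
  \<comment> \<open>The number of complete layers of \<open>S\<close> sites; only the side in
    direction \<open>i0\<close> is shortened.\<close>
  define m where "m = q div S"
  define l where "l i = (if i = i0 then m else L)" for i
  define R where "R = cuboid r l"
  define e where "e = band_energy M f"
  have fin: "finite \<Lambda>" by (simp add: \<Lambda>_def)
  have c\<Lambda>: "card \<Lambda> = L ^ CARD('d)" by (simp add: \<Lambda>_def card_cuboid)
  have qL: "q \<le> L * S" using q N2 LS by auto
  have cR: "card R = m * S"
  proof -
    have "card R = l i0 * (\<Prod>i\<in>UNIV - {i0}. l i)" unfolding R_def card_cuboid by (subst prod.remove[of _ i0]) auto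
    also have "(\<Prod>i\<in>UNIV - {i0}. l i) = (\<Prod>i\<in>UNIV - {i0}. L)" by (intro prod.cong refl) (simp add: l_def)
    finally show ?thesis by (simp add: l_def S_def card_Diff_singleton)
  qed
  have Rq: "card R \<le> q" "q < card R + S"
    using S div_mult_mod_eq[of q S] mod_less_divisor[OF S, of q] unfolding cR m_def by linarith+
  have bigS: "real S \<le> (1 - n) * real q" using big by (simp add: S_def)
  have "(1 - n) * real q \<le> 1 * real q" using n by (intro mult_right_mono) auto
  then have "real S \<le> real q" using bigS by linarith
  then have "S \<le> q" by simp
  then have m: "m > 0" using S by (simp add: m_def div_greater_zero_iff)
  have "m \<le> (L * S) div S" unfolding m_def by (intro div_le_mono qL)
  then have mL: "m \<le> L" using S by simp
  have l: "l i > 0" "l i \<le> L" for i using m mL L by (simp_all add: l_def)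
  \<comment> \<open>\<open>big\<close> says that at least \<open>S\<close> of the \<open>q\<close>
    sites are in excess of the particles, and the incomplete layer has fewer than \<open>S\<close>
    sites.\<close>
  have KR: "K \<le> card R"
  proof -
    have "real K \<le> real q - real S" using K bigS by (simp add: left_diff_distrib)
    also have "\<dots> \<le> real (card R)" using Rq by linarith
    finally show ?thesis by simp
  qed
  have R\<Lambda>: "R \<subseteq> \<Lambda>"
  proof
    fix x assume "x \<in> R"
    then have "r $ i \<le> x $ i \<and> x $ i < r $ i + int L" for i
      using l(2)[of i] unfolding R_def cuboid_def by (auto intro: less_le_trans[of _ "r $ i + int (l i)"])
    then show "x \<in> \<Lambda>" by (simp add: \<Lambda>_def cuboid_def)
  qed
  have "q \<le> card \<Lambda>" using qL by (simp add: c\<Lambda> LS)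
  then obtain D where D: "R \<subseteq> D" "D \<subseteq> \<Lambda>" "card D = q"
    using exists_subset_between[of R q \<Lambda>] Rq(1) R\<Lambda> fin by auto
  have fD: "finite D" using D fin finite_subset by blast
  \<comment> \<open>The light plane waves live in the slab inside \<open>D\<close>. If
    \<open>high\<close>, then \<open>D\<close> is the heavy region and frozen light particles fill
    its complement; otherwise the heavy region is the complement of \<open>D\<close>.\<close>
  define W where "W = (if high then D else \<Lambda> - D)"
  define Z where "Z = (if high then \<Lambda> - D else {})"
  have W: "W \<subseteq> \<Lambda>" using D by (auto simp: W_def)
  have cW: "card W = N2"
    using D fD q N2 c\<Lambda> by (auto simp: W_def card_Diff_subset)
  obtain A where A: "A \<subseteq> modes l" "card A = K"
    "(\<Sum>k\<in>A. Re (kinetic R (\<lambda>x y. cnj (wave l k x) * wave l k y)) / real (card R))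
    \<le> real (card R) * e + 8 * (\<Sum>i\<in>UNIV. real (card R) / real (l i)) + 2 * real CARD('d) * \<bar>real K - n * real (card R)\<bar>"
    using trial_orbitals[where l = l and r = r and L = L, OF l L(2) n fill] KR unfolding R_def e_def by blast
  have N1': "card A + card Z = N1"
    using D fD q N2 c\<Lambda> A(2) N1 by (auto simp: Z_def card_Diff_subset)
  obtain \<psi>1 where \<psi>1: "\<psi>1 \<in> fock_n \<Lambda> N1" "mbnorm2 \<Lambda> N1 \<psi>1 = 1"
    "Re (mbinner \<Lambda> N1 \<psi>1 (onebody \<Lambda> (hubbard_matrix U W) \<psi>1)) =
     (\<Sum>k\<in>A. Re (kinetic R (\<lambda>x y. cnj (wave l k x) * wave l k y)) / real (card R))
      + of_bool high * U * real (card A)"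
  proof -
    have ZR: "Z \<subseteq> \<Lambda> - cuboid r l" "Z \<inter> W = {}" using D by (auto simp: Z_def W_def R_def)
    have u: "of_bool (x \<in> W) = (of_bool high :: real)" if "x \<in> cuboid r l" for x
      using that D R\<Lambda> by (auto simp: W_def R_def)
    show ?thesis
      using light_trial_state[where l = l and r = r, OF fin l(1) A(1) R\<Lambda>[unfolded R_def] ZR u, of U] that
      unfolding N1' R_def by blast
  qed
  obtain \<psi>2 where \<psi>2: "\<psi>2 \<in> fock_n \<Lambda> N2" "mbnorm2 \<Lambda> N2 \<psi>2 = 1"
    "mbinner \<Lambda> N2 \<psi>2 (onebody \<Lambda> (hubbard_matrix 0 {}) \<psi>2) = 0" "\<And>ys. \<psi>2 ys \<noteq> 0 \<Longrightarrow> set ys = W"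
    using heavy_trial_state[OF fin W] unfolding cW by blast
  note ps = product_state[OF fin \<psi>1(1,2) \<psi>2(1,2,4)]
  have sR: "(\<Sum>i\<in>UNIV. real (card R) / real (l i)) \<le> real CARD('d) * real S"
  proof -
    have "real (card R) / real (l i) \<le> real S" for i
    proof (cases "i = i0")
      case False
      have "real m * real S \<le> real L * real S" using mL by (intro mult_right_mono) auto
      then show ?thesis using False L by (simp add: l_def cR divide_le_eq mult.commute)
    qed (use m in \<open>simp add: l_def cR\<close>)
    then have "(\<Sum>i\<in>UNIV. real (card R) / real (l i)) \<le> (\<Sum>i\<in>(UNIV::'d set). real S)" by (intro sum_mono) auto
    then show ?thesis by simp
  qed
  have Kd: "\<bar>real K - n * real (card R)\<bar> \<le> real S"
  proof -
    have eq: "real K - n * real (card R) = n * (real q - real (card R))" by (simp add: K right_diff_distrib)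
    have "real q - real (card R) \<le> real S" using Rq(2) by linarith
    moreover have "0 \<le> n * (real q - real (card R))" using n Rq by (intro mult_nonneg_nonneg) auto
    moreover have "n * (real q - real (card R)) \<le> 1 * (real q - real (card R))"
      using n Rq by (intro mult_right_mono) auto
    ultimately show ?thesis unfolding eq by (simp add: abs_of_nonneg)
  qed
  have e: "\<bar>e\<bar> \<le> 2 * real CARD('d)"
  proof -
    have "\<bar>\<Sum>k\<in>modes (\<lambda>_::'d. M). f k * dispersion (\<lambda>_. M) k\<bar> \<le> (\<Sum>k\<in>modes (\<lambda>_::'d. M). \<bar>f k * dispersion (\<lambda>_. M) k\<bar>)"
      by (rule sum_abs)
    also have "\<dots> \<le> (\<Sum>k\<in>modes (\<lambda>_::'d. M). 1 * (2 * real CARD('d)))"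
      unfolding abs_mult using fill by (intro sum_mono mult_mono dispersion_bound) (auto simp: filling_def)
    also have "\<dots> = 2 * real CARD('d) * real M ^ CARD('d)" by (simp add: card_modes)
    finally show ?thesis using L by (simp add: e_def abs_divide divide_le_eq)
  qed
  have "real (card R) * e \<le> real q * e + 2 * real CARD('d) * real S"
  proof -
    have "(real (card R) - real q) * e \<le> \<bar>real (card R) - real q\<bar> * \<bar>e\<bar>" by (simp add: abs_mult[symmetric])
    also have "\<dots> \<le> real S * (2 * real CARD('d))" using e Rq by (intro mult_mono) auto
    finally show ?thesis by (simp add: algebra_simps)
  qed
  moreover have "2 * real CARD('d) * \<bar>real K - n * real (card R)\<bar> \<le> 2 * real CARD('d) * real S"
    using Kd by (intro mult_left_mono) auto
  \<comment> \<open>The 12 is made up of 8 from the energies of the orbitals, 2 from the mismatch of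
    the particle number with the filling of the slab, and 2 from the sites of \<open>D\<close>
    outside the slab.\<close>
  ultimately have "Re (mbinner \<Lambda> N1 \<psi>1 (onebody \<Lambda> (hubbard_matrix U W) \<psi>1)) \<le> real q * e + of_bool high * U * real K + 12 * real CARD('d) * real S"
    unfolding \<psi>1(3) A(2) using A(3) sR by linarith
  moreover have "Re (inner_state \<Lambda> (\<lambda>(xs, ys). \<psi>1 xs * \<psi>2 ys) (hamiltonian \<Lambda> t U (\<lambda>(xs, ys). \<psi>1 xs * \<psi>2 ys)))
      = Re (mbinner \<Lambda> N1 \<psi>1 (onebody \<Lambda> (hubbard_matrix U W) \<psi>1))"
  proof -
    have "inner_state \<Lambda> (\<lambda>(xs, ys). \<psi>1 xs * \<psi>2 ys) (hamiltonian \<Lambda> t U (\<lambda>(xs, ys). \<psi>1 xs * \<psi>2 ys))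
        = mbinner \<Lambda> N1 \<psi>1 (onebody \<Lambda> (hubbard_matrix U W) \<psi>1)
          + of_real t * mbinner \<Lambda> N2 \<psi>2 (onebody \<Lambda> (hubbard_matrix 0 {}) \<psi>2)"
      by (rule ps(3))
    then show ?thesis unfolding \<psi>2(3) by simp
  qed
  ultimately show ?thesis using ps(1,2) unfolding e_def S_def by (intro exI[of _ "\<lambda>(xs, ys). \<psi>1 xs * \<psi>2 ys"]) simp
qed

section \<open>From the energy to the correlation\<close>

lemma normalized_card_le:
  assumes "\<Psi> \<in> tensor (fock_n \<Lambda> N1) (fock_n \<Lambda> N2)" "finite \<Lambda>" "inner_state \<Lambda> \<Psi> \<Psi> = 1"
  shows "N1 \<le> card \<Lambda>" "N2 \<le> card \<Lambda>"
proof -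
  have "\<exists>xs ys. \<Psi> (xs, ys) \<noteq> 0"
  proof (rule ccontr)
    assume "\<not> ?thesis"
    then have "inner_state \<Lambda> \<Psi> \<Psi> = 0" by (auto simp: inner_state_def Let_def intro!: sum.neutral)
    then show False using assms(3) by simp
  qed
  then obtain xs ys where nz: "\<Psi> (xs, ys) \<noteq> 0" by blast
  have "set xs \<subseteq> \<Lambda> \<and> length xs = N1 \<and> distinct xs" "set ys \<subseteq> \<Lambda> \<and> length ys = N2 \<and> distinct ys"
    using fock_n_nonzero[OF tensor_slices(1)[OF assms(1), of ys], of xs]
      fock_n_nonzero[OF tensor_slices(2)[OF assms(1), of xs], of ys] nz by auto
  then show "N1 \<le> card \<Lambda>" "N2 \<le> card \<Lambda>"
    using card_mono[OF assms(2)] distinct_card by metis+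
qed

text \<open>The correlation is the mean number of sites with differing occupation, divided by the
  volume. The bound 1 disposes of small cubes; in the other one the mean boundary appears, which is
  what the energy controls.\<close>

lemma correlation_le:
  fixes \<Psi> :: "'d::finite site state" and c :: real
  assumes \<Psi>: "\<Psi> \<in> tensor (fock_n \<Lambda> N1) (fock_n \<Lambda> N2)" and norm: "inner_state \<Lambda> \<Psi> \<Psi> = 1"
    and \<Lambda>: "\<Lambda> = cuboid r (\<lambda>_. L)" "L > 0"
  shows "cmod (inner_state \<Lambda> \<Psi> (correlation \<Lambda> x \<Psi>)) \<le> 1"
    and "(\<And>W. W \<subseteq> \<Lambda> \<Longrightarrow> real (card {y. (y \<in> W) \<noteq> (y + x \<in> W)}) \<le> c * (real (boundary \<Lambda> W) + real (card \<Lambda>) / real L)) \<Longrightarrow>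
      cmod (inner_state \<Lambda> \<Psi> (correlation \<Lambda> x \<Psi>)) \<le>
      c * ((\<Sum>ys\<in>words \<Lambda> N2. mbnorm2 \<Lambda> N1 (\<lambda>xs. \<Psi> (xs, ys)) * real (boundary \<Lambda> (set ys))) + real (card \<Lambda>) / real L) / real (card \<Lambda>)"
proof -
  have fin: "finite \<Lambda>" by (simp add: \<Lambda>)
  have c0: "real (card \<Lambda>) > 0" using \<Lambda> by (simp add: card_cuboid)
  define p where "p ys = mbnorm2 \<Lambda> N1 (\<lambda>xs. \<Psi> (xs, ys))" for ys
  define D where "D ys = real (card {y\<in>\<Lambda>. (y \<in> set ys) \<noteq> (y + x \<in> set ys)})" for ys
  have p0: "0 \<le> p ys" for ys by (simp add: p_def mbnorm2_nonneg)
  have p1: "(\<Sum>ys\<in>words \<Lambda> N2. p ys) = 1"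
    unfolding p_def by (rule sum_slices_eq_one[OF \<Psi> fin norm])
  have eq: "cmod (inner_state \<Lambda> \<Psi> (correlation \<Lambda> x \<Psi>)) = (\<Sum>ys\<in>words \<Lambda> N2. p ys * (D ys / real (card \<Lambda>)))"
    unfolding correlation_expectation[OF \<Psi> fin] p_def[symmetric] D_def[symmetric] norm_of_real
    using p0 by (intro abs_of_nonneg sum_nonneg mult_nonneg_nonneg) (auto simp: D_def)
  have "(\<Sum>ys\<in>words \<Lambda> N2. p ys * (D ys / real (card \<Lambda>))) \<le> (\<Sum>ys\<in>words \<Lambda> N2. p ys * 1)"
  proof (intro sum_mono mult_left_mono p0)
    fix ys
    have "card {y\<in>\<Lambda>. (y \<in> set ys) \<noteq> (y + x \<in> set ys)} \<le> card \<Lambda>" using fin by (intro card_mono) auto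
    then show "D ys / real (card \<Lambda>) \<le> 1" using c0 by (simp add: D_def)
  qed
  then show "cmod (inner_state \<Lambda> \<Psi> (correlation \<Lambda> x \<Psi>)) \<le> 1" unfolding eq using p1 by simp
  assume c: "\<And>W. W \<subseteq> \<Lambda> \<Longrightarrow> real (card {y. (y \<in> W) \<noteq> (y + x \<in> W)}) \<le> c * (real (boundary \<Lambda> W) + real (card \<Lambda>) / real L)"
  have "(\<Sum>ys\<in>words \<Lambda> N2. p ys * (D ys / real (card \<Lambda>))) \<le>
      (\<Sum>ys\<in>words \<Lambda> N2. p ys * (c * (real (boundary \<Lambda> (set ys)) + real (card \<Lambda>) / real L) / real (card \<Lambda>)))"
  proof (intro sum_mono mult_left_mono p0 divide_right_mono)
    fix ys assume "ys \<in> words \<Lambda> N2"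
    then have s: "set ys \<subseteq> \<Lambda>" by (simp add: words_def)
    have "card {y\<in>\<Lambda>. (y \<in> set ys) \<noteq> (y + x \<in> set ys)} \<le> card {y. (y \<in> set ys) \<noteq> (y + x \<in> set ys)}"
      by (intro card_mono finite_differ) auto
    then show "D ys \<le> c * (real (boundary \<Lambda> (set ys)) + real (card \<Lambda>) / real L)"
      using c[OF s] unfolding D_def by linarith
  qed simp
  also have "\<dots> = (\<Sum>ys\<in>words \<Lambda> N2. c / real (card \<Lambda>) * (p ys * real (boundary \<Lambda> (set ys))) + c / real (card \<Lambda>) * (real (card \<Lambda>) / real L) * p ys)"
    by (intro sum.cong refl) (simp add: add_divide_distrib algebra_simps)
  also have "\<dots> = c / real (card \<Lambda>) * (\<Sum>ys\<in>words \<Lambda> N2. p ys * real (boundary \<Lambda> (set ys)))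
      + c / real (card \<Lambda>) * (real (card \<Lambda>) / real L) * (\<Sum>ys\<in>words \<Lambda> N2. p ys)"
    unfolding sum.distrib sum_distrib_left ..
  also have "\<dots> = c * ((\<Sum>ys\<in>words \<Lambda> N2. p ys * real (boundary \<Lambda> (set ys))) + real (card \<Lambda>) / real L) / real (card \<Lambda>)"
    unfolding p1 by (simp add: add_divide_distrib distrib_left)
  finally show "cmod (inner_state \<Lambda> \<Psi> (correlation \<Lambda> x \<Psi>)) \<le>
      c * ((\<Sum>ys\<in>words \<Lambda> N2. mbnorm2 \<Lambda> N1 (\<lambda>xs. \<Psi> (xs, ys)) * real (boundary \<Lambda> (set ys))) + real (card \<Lambda>) / real L) / real (card \<Lambda>)"
    unfolding eq p_def .
qed

lemma is_cubeE:
  assumes "is_cube \<Lambda>"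
  obtains r L where "L > 0" "\<Lambda> = cuboid r (\<lambda>_. L)"
proof -
  obtain a l where l: "l > 0" "\<Lambda> = {x. \<forall>i. a $ i \<le> x $ i \<and> x $ i < a $ i + l}"
    using assms by (auto simp: is_cube_def)
  then have "\<Lambda> = cuboid a (\<lambda>_. nat l)" "nat l > 0" by (auto simp: cuboid_def)
  then show ?thesis using that by blast
qed

lemma card_cube_powr:
  assumes "L > 0"
  shows "real (card (cuboid r (\<lambda>_::'d::finite. L))) powr (- 1 / real CARD('d)) = 1 / real L"
proof -
  have "real (card (cuboid r (\<lambda>_::'d. L))) = real L powr real CARD('d)"
    using assms by (simp add: card_cuboid powr_realpow)
  then have "real (card (cuboid r (\<lambda>_::'d. L))) powr (- 1 / real CARD('d)) = real L powr (- 1)"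
    by (simp add: powr_powr)
  then show ?thesis using assms by (simp add: powr_minus_divide)
qed

lemma ground_stateD:
  assumes "ground_state \<Lambda> t U N1 N2 \<Upsilon>"
  shows "\<Upsilon> \<in> tensor (fock_n \<Lambda> N1) (fock_n \<Lambda> N2)" "inner_state \<Lambda> \<Upsilon> \<Upsilon> = 1"
    and "\<And>\<Psi>. \<Psi> \<in> tensor (fock_n \<Lambda> N1) (fock_n \<Lambda> N2) \<Longrightarrow> inner_state \<Lambda> \<Psi> \<Psi> = 1 \<Longrightarrow>
      Re (inner_state \<Lambda> \<Upsilon> (hamiltonian \<Lambda> t U \<Upsilon>)) \<le> Re (inner_state \<Lambda> \<Psi> (hamiltonian \<Lambda> t U \<Psi>))"
  using assms by (simp_all add: ground_state_def Let_def)

text \<open>An empty or full heavy configuration has no boundary inside the cube, so only the faces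
  of the cube contribute.\<close>

lemma correlation_trivial_heavy:
  fixes \<Upsilon> :: "'d::finite site state"
  assumes "ground_state (cuboid r (\<lambda>_. L)) t U N1 N2 \<Upsilon>" "L > 0" "N2 = 0 \<or> N2 = card (cuboid r (\<lambda>_::'d. L))"
    and c: "\<And>W. W \<subseteq> cuboid r (\<lambda>_. L) \<Longrightarrow> real (card {y. (y \<in> W) \<noteq> (y + x \<in> W)}) \<le>
      c * (real (boundary (cuboid r (\<lambda>_. L)) W) + real (card (cuboid r (\<lambda>_::'d. L))) / real L)"
  shows "cmod (inner_state (cuboid r (\<lambda>_. L)) \<Upsilon> (correlation (cuboid r (\<lambda>_. L)) x \<Upsilon>)) \<le> c / real L"
proof -
  define \<Lambda> where "\<Lambda> = cuboid r (\<lambda>_::'d. L)"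
  have fin: "finite \<Lambda>" by (simp add: \<Lambda>_def)
  note gs = ground_stateD[OF assms(1), folded \<Lambda>_def]
  have zero: "mbnorm2 \<Lambda> N1 (\<lambda>xs. \<Upsilon> (xs, ys)) * real (boundary \<Lambda> (set ys)) = 0" for ys
  proof (cases "mbnorm2 \<Lambda> N1 (\<lambda>xs. \<Upsilon> (xs, ys)) = 0")
    case False
    then obtain xs where "\<Upsilon> (xs, ys) \<noteq> 0" by (force simp: mbnorm2_def)
    then have ys: "set ys \<subseteq> \<Lambda>" "length ys = N2" "distinct ys"
      using fock_n_nonzero[OF tensor_slices(2)[OF gs(1), of xs], of ys] by auto
    have "set ys = {} \<or> set ys = \<Lambda>"
      using assms(3) ys distinct_card[OF ys(3)] card_subset_eq[OF fin ys(1)] by (auto simp: \<Lambda>_def)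
    moreover have "boundary \<Lambda> {} = 0" "boundary \<Lambda> \<Lambda> = 0"
      by (simp_all add: boundary_def)
    ultimately show ?thesis by auto
  qed simp
  have "card \<Lambda> > 0" using assms(2) by (simp add: \<Lambda>_def card_cuboid)
  moreover have "cmod (inner_state \<Lambda> \<Upsilon> (correlation \<Lambda> x \<Upsilon>)) \<le>
      c * ((\<Sum>ys\<in>words \<Lambda> N2. mbnorm2 \<Lambda> N1 (\<lambda>xs. \<Upsilon> (xs, ys)) * real (boundary \<Lambda> (set ys))) + real (card \<Lambda>) / real L) / real (card \<Lambda>)"
    by (rule correlation_le(2)[OF gs(1,2) \<Lambda>_def assms(2) c[folded \<Lambda>_def]])
  ultimately show ?thesis unfolding zero \<Lambda>_def[symmetric] by simp
qed

abbreviation surface_bound ::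
  "real \<Rightarrow> real \<Rightarrow> real \<Rightarrow> real \<Rightarrow> 'd::finite site \<Rightarrow> real \<Rightarrow> bool" where
  "surface_bound \<rho>1 \<rho>2 t U x C \<equiv> \<forall>r L N1 N2 \<Upsilon>.
    L > 0 \<and> real N1 = \<rho>1 * real (L ^ CARD('d)) \<and> real N2 = \<rho>2 * real (L ^ CARD('d)) \<and>
    ground_state (cuboid r (\<lambda>_. L)) t U N1 N2 \<Upsilon> \<longrightarrow>
    cmod (inner_state (cuboid r (\<lambda>_. L)) \<Upsilon> (correlation (cuboid r (\<lambda>_. L)) x \<Upsilon>)) \<le> C / real L"

text \<open>\<delta> is the fraction of sites available to the partially filled band, and
  \<open>n\<close> is its filling. In the comparison of the two energy bounds \<open>E0\<close>
  drops out, and (a / 2 - t) X \<le> 12 d L^(d-1) remains for the expected boundary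
  \<open>X\<close>.\<close>

lemma segregation:
  fixes \<rho>1 \<rho>2 :: real
  assumes \<rho>: "0 < \<rho>1" "\<rho>1 < 1" "0 \<le> \<rho>2" "\<rho>2 \<le> 1" "\<rho>1 + \<rho>2 \<noteq> 1"
  shows "\<exists>U0 t0 :: real. t0 > 0 \<and> (\<forall>U t. U > U0 \<and> 0 \<le> t \<and> t < t0 \<longrightarrow>
    (\<forall>x :: ('d::finite) site. \<exists>C. surface_bound \<rho>1 \<rho>2 t U x C))"
proof -
  define high where "high \<longleftrightarrow> \<rho>1 + \<rho>2 > 1"
  define \<delta> where "\<delta> = (if high then \<rho>2 else 1 - \<rho>2)"
  define n where "n = (if high then (\<rho>1 + \<rho>2 - 1) / \<rho>2 else \<rho>1 / (1 - \<rho>2))"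
  define dd where "dd = real CARD('d)"
  have \<delta>: "\<delta> > 0" using \<rho> by (auto simp: \<delta>_def high_def)
  have n: "0 < n" "n < 1" using \<rho> by (auto simp: n_def high_def field_simps)
  have n\<delta>: "n * \<delta> = (if high then \<rho>1 + \<rho>2 - 1 else \<rho>1)"
    using \<rho> by (auto simp: n_def \<delta>_def high_def)
  from light_lower_bound[OF n, where 'd = 'd]
  obtain a M0 where a: "a > 0" and lower: "\<forall>M L r W \<phi> \<mu> f high N1 K U.
    M \<ge> M0 \<and> L < M \<and> W \<subseteq> cuboid r (\<lambda>_::'d. L) \<and>
    \<phi> \<in> fock_n (cuboid r (\<lambda>_. L)) N1 \<and> mbnorm2 (cuboid r (\<lambda>_. L)) N1 \<phi> = 1 \<and>
    filling (modes (\<lambda>_::'d. M)) (dispersion (\<lambda>_::'d. M)) n \<mu> f \<and>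
    real K = n * real (card (if high then W else cuboid r (\<lambda>_. L) - W)) \<and>
    N1 = (if high then card (cuboid r (\<lambda>_. L) - W) + K else K) \<and>
    U \<ge> 4 * real CARD('d) + 4 * real CARD('d) / a \<longrightarrow>
    real (card (if high then W else cuboid r (\<lambda>_. L) - W)) * band_energy M f
      + of_bool high * U * real K + a / 2 * real (boundary (cuboid r (\<lambda>_. L)) W)
    \<le> Re (mbinner (cuboid r (\<lambda>_. L)) N1 \<phi> (onebody (cuboid r (\<lambda>_. L)) (hubbard_matrix U W) \<phi>))"
    by (elim exE conjE) (rule that, assumption+)
  \<comment> \<open>Beyond \<open>L0\<close> one layer of the cube has at most (1 - n) q sites, as
    the trial state requires. For smaller cubes the correlation is simply at most 1.\<close>
  define L0 where "L0 = nat \<lceil>1 / ((1 - n) * \<delta>)\<rceil>"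
  show ?thesis
  \<comment> \<open>For t < a / 4 the coefficient a / 2 - t of the boundary is still at least a /
    4.\<close>
  proof (rule exI[of _ "4 * dd + 4 * dd / a"], rule exI[of _ "a / 4"], intro conjI allI impI)
    show "a / 4 > 0" using a by simp
    fix U t :: real and x :: "'d site"
    assume "U > 4 * dd + 4 * dd / a \<and> 0 \<le> t \<and> t < a / 4"
    then have U: "U \<ge> 4 * dd + 4 * dd / a" and t: "0 \<le> t" "t \<le> a / 4" by auto
    obtain c where c: "c \<ge> 0" "\<And>L r W. L > 0 \<Longrightarrow> W \<subseteq> cuboid r (\<lambda>_. L) \<Longrightarrow>
      real (card {y. (y \<in> W) \<noteq> (y + x \<in> W)}) \<le>
        c * (real (boundary (cuboid r (\<lambda>_. L)) W) + real (card (cuboid r (\<lambda>_::'d. L))) / real L)"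
      by (rule card_differ_le_boundary[of x]) (rule that)
    \<comment> \<open>48 d / a is 12 d divided by a / 4; the 1 accounts for the faces of the cube,
      and \<open>L0\<close> for the small cubes.\<close>
    define C where "C = c * (48 * dd / a + 1) + real L0"
    have dd: "dd \<ge> 0" by (simp add: dd_def)
    show "\<exists>C. surface_bound \<rho>1 \<rho>2 t U x C"
    proof (intro exI[of _ C] allI impI, elim conjE)
      fix r :: "'d site" and L N1 N2 :: nat and \<Upsilon>
      assume L: "L > 0" and N1: "real N1 = \<rho>1 * real (L ^ CARD('d))" and N2: "real N2 = \<rho>2 * real (L ^ CARD('d))"
        and ground: "ground_state (cuboid r (\<lambda>_. L)) t U N1 N2 \<Upsilon>"
      define \<Lambda> where "\<Lambda> = cuboid r (\<lambda>_. L)"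
      define V where "V = L ^ CARD('d)"
      define S where "S = L ^ (CARD('d) - 1)"
      have fin: "finite \<Lambda>" by (simp add: \<Lambda>_def)
      have c\<Lambda>: "card \<Lambda> = V" by (simp add: \<Lambda>_def V_def card_cuboid)
      have V: "V = L * S"
        unfolding V_def S_def using power_minus_mult[of "CARD('d)" L] by (simp add: mult.commute)
      have V0: "V > 0" using L by (simp add: V_def)
      note gs = ground_stateD[OF ground, folded \<Lambda>_def]
      have N2V: "N2 \<le> V" using normalized_card_le(2)[OF gs(1) fin gs(2)] by (simp add: c\<Lambda>)
      have C: "C \<ge> real L0" "C \<ge> c * (48 * dd / a + 1)" using c(1) a dd by (simp_all add: C_def)
      have "cmod (inner_state \<Lambda> \<Upsilon> (correlation \<Lambda> x \<Upsilon>)) \<le> C / real L"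
      proof (cases "L \<le> L0")
        case True
        have "cmod (inner_state \<Lambda> \<Upsilon> (correlation \<Lambda> x \<Upsilon>)) \<le> 1"
          by (rule correlation_le(1)[OF gs(1,2) \<Lambda>_def L])
        also have "1 \<le> real L0 / real L" using True L by simp
        also have "\<dots> \<le> C / real L" using C by (intro divide_right_mono) auto
        finally show ?thesis .
      next
        case False
        define q where "q = (if high then N2 else V - N2)"
        define K where "K = (if high then N1 + N2 - V else N1)"
        have q: "real q = \<delta> * real V" using N2 N2V by (auto simp: q_def \<delta>_def V_def of_nat_diff algebra_simps)
        have N12: "high \<Longrightarrow> V \<le> N1 + N2"
        proof -
          assume "high"
          then have "1 * real V \<le> (\<rho>1 + \<rho>2) * real V" unfolding high_def by (intro mult_right_mono) auto
          also have "\<dots> = real (N1 + N2)" using N1 N2 by (simp add: V_def distrib_right)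
          finally show ?thesis by simp
        qed
        have K: "real K = n * real q"
          unfolding q mult.assoc[symmetric] n\<delta> using N1 N2 N12 by (auto simp: K_def V_def of_nat_diff algebra_simps)
        have N1': "N1 = (if high then V - N2 + K else K)" using N12 N2V by (auto simp: K_def)
        have "real S \<le> (1 - n) * real q"
        proof -
          have "1 / ((1 - n) * \<delta>) \<le> real L" using False unfolding L0_def by linarith
          then have "1 \<le> (1 - n) * \<delta> * real L" using n \<delta> by (simp add: field_simps)
          then have "1 * real S \<le> (1 - n) * \<delta> * real L * real S" by (intro mult_right_mono) auto
          then show ?thesis by (simp add: q V mult.assoc)
        qed
        then have big: "real L ^ (CARD('d) - 1) \<le> (1 - n) * real q" by (simp add: S_def)
        \<comment> \<open>Any torus larger than the cube and large enough for counting momenta will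
          do, since its band energy enters both bounds only through \<open>E0\<close>.\<close>
        define M where "M = L + 1 + M0"
        have M: "M \<ge> M0" "L < M" by (simp_all add: M_def)
        have "modes (\<lambda>_::'d. M) \<noteq> {}" using card_modes[of "\<lambda>_::'d. M"] M by (auto simp: card_gt_0_iff)
        then obtain \<mu> f where fill: "filling (modes (\<lambda>_::'d. M)) (dispersion (\<lambda>_::'d. M)) n \<mu> f"
          using ex_filling[of "modes (\<lambda>_::'d. M)" n "dispersion (\<lambda>_::'d. M)"] n by auto
        define E0 where "E0 = real q * band_energy M f + of_bool high * U * real K"
        obtain \<Psi> where \<Psi>: "\<Psi> \<in> tensor (fock_n \<Lambda> N1) (fock_n \<Lambda> N2)" "inner_state \<Lambda> \<Psi> \<Psi> = 1"
          "Re (inner_state \<Lambda> \<Psi> (hamiltonian \<Lambda> t U \<Psi>)) \<le> E0 + 12 * dd * real S"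
          using trial_energy[OF less_imp_le[OF n(1)] less_imp_le[OF n(2)] L M(2) fill N2V[unfolded V_def]
              q_def[unfolded V_def] K big N1'[unfolded V_def], of r t U] unfolding \<Lambda>_def E0_def dd_def S_def by auto
        define X where "X = (\<Sum>ys\<in>words \<Lambda> N2. mbnorm2 \<Lambda> N1 (\<lambda>xs. \<Upsilon> (xs, ys)) * real (boundary \<Lambda> (set ys)))"
        have X0: "X \<ge> 0" unfolding X_def by (intro sum_nonneg mult_nonneg_nonneg mbnorm2_nonneg) auto
        have "E0 + (a / 2 - t) * X \<le> Re (inner_state \<Lambda> \<Upsilon> (hamiltonian \<Lambda> t U \<Upsilon>))"
          unfolding X_def
        proof (rule energy_lower_bound[OF gs(1) fin gs(2) t(1)])
          fix W \<phi> assume W: "W \<subseteq> \<Lambda>" "card W = N2" and \<phi>: "\<phi> \<in> fock_n \<Lambda> N1" "mbnorm2 \<Lambda> N1 \<phi> = 1"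
          have cD: "card (\<Lambda> - W) = V - N2" using W fin finite_subset[OF W(1) fin] by (simp add: card_Diff_subset c\<Lambda>)
          then have cq: "card (if high then W else \<Lambda> - W) = q" using W by (simp add: q_def)
          show "E0 + a / 2 * real (boundary \<Lambda> W) \<le> Re (mbinner \<Lambda> N1 \<phi> (onebody \<Lambda> (hubbard_matrix U W) \<phi>))"
            using lower[rule_format, where M = M and L = L and r = r and W = W and \<phi> = \<phi> and \<mu> = \<mu> and f = f
                and high = high and ?N1.0 = N1 and K = K and U = U, folded \<Lambda>_def] M W(1) \<phi> fill K N1' U
            unfolding cq cD E0_def dd_def by blast
        qed
        also have "\<dots> \<le> E0 + 12 * dd * real S" using gs(3)[OF \<Psi>(1,2)] \<Psi>(3) by linarith
        finally have "(a / 2 - t) * X \<le> 12 * dd * real S" by simp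
        moreover have "a / 4 * X \<le> (a / 2 - t) * X" using t X0 by (intro mult_right_mono) auto
        ultimately have X: "X \<le> 48 * dd / a * real S" using a by (simp add: field_simps)
        have "cmod (inner_state \<Lambda> \<Upsilon> (correlation \<Lambda> x \<Upsilon>)) \<le> c * (X + real (card \<Lambda>) / real L) / real (card \<Lambda>)"
          unfolding X_def using c(2)[OF L, of _ r] by (intro correlation_le(2)[OF gs(1,2) \<Lambda>_def L]) (simp add: \<Lambda>_def)
        also have "\<dots> = c * (X + real S) / real V" using L by (simp add: c\<Lambda> V)
        also have "\<dots> \<le> c * (48 * dd / a * real S + real S) / real V"
          using X c(1) by (intro divide_right_mono mult_left_mono) auto
        also have "\<dots> = c * (48 * dd / a + 1) * real S / real V" by (simp add: algebra_simps)
        also have "\<dots> = c * (48 * dd / a + 1) / real L" using L V0 by (simp add: V)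
        also have "\<dots> \<le> C / real L" using C by (intro divide_right_mono) auto
        finally show ?thesis .
      qed
      then show "cmod (inner_state (cuboid r (\<lambda>_. L)) \<Upsilon> (correlation (cuboid r (\<lambda>_. L)) x \<Upsilon>)) \<le> C / real L"
        by (simp add: \<Lambda>_def)
    qed
  qed
qed

text \<open>For \<rho>1 strictly between 0 and 1 and \<rho>2 in [0, 1], both ends included,
  segregation applies. For \<rho>1 in {0, 1} the second hypothesis makes the heavy particles absent
  or present everywhere. Densities outside [0, 1] admit no normalized vector, hence no ground
  state.\<close>

theorem theorem1:
  fixes \<rho>1 \<rho>2 :: real
  assumes "\<rho>1 + \<rho>2 \<noteq> 1"
    and "\<rho>1 \<in> {0, 1} \<Longrightarrow> \<rho>2 \<in> {0, 1}"
  shows "\<exists>U0 t0 :: real. t0 > 0 \<and>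
    (\<forall>U t. U > 0 \<and> U > U0 \<and> 0 \<le> t \<and> t \<le> 1 \<and> t < t0 \<longrightarrow>
      (\<forall>x :: ('d::finite) site. \<exists>C :: real.
        \<forall>\<Lambda> N1 N2 \<Upsilon>.
          is_cube \<Lambda> \<and> \<rho>1 = real N1 / real (card \<Lambda>) \<and> \<rho>2 = real N2 / real (card \<Lambda>) \<and>
          ground_state \<Lambda> t U N1 N2 \<Upsilon> \<longrightarrow>
            cmod (inner_state \<Lambda> \<Upsilon> (correlation \<Lambda> x \<Upsilon>))
              \<le> C * real (card \<Lambda>) powr (- 1 / real CARD('d))))"
proof -
  have "\<exists>U0 t0 :: real. t0 > 0 \<and> (\<forall>U t. U > U0 \<and> 0 \<le> t \<and> t < t0 \<longrightarrow>
    (\<forall>x :: 'd site. \<exists>C. surface_bound \<rho>1 \<rho>2 t U x C))"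
    (is "?P")
  proof (cases "\<rho>1 \<in> {0, 1}")
    case True
    then have \<rho>2: "\<rho>2 = 0 \<or> \<rho>2 = 1" using assms(2) by auto
    show ?thesis
    proof (rule exI[of _ 0], rule exI[of _ 1], intro conjI allI impI)
      fix U t :: real and x :: "'d site"
      obtain c where c: "c \<ge> 0" "\<And>L r W. L > 0 \<Longrightarrow> W \<subseteq> cuboid r (\<lambda>_. L) \<Longrightarrow>
        real (card {y. (y \<in> W) \<noteq> (y + x \<in> W)}) \<le>
          c * (real (boundary (cuboid r (\<lambda>_. L)) W) + real (card (cuboid r (\<lambda>_::'d. L))) / real L)"
        by (rule card_differ_le_boundary[of x]) (rule that)
      show "\<exists>C. surface_bound \<rho>1 \<rho>2 t U x C"
      proof (intro exI[of _ c] allI impI, elim conjE)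
        fix r :: "'d site" and L N1 N2 :: nat and \<Upsilon>
        assume L: "L > 0" and N2: "real N2 = \<rho>2 * real (L ^ CARD('d))"
          and ground: "ground_state (cuboid r (\<lambda>_. L)) t U N1 N2 \<Upsilon>"
        have "real N2 = 0 \<or> real N2 = real (card (cuboid r (\<lambda>_::'d. L)))"
          using N2 \<rho>2 by (auto simp: card_cuboid)
        then have "N2 = 0 \<or> N2 = card (cuboid r (\<lambda>_::'d. L))" by (simp only: of_nat_eq_iff of_nat_eq_0_iff)
        then show "cmod (inner_state (cuboid r (\<lambda>_. L)) \<Upsilon> (correlation (cuboid r (\<lambda>_. L)) x \<Upsilon>)) \<le> c / real L"
          using c(2)[OF L] by (intro correlation_trivial_heavy[OF ground L])
      qed
    qed simp
  next
    case False
    show ?thesis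
    proof (cases "0 < \<rho>1 \<and> \<rho>1 < 1 \<and> 0 \<le> \<rho>2 \<and> \<rho>2 \<le> 1")
      case True
      then show ?thesis using segregation[of \<rho>1 \<rho>2, where 'd = 'd] assms(1) by simp
    next
      case out: False
      have absurd: False
        if "L > 0" "real N1 = \<rho>1 * real (L ^ CARD('d))" "real N2 = \<rho>2 * real (L ^ CARD('d))"
          "ground_state (cuboid r (\<lambda>_::'d. L)) t U N1 N2 \<Upsilon>" for r L N1 N2 t U \<Upsilon>
      proof -
        note gs = ground_stateD[OF that(4)]
        have V: "real (L ^ CARD('d)) > 0" using that(1) by simp
        have "N1 \<le> L ^ CARD('d)" "N2 \<le> L ^ CARD('d)"
          using normalized_card_le[OF gs(1) finite_cuboid gs(2)] by (simp_all add: card_cuboid)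
        then have "real N1 \<le> real (L ^ CARD('d))" "real N2 \<le> real (L ^ CARD('d))" by (simp_all only: of_nat_le_iff)
        then have *: "0 \<le> \<rho>1 * real (L ^ CARD('d))" "\<rho>1 * real (L ^ CARD('d)) \<le> 1 * real (L ^ CARD('d))"
          "0 \<le> \<rho>2 * real (L ^ CARD('d))" "\<rho>2 * real (L ^ CARD('d)) \<le> 1 * real (L ^ CARD('d))"
          using that(2,3)[symmetric] by simp_all
        have "0 \<le> \<rho> * v \<Longrightarrow> 0 \<le> \<rho>" "\<rho> * v \<le> 1 * v \<Longrightarrow> \<rho> \<le> 1" if "v > 0" for \<rho> v :: real
          using that by (simp_all add: zero_le_mult_iff)
        then have "0 \<le> \<rho>1 \<and> \<rho>1 \<le> 1 \<and> 0 \<le> \<rho>2 \<and> \<rho>2 \<le> 1"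
          using V * by blast
        then show False using out False by auto
      qed
      show ?thesis
      proof (rule exI[of _ 0], rule exI[of _ 1], intro conjI allI impI)
        fix U t :: real and x :: "'d site"
        show "\<exists>C. surface_bound \<rho>1 \<rho>2 t U x C"
          by (intro exI[of _ 0] allI impI, elim conjE) (drule (3) absurd, simp)
      qed simp
    qed
  qed
  then obtain U0 t0 where t0: "t0 > 0" and main: "\<And>U t (x :: 'd site). U > U0 \<Longrightarrow> 0 \<le> t \<Longrightarrow> t < t0 \<Longrightarrow>
    \<exists>C. surface_bound \<rho>1 \<rho>2 t U x C" by blast
  show ?thesis
  proof (rule exI[of _ U0], rule exI[of _ t0], intro conjI t0 allI impI, elim conjE)
    fix U t :: real and x :: "'d site"
    assume "U > U0" "0 \<le> t" "t < t0"
    then obtain C where C: "\<And>r L N1 N2 \<Upsilon>. L > 0 \<Longrightarrow> real N1 = \<rho>1 * real (L ^ CARD('d)) \<Longrightarrow> real N2 = \<rho>2 * real (L ^ CARD('d)) \<Longrightarrow>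
        ground_state (cuboid r (\<lambda>_. L)) t U N1 N2 \<Upsilon> \<Longrightarrow>
        cmod (inner_state (cuboid r (\<lambda>_. L)) \<Upsilon> (correlation (cuboid r (\<lambda>_. L)) x \<Upsilon>)) \<le> C / real L"
      using main[of U t x] by blast
    show "\<exists>C :: real. \<forall>\<Lambda> N1 N2 \<Upsilon>.
        is_cube \<Lambda> \<and> \<rho>1 = real N1 / real (card \<Lambda>) \<and> \<rho>2 = real N2 / real (card \<Lambda>) \<and> ground_state \<Lambda> t U N1 N2 \<Upsilon> \<longrightarrow>
        cmod (inner_state \<Lambda> \<Upsilon> (correlation \<Lambda> x \<Upsilon>)) \<le> C * real (card \<Lambda>) powr (- 1 / real CARD('d))"
    proof (intro exI[of _ C] allI impI, elim conjE)
      fix \<Lambda> :: "'d site set" and N1 N2 \<Upsilon>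
      assume cube: "is_cube \<Lambda>" and \<rho>1: "\<rho>1 = real N1 / real (card \<Lambda>)" and \<rho>2: "\<rho>2 = real N2 / real (card \<Lambda>)"
        and ground: "ground_state \<Lambda> t U N1 N2 \<Upsilon>"
      obtain r L where L: "L > 0" and \<Lambda>: "\<Lambda> = cuboid r (\<lambda>_. L)" using is_cubeE[OF cube] by blast
      have "card \<Lambda> = L ^ CARD('d)" by (simp add: \<Lambda> card_cuboid)
      then have "real N1 = \<rho>1 * real (L ^ CARD('d))" "real N2 = \<rho>2 * real (L ^ CARD('d))"
        using L by (simp_all add: \<rho>1 \<rho>2)
      then have "cmod (inner_state \<Lambda> \<Upsilon> (correlation \<Lambda> x \<Upsilon>)) \<le> C / real L"
        using C[OF L] ground unfolding \<Lambda> by blast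
      then show "cmod (inner_state \<Lambda> \<Upsilon> (correlation \<Lambda> x \<Upsilon>)) \<le> C * real (card \<Lambda>) powr (- 1 / real CARD('d))"
        unfolding \<Lambda> card_cube_powr[OF L] by simp
    qed
  qed
qed

end
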